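(* Let $p$ be a prime and let $X$ be a free simplicial pro-$p$-resolution of a pro-$p$-group $G$. Then for every $m>0$ the spectral sequence $E^1_{*,m}(X)$ converges to $\pi_m(G)=0$ ($G$ regarded as a constant simplicial group), and the spectral sequence $\bar E^1_{*,m}(X)$ converges to $H_m(X)=\pi_m(\mathbb{F}_p[[X]])=0$.
   Context: A free simplicial pro-$p$-resolution of $G$ is a simplicial pro-$p$-group $X$ with $\pi_n(X)=0$ for $n>0$, $\pi_0(X)=G$, having a CW-basis: each $X_n$ is free pro-$p$ on a (pointed) profinite space $\mathcal{F}_n$ (base point the identity), $s_i(\mathcal{F}_n)\subset\mathcal{F}_{n+1}$ for $0\le i\le n$, and $\mathcal{F}_{n+1}=\bigcup_{i=0}^{n}s_i(\mathcal{F}_n)\uplus Y_{n+1}$ with $Y_{n+1}$ closed (disjoint up to the base point). $\pi_m$ is the $m$-th homology of the Moore complex $N_m=\bigcap_{i<m}\ker d_i$ with differential $d_m$. For a pro-$p$-group $H$, $\Delta^n(H)$ is the $n$-th (closed) power of the augmentation ideal of $\mathbb{F}_p[[H]]$ and $\mathcal{M}_n(H)=\{h\in H:h-1\in\Delta^n(H)\}$; for simplicial $X$ these are applied degreewise. The long exact homotopy sequences of $1\to\mathcal{M}_n(X)/\mathcal{M}_{n+1}(X)\to X/\mathcal{M}_{n+1}(X)\to X/\mathcal{M}_n(X)\to1$ form an exact couple with $E^1_{n,m}=\pi_m(\mathcal{M}_n(X)/\mathcal{M}_{n+1}(X))$ and $D^1_{n,m}=\pi_m(X/\mathcal{M}_n(X))$,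 giving a spectral sequence $E^r_{n,m}(X)$ with $d^r:E^r_{n,m}\to E^r_{n+r,m-1}$. Likewise $0\to\Delta^n(X)/\Delta^{n+1}(X)\to\mathbb{F}_p[[X]]/\Delta^{n+1}(X)\to\mathbb{F}_p[[X]]/\Delta^n(X)\to0$ gives $\bar E^r_{n,m}(X)$ with $\bar E^1_{n,m}=\pi_m(\Delta^n(X)/\Delta^{n+1}(X))$ and $\bar d^r:\bar E^r_{n,m}\to\bar E^r_{n+r,m-1}$. Convergence to a filtered object means that $E^\infty_{n,m}$ is the $n$-th associated graded piece, for the filtration of $\pi_m(X)$ (resp. $\pi_m(\mathbb{F}_p[[X]])$) by the kernels of the maps to $\pi_m(X/\mathcal{M}_n(X))$ (resp. $\pi_m(\mathbb{F}_p[[X]]/\Delta^n(X))$), where $E^\infty_{n,m}=\bigcap_rZ^r_{n,m}/\bigcup_rB^r_{n,m}$ is the quotient of permanent cycles by boundaries. Convergence to $0$ thus means $E^\infty_{n,m}=0$ (resp. $\bar E^\infty_{n,m}=0$) for all $n$. *)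

theory Defs
  imports "HOL-Analysis.Analysis" "HOL-Algebra.Elementary_Groups" "HOL-Algebra.Ideal_Product"
    "HOL-Number_Theory.Residues"
begin

section \<open>Pro-p groups\<close>

definition topological_group_on :: "'a monoid \<Rightarrow> 'a topology \<Rightarrow> bool" where
  "topological_group_on G T \<longleftrightarrow>
     group G \<and> topspace T = carrier G \<and>
     continuous_map (prod_topology T T) T (\<lambda>(x, y). x \<otimes>\<^bsub>G\<^esub> y) \<and>
     continuous_map T T (\<lambda>x. inv\<^bsub>G\<^esub> x)"

definition open_normal_subgroups :: "'a monoid \<Rightarrow> 'a topology \<Rightarrow> 'a set set" where
  "open_normal_subgroups G T = {U. U \<lhd> G \<and> openin T U}"

definition pro_p_group :: "nat \<Rightarrow> 'a monoid \<Rightarrow> 'a topology \<Rightarrow> bool" where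
  "pro_p_group p G T \<longleftrightarrow>
     topological_group_on G T \<and> compact_space T \<and> Hausdorff_space T \<and>
     (\<forall>x\<in>carrier G. connected_component_of_set T x = {x}) \<and>
     (\<forall>U\<in>open_normal_subgroups G T. \<exists>k. card (rcosets\<^bsub>G\<^esub> U) = p ^ k)"

definition extends_uniquely_to_hom ::
    "'a monoid \<Rightarrow> 'a topology \<Rightarrow> 'a set \<Rightarrow> 'b monoid \<Rightarrow> 'b topology \<Rightarrow> ('a \<Rightarrow> 'b) \<Rightarrow> bool" where
  "extends_uniquely_to_hom A TA F H TH f \<longleftrightarrow>
     (\<exists>h. h \<in> hom A H \<and> continuous_map TA TH h \<and> (\<forall>x\<in>F. h x = f x) \<and>
        (\<forall>h'. h' \<in> hom A H \<and> continuous_map TA TH h' \<and> (\<forall>x\<in>F. h' x = f x)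
               \<longrightarrow> (\<forall>x\<in>carrier A. h' x = h x)))"

text \<open>
  A is the free pro-p group on its closed subspace F, pointed by the identity.
  HOL cannot quantify over all types inside a formula; the test groups H range over
  all pro-p groups with elements in the type \<open>('a \<times> nat) set set\<close>.  Up to isomorphism this
  is no restriction: a pro-p group topologically generated by an image of F
  embeds into the product of its finite quotients, and these are determined by the countably many
  finite p-groups with locally constant maps from F into them; so the cardinality of
  the group is at most that of the type.  In particular all finite p-groups occur.
\<close>

definition free_pro_p_on :: "nat \<Rightarrow> 'a monoid \<Rightarrow> 'a topology \<Rightarrow> 'a set \<Rightarrow> bool" where
  "free_pro_p_on p A TA F \<longleftrightarrow>
     pro_p_group p A TA \<and> closedin TA F \<and> \<one>\<^bsub>A\<^esub> \<in> F \<and>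
     (\<forall>(H :: ('a \<times> nat) set set monoid) TH f.
        pro_p_group p H TH \<and> continuous_map (subtopology TA F) TH f \<and> f \<one>\<^bsub>A\<^esub> = \<one>\<^bsub>H\<^esub>
          \<longrightarrow> extends_uniquely_to_hom A TA F H TH f)"


section \<open>Simplicial groups and their homotopy groups\<close>

text \<open>
  \<open>face S m i\<close> maps \<open>obj S m\<close> to \<open>obj S (m - 1)\<close> and is meaningful for \<open>m > 0\<close> and \<open>i \<le> m\<close>;
  \<open>degen S m i\<close> maps \<open>obj S m\<close> to \<open>obj S (Suc m)\<close> and is meaningful for \<open>i \<le> m\<close>.
\<close>

record 'a simplicial =
  obj :: "nat \<Rightarrow> 'a monoid"
  face :: "nat \<Rightarrow> nat \<Rightarrow> 'a \<Rightarrow> 'a"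
  degen :: "nat \<Rightarrow> nat \<Rightarrow> 'a \<Rightarrow> 'a"

definition simplicial_group :: "'a simplicial \<Rightarrow> bool" where
  "simplicial_group S \<longleftrightarrow>
     (\<forall>m. group (obj S m)) \<and>
     (\<forall>m i. i \<le> Suc m \<longrightarrow> face S (Suc m) i \<in> hom (obj S (Suc m)) (obj S m)) \<and>
     (\<forall>m i. i \<le> m \<longrightarrow> degen S m i \<in> hom (obj S m) (obj S (Suc m))) \<and>
     (\<forall>m i j. \<forall>x\<in>carrier (obj S (Suc (Suc m))). i < j \<and> j \<le> Suc (Suc m) \<longrightarrow>
        face S (Suc m) i (face S (Suc (Suc m)) j x) =
        face S (Suc m) (j - 1) (face S (Suc (Suc m)) i x)) \<and>
     (\<forall>m i j. \<forall>x\<in>carrier (obj S m). i \<le> Suc m \<and> j \<le> m \<longrightarrow>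
        face S (Suc m) i (degen S m j x) =
          (if i < j then degen S (m - 1) (j - 1) (face S m i x)
           else if i = j \<or> i = Suc j then x
           else degen S (m - 1) j (face S m (i - 1) x))) \<and>
     (\<forall>m i j. \<forall>x\<in>carrier (obj S m). i \<le> j \<and> j \<le> m \<longrightarrow>
        degen S (Suc m) i (degen S m j x) = degen S (Suc m) (Suc j) (degen S m i x))"

definition const_simplicial :: "'a monoid \<Rightarrow> 'a simplicial" where
  "const_simplicial G = \<lparr>obj = \<lambda>m. G, face = \<lambda>m i x. x, degen = \<lambda>m i x. x\<rparr>"

definition moore :: "'a simplicial \<Rightarrow> nat \<Rightarrow> 'a set" where
  "moore S m = {x \<in> carrier (obj S m). \<forall>i<m. face S m i x = \<one>\<^bsub>obj S (m - 1)\<^esub>}"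

definition moore_cycles :: "'a simplicial \<Rightarrow> nat \<Rightarrow> 'a set" where
  "moore_cycles S m = {x \<in> moore S m. m > 0 \<longrightarrow> face S m m x = \<one>\<^bsub>obj S (m - 1)\<^esub>}"

definition moore_boundaries :: "'a simplicial \<Rightarrow> nat \<Rightarrow> 'a set" where
  "moore_boundaries S m = face S (Suc m) (Suc m) ` moore S (Suc m)"

definition homotopy_group :: "'a simplicial \<Rightarrow> nat \<Rightarrow> 'a set monoid" where
  "homotopy_group S m =
     ((obj S m)\<lparr>carrier := moore_cycles S m\<rparr>) Mod moore_boundaries S m"

text \<open>The map induced on homotopy groups by a simplicial homomorphism f into S; the
  product with the boundaries turns the image of a coset into a full coset.\<close>

definition homotopy_map :: "'b simplicial \<Rightarrow> (nat \<Rightarrow> 'a \<Rightarrow> 'b) \<Rightarrow> nat \<Rightarrow> 'a set \<Rightarrow> 'b set" where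
  "homotopy_map S f m \<xi> = moore_boundaries S m <#>\<^bsub>obj S m\<^esub> f m ` \<xi>"

definition subquotient :: "'a simplicial \<Rightarrow> (nat \<Rightarrow> 'a set) \<Rightarrow> (nat \<Rightarrow> 'a set) \<Rightarrow> 'a set simplicial" where
  "subquotient S A B =
     \<lparr>obj = \<lambda>m. ((obj S m)\<lparr>carrier := A m\<rparr>) Mod B m,
      face = \<lambda>m i C. B (m - 1) <#>\<^bsub>obj S (m - 1)\<^esub> face S m i ` C,
      degen = \<lambda>m i C. B (Suc m) <#>\<^bsub>obj S (Suc m)\<^esub> degen S m i ` C\<rparr>"


section \<open>Free simplicial pro-p resolutions\<close>

definition simplicial_pro_p_group :: "nat \<Rightarrow> 'a simplicial \<Rightarrow> (nat \<Rightarrow> 'a topology) \<Rightarrow> bool" where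
  "simplicial_pro_p_group p X T \<longleftrightarrow>
     simplicial_group X \<and>
     (\<forall>m. pro_p_group p (obj X m) (T m)) \<and>
     (\<forall>m i. i \<le> Suc m \<longrightarrow> continuous_map (T (Suc m)) (T m) (face X (Suc m) i)) \<and>
     (\<forall>m i. i \<le> m \<longrightarrow> continuous_map (T m) (T (Suc m)) (degen X m i))"

definition is_CW_basis ::
    "nat \<Rightarrow> 'a simplicial \<Rightarrow> (nat \<Rightarrow> 'a topology) \<Rightarrow> (nat \<Rightarrow> 'a set) \<Rightarrow> bool" where
  "is_CW_basis p X T F \<longleftrightarrow>
     (\<forall>m. free_pro_p_on p (obj X m) (T m) (F m)) \<and>
     (\<forall>m i. i \<le> m \<longrightarrow> degen X m i ` F m \<subseteq> F (Suc m)) \<and>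
     (\<forall>m. \<exists>Y. closedin (T (Suc m)) Y \<and>
            F (Suc m) = (\<Union>i\<le>m. degen X m i ` F m) \<union> Y \<and>
            (\<Union>i\<le>m. degen X m i ` F m) \<inter> Y \<subseteq> {\<one>\<^bsub>obj X (Suc m)\<^esub>})"

text \<open>The second condition says that \<open>\<pi>\<^sub>0(X)\<close>, with the quotient topology, is isomorphic to G.\<close>

definition free_simplicial_pro_p_resolution ::
    "nat \<Rightarrow> 'a simplicial \<Rightarrow> (nat \<Rightarrow> 'a topology) \<Rightarrow> 'b monoid \<Rightarrow> 'b topology \<Rightarrow> bool" where
  "free_simplicial_pro_p_resolution p X T G TG \<longleftrightarrow>
     simplicial_pro_p_group p X T \<and>
     (\<exists>\<phi>\<in>iso (homotopy_group X 0) G.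
        quotient_map (T 0) TG (\<lambda>x. \<phi> (moore_boundaries X 0 #>\<^bsub>obj X 0\<^esub> x))) \<and>
     (\<forall>m>0. trivial_group (homotopy_group X m)) \<and>
     (\<exists>F. is_CW_basis p X T F)"


section \<open>Completed group algebras\<close>

definition group_ring :: "'r ring \<Rightarrow> 'g monoid \<Rightarrow> ('g \<Rightarrow> 'r) ring" where
  "group_ring R K =
     \<lparr>carrier = carrier K \<rightarrow>\<^sub>E carrier R,
      mult = \<lambda>f g. \<lambda>x\<in>carrier K. \<Oplus>\<^bsub>R\<^esub>y\<in>carrier K. f y \<otimes>\<^bsub>R\<^esub> g (inv\<^bsub>K\<^esub> y \<otimes>\<^bsub>K\<^esub> x),
      one = \<lambda>x\<in>carrier K. if x = \<one>\<^bsub>K\<^esub> then \<one>\<^bsub>R\<^esub> else \<zero>\<^bsub>R\<^esub>,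
      zero = \<lambda>x\<in>carrier K. \<zero>\<^bsub>R\<^esub>,
      add = \<lambda>f g. \<lambda>x\<in>carrier K. f x \<oplus>\<^bsub>R\<^esub> g x\<rparr>"

text \<open>The linear extension of q from the basis K to the basis L.\<close>

definition push_forward ::
    "'r ring \<Rightarrow> 'g monoid \<Rightarrow> 'h monoid \<Rightarrow> ('g \<Rightarrow> 'h) \<Rightarrow> ('g \<Rightarrow> 'r) \<Rightarrow> 'h \<Rightarrow> 'r" where
  "push_forward R K L q f = (\<lambda>l\<in>carrier L. \<Oplus>\<^bsub>R\<^esub>k\<in>{k \<in> carrier K. q k = l}. f k)"

abbreviation Fp :: "nat \<Rightarrow> int ring" where
  "Fp p \<equiv> residue_ring (int p)"

type_synonym 'a cga = "'a set \<Rightarrow> 'a set \<Rightarrow> int"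

text \<open>\<open>\<bbbF>\<^sub>p[[H]]\<close> as the inverse limit of the group rings \<open>\<bbbF>\<^sub>p[H/U]\<close> over the open normal subgroups U:
  an element is the compatible family of its components \<open>c U\<close>.\<close>

definition completed_group_algebra :: "nat \<Rightarrow> 'a monoid \<Rightarrow> 'a topology \<Rightarrow> 'a cga ring" where
  "completed_group_algebra p H T =
    (let I = open_normal_subgroups H T in
     \<lparr>carrier = {c \<in> (\<Pi>\<^sub>E U\<in>I. carrier (group_ring (Fp p) (H Mod U))).
                  \<forall>U\<in>I. \<forall>V\<in>I. U \<subseteq> V \<longrightarrow>
                    push_forward (Fp p) (H Mod U) (H Mod V) (\<lambda>C. V <#>\<^bsub>H\<^esub> C) (c U) = c V},
      mult = \<lambda>c d. \<lambda>U\<in>I. c U \<otimes>\<^bsub>group_ring (Fp p) (H Mod U)\<^esub> d U,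
      one = \<lambda>U\<in>I. \<one>\<^bsub>group_ring (Fp p) (H Mod U)\<^esub>,
      zero = \<lambda>U\<in>I. \<zero>\<^bsub>group_ring (Fp p) (H Mod U)\<^esub>,
      add = \<lambda>c d. \<lambda>U\<in>I. c U \<oplus>\<^bsub>group_ring (Fp p) (H Mod U)\<^esub> d U\<rparr>)"

definition cga_topology :: "nat \<Rightarrow> 'a monoid \<Rightarrow> 'a topology \<Rightarrow> 'a cga topology" where
  "cga_topology p H T =
     subtopology
       (product_topology (\<lambda>U. discrete_topology (carrier (group_ring (Fp p) (H Mod U))))
          (open_normal_subgroups H T))
       (carrier (completed_group_algebra p H T))"

definition cga_of :: "nat \<Rightarrow> 'a monoid \<Rightarrow> 'a topology \<Rightarrow> 'a \<Rightarrow> 'a cga" where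
  "cga_of p H T h =
     (\<lambda>U\<in>open_normal_subgroups H T. \<lambda>C\<in>carrier (H Mod U).
        if C = U #>\<^bsub>H\<^esub> h then \<one>\<^bsub>Fp p\<^esub> else \<zero>\<^bsub>Fp p\<^esub>)"

text \<open>The map \<open>\<bbbF>\<^sub>p[[H]] \<rightarrow> \<bbbF>\<^sub>p[[K]]\<close> induced by a continuous homomorphism f from H to K.\<close>

definition cga_map ::
    "nat \<Rightarrow> 'a monoid \<Rightarrow> 'b monoid \<Rightarrow> 'b topology \<Rightarrow> ('a \<Rightarrow> 'b) \<Rightarrow> 'a cga \<Rightarrow> 'b cga" where
  "cga_map p H K TK f c =
     (\<lambda>V\<in>open_normal_subgroups K TK.
        let U = {h \<in> carrier H. f h \<in> V} in
        push_forward (Fp p) (H Mod U) (K Mod V) (\<lambda>C. V <#>\<^bsub>K\<^esub> f ` C) (c U))"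

definition augmentation_ideal :: "nat \<Rightarrow> 'a monoid \<Rightarrow> 'a topology \<Rightarrow> 'a cga set" where
  "augmentation_ideal p H T =
     {c \<in> carrier (completed_group_algebra p H T).
        \<forall>U\<in>open_normal_subgroups H T. (\<Oplus>\<^bsub>Fp p\<^esub>C\<in>carrier (H Mod U). c U C) = \<zero>\<^bsub>Fp p\<^esub>}"

primrec augmentation_power :: "nat \<Rightarrow> 'a monoid \<Rightarrow> 'a topology \<Rightarrow> nat \<Rightarrow> 'a cga set" where
  "augmentation_power p H T 0 = carrier (completed_group_algebra p H T)"
| "augmentation_power p H T (Suc n) =
     ideal_prod (completed_group_algebra p H T) (augmentation_power p H T n) (augmentation_ideal p H T)"

definition Delta :: "nat \<Rightarrow> 'a monoid \<Rightarrow> 'a topology \<Rightarrow> nat \<Rightarrow> 'a cga set" where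
  "Delta p H T n = (cga_topology p H T) closure_of (augmentation_power p H T n)"

definition MM :: "nat \<Rightarrow> 'a monoid \<Rightarrow> 'a topology \<Rightarrow> nat \<Rightarrow> 'a set" where
  "MM p H T n =
     {h \<in> carrier H.
        cga_of p H T h \<ominus>\<^bsub>completed_group_algebra p H T\<^esub> \<one>\<^bsub>completed_group_algebra p H T\<^esub>
          \<in> Delta p H T n}"

definition cga_simplicial :: "nat \<Rightarrow> 'a simplicial \<Rightarrow> (nat \<Rightarrow> 'a topology) \<Rightarrow> 'a cga simplicial" where
  "cga_simplicial p X T =
     \<lparr>obj = \<lambda>m. add_monoid (completed_group_algebra p (obj X m) (T m)),
      face = \<lambda>m i. cga_map p (obj X m) (obj X (m - 1)) (T (m - 1)) (face X m i),
      degen = \<lambda>m i. cga_map p (obj X m) (obj X (Suc m)) (T (Suc m)) (degen X m i)\<rparr>"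


section \<open>The spectral sequence of an exact couple\<close>

text \<open>
  Exact couples of the shape needed here, with indices n (filtration) and m (degree) and

    \<^item> \<open>imap C n m\<close> from \<open>D(n + 1, m)\<close> to \<open>D(n, m)\<close>,
    \<^item> \<open>kmap C n m\<close> from \<open>E(n, m)\<close> to \<open>D(n + 1, m)\<close>,
    \<^item> \<open>bmap C n m\<close> from \<open>D(n, m + 1)\<close> to \<open>E(n, m)\<close>.

  Negative indices are omitted; the groups there are trivial in the cases considered.
\<close>

record ('d, 'e) couple =
  Dgrp :: "nat \<Rightarrow> nat \<Rightarrow> 'd monoid"
  Egrp :: "nat \<Rightarrow> nat \<Rightarrow> 'e monoid"
  imap :: "nat \<Rightarrow> nat \<Rightarrow> 'd \<Rightarrow> 'd"
  kmap :: "nat \<Rightarrow> nat \<Rightarrow> 'e \<Rightarrow> 'd"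
  bmap :: "nat \<Rightarrow> nat \<Rightarrow> 'd \<Rightarrow> 'e"

text \<open>The composite \<open>D(n + t, m) \<rightarrow> D(n, m)\<close>.\<close>

primrec imap_iter :: "('d, 'e) couple \<Rightarrow> nat \<Rightarrow> nat \<Rightarrow> nat \<Rightarrow> 'd \<Rightarrow> 'd" where
  "imap_iter C 0 n m w = w"
| "imap_iter C (Suc t) n m w = imap_iter C t n m (imap C (n + t) m w)"

definition page_of ::
    "('d, 'e) couple \<Rightarrow> (nat \<Rightarrow> nat \<Rightarrow> 'e set) \<Rightarrow> (nat \<Rightarrow> nat \<Rightarrow> 'e set) \<Rightarrow> nat \<Rightarrow> nat \<Rightarrow> 'e set monoid" where
  "page_of C Z B n m = ((Egrp C n m)\<lparr>carrier := Z n m\<rparr>) Mod B n m"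

text \<open>
  The differential \<open>d\<^sup>r\<close> from \<open>E\<^sup>r(n, m + 1)\<close> to \<open>E\<^sup>r(n + r, m)\<close>, where \<open>E\<^sup>r = Z/B\<close> and \<open>r \<ge> 1\<close>:
  the class of x goes to the class of \<open>\<partial>w\<close>, where w in \<open>D(n + r, m + 1)\<close> maps
  to \<open>k x\<close> under the (r - 1)-fold composite of \<open>i\<close>.
\<close>

definition page_diff ::
    "('d, 'e) couple \<Rightarrow> (nat \<Rightarrow> nat \<Rightarrow> 'e set) \<Rightarrow> nat \<Rightarrow> nat \<Rightarrow> nat \<Rightarrow> 'e set \<Rightarrow> 'e set" where
  "page_diff C B r n m \<xi> =
     B (n + r) m <#>\<^bsub>Egrp C (n + r) m\<^esub>
       {bmap C (n + r) m w | w. w \<in> carrier (Dgrp C (n + r) (Suc m)) \<and>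
          imap_iter C (r - 1) (Suc n) (Suc m) w \<in> kmap C n (Suc m) ` \<xi>}"

text \<open>
  The subgroups \<open>Z\<^sup>r\<close> and \<open>B\<^sup>r\<close> of \<open>E\<^sup>1\<close> for \<open>r = t + 1\<close>, determined recursively by
  \<open>E\<^sup>r = Z\<^sup>r/B\<^sup>r\<close> and \<open>E\<^sup>r\<^sup>+\<^sup>1 = ker d\<^sup>r / im d\<^sup>r\<close>.  The differential vanishes on
  degree 0, and nothing maps into filtration degrees below r.
\<close>

primrec cycles_boundaries ::
    "('d, 'e) couple \<Rightarrow> nat \<Rightarrow> (nat \<Rightarrow> nat \<Rightarrow> 'e set) \<times> (nat \<Rightarrow> nat \<Rightarrow> 'e set)" where
  "cycles_boundaries C 0 = (\<lambda>n m. carrier (Egrp C n m), \<lambda>n m. {\<one>\<^bsub>Egrp C n m\<^esub>})"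
| "cycles_boundaries C (Suc t) =
    (let Z = fst (cycles_boundaries C t); B = snd (cycles_boundaries C t); r = Suc t in
     (\<lambda>n m. case m of
          0 \<Rightarrow> Z n 0
        | Suc m' \<Rightarrow> {x \<in> Z n (Suc m').
             page_diff C B r n m' (B n (Suc m') #>\<^bsub>Egrp C n (Suc m')\<^esub> x) = \<one>\<^bsub>page_of C Z B (n + r) m'\<^esub>},
      \<lambda>n m. if n < r then B n m
        else \<Union>(page_diff C B r (n - r) m ` carrier (page_of C Z B (n - r) (Suc m)))))"

definition Zr :: "('d, 'e) couple \<Rightarrow> nat \<Rightarrow> nat \<Rightarrow> nat \<Rightarrow> 'e set" where
  "Zr C r = fst (cycles_boundaries C (r - 1))"

definition Br :: "('d, 'e) couple \<Rightarrow> nat \<Rightarrow> nat \<Rightarrow> nat \<Rightarrow> 'e set" where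
  "Br C r = snd (cycles_boundaries C (r - 1))"

definition E_infinity :: "('d, 'e) couple \<Rightarrow> nat \<Rightarrow> nat \<Rightarrow> 'e set monoid" where
  "E_infinity C n m = page_of C (\<lambda>n m. \<Inter>r\<in>{1..}. Zr C r n m) (\<lambda>n m. \<Union>r\<in>{1..}. Br C r n m) n m"

text \<open>
  Convergence in degree m to a group P with compatible maps \<open>\<kappa> n\<close> to \<open>D(n, m)\<close>,
  filtered by the kernels of these maps.  The isomorphism of the n-th graded piece with
  \<open>E\<^sup>\<infinity>(n, m)\<close> is the canonical one: the class of x corresponds to the class of e if \<open>k e = \<kappa> (n + 1) x\<close>.
\<close>

definition converges_to ::
    "('d, 'e) couple \<Rightarrow> nat \<Rightarrow> 'c monoid \<Rightarrow> (nat \<Rightarrow> 'c \<Rightarrow> 'd) \<Rightarrow> bool" where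
  "converges_to C m P \<kappa> \<longleftrightarrow>
     (let F = (\<lambda>n. kernel P (Dgrp C n m) (\<kappa> n)) in
      \<forall>n. \<exists>\<phi>\<in>iso ((P\<lparr>carrier := F n\<rparr>) Mod F (Suc n)) (E_infinity C n m).
        \<forall>x\<in>F n. \<forall>e\<in>\<phi> (F (Suc n) #>\<^bsub>P\<^esub> x). kmap C n m e = \<kappa> (Suc n) x)"


section \<open>The spectral sequence of a filtered simplicial group\<close>

text \<open>\<open>Fil n m\<close> is the n-th filtration subgroup of \<open>obj S m\<close>.\<close>

definition quot :: "'a simplicial \<Rightarrow> (nat \<Rightarrow> nat \<Rightarrow> 'a set) \<Rightarrow> nat \<Rightarrow> 'a set simplicial" where
  "quot S Fil n = subquotient S (\<lambda>m. carrier (obj S m)) (Fil n)"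

definition graded :: "'a simplicial \<Rightarrow> (nat \<Rightarrow> nat \<Rightarrow> 'a set) \<Rightarrow> nat \<Rightarrow> 'a set simplicial" where
  "graded S Fil n = subquotient S (Fil n) (Fil (Suc n))"

definition quot_proj :: "'a simplicial \<Rightarrow> (nat \<Rightarrow> nat \<Rightarrow> 'a set) \<Rightarrow> nat \<Rightarrow> nat \<Rightarrow> 'a set \<Rightarrow> 'a set" where
  "quot_proj S Fil n m C = Fil n m <#>\<^bsub>obj S m\<^esub> C"

text \<open>
  The connecting homomorphism \<open>\<pi>\<^sub>m\<^sub>+\<^sub>1(S/Fil n) \<rightarrow> \<pi>\<^sub>m(Fil n/Fil (n + 1))\<close>: lift a representing cycle
  to a Moore chain y of \<open>S/Fil (n + 1)\<close> and apply the differential.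
\<close>

definition connecting_map ::
    "'a simplicial \<Rightarrow> (nat \<Rightarrow> nat \<Rightarrow> 'a set) \<Rightarrow> nat \<Rightarrow> nat \<Rightarrow> 'a set set \<Rightarrow> 'a set set" where
  "connecting_map S Fil n m \<zeta> =
     moore_boundaries (graded S Fil n) m <#>\<^bsub>obj (graded S Fil n) m\<^esub>
       {face (quot S Fil (Suc n)) (Suc m) (Suc m) y | y.
          y \<in> moore (quot S Fil (Suc n)) (Suc m) \<and> quot_proj S Fil n (Suc m) y \<in> \<zeta>}"

text \<open>\<open>kmap\<close> is induced by the inclusion of \<open>Fil n/Fil (n + 1)\<close> into \<open>S/Fil (n + 1)\<close>, which is the identity on
  cosets.\<close>

definition filtration_couple ::
    "'a simplicial \<Rightarrow> (nat \<Rightarrow> nat \<Rightarrow> 'a set) \<Rightarrow> ('a set set, 'a set set) couple" where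
  "filtration_couple S Fil =
     \<lparr>Dgrp = \<lambda>n m. homotopy_group (quot S Fil n) m,
      Egrp = \<lambda>n m. homotopy_group (graded S Fil n) m,
      imap = \<lambda>n m. homotopy_map (quot S Fil n) (quot_proj S Fil n) m,
      kmap = \<lambda>n m. homotopy_map (quot S Fil (Suc n)) (\<lambda>m C. C) m,
      bmap = connecting_map S Fil\<rparr>"

definition limit_map :: "'a simplicial \<Rightarrow> (nat \<Rightarrow> nat \<Rightarrow> 'a set) \<Rightarrow> nat \<Rightarrow> nat \<Rightarrow> 'a set \<Rightarrow> 'a set set" where
  "limit_map S Fil m n = homotopy_map (quot S Fil n) (\<lambda>m x. Fil n m #>\<^bsub>obj S m\<^esub> x) m"

definition M_filtration :: "nat \<Rightarrow> 'a simplicial \<Rightarrow> (nat \<Rightarrow> 'a topology) \<Rightarrow> nat \<Rightarrow> nat \<Rightarrow> 'a set" where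
  "M_filtration p X T n m = MM p (obj X m) (T m) n"

definition Delta_filtration ::
    "nat \<Rightarrow> 'a simplicial \<Rightarrow> (nat \<Rightarrow> 'a topology) \<Rightarrow> nat \<Rightarrow> nat \<Rightarrow> 'a cga set" where
  "Delta_filtration p X T n m = Delta p (obj X m) (T m) n"

definition M_couple ::
    "nat \<Rightarrow> 'a simplicial \<Rightarrow> (nat \<Rightarrow> 'a topology) \<Rightarrow> ('a set set, 'a set set) couple" where
  "M_couple p X T = filtration_couple X (M_filtration p X T)"

definition Delta_couple ::
    "nat \<Rightarrow> 'a simplicial \<Rightarrow> (nat \<Rightarrow> 'a topology) \<Rightarrow> ('a cga set set, 'a cga set set) couple" where
  "Delta_couple p X T = filtration_couple (cga_simplicial p X T) (Delta_filtration p X T)"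

definition homology_group :: "nat \<Rightarrow> 'a simplicial \<Rightarrow> (nat \<Rightarrow> 'a topology) \<Rightarrow> nat \<Rightarrow> 'a cga set monoid" where
  "homology_group p X T m = homotopy_group (cga_simplicial p X T) m"

end

theory Submission
  imports Defs "HOL-Algebra.Group_Action"
begin

text \<open>
  Let \<open>S\<close> be a simplicial compact group with a filtration by closed normal simplicial subgroups with trivial
  intersection and with \<open>\<pi>\<^sub>m(S) = 0\<close>.  In the exact couple, \<open>E\<^sup>\<infinity>(n, m)\<close> embeds into the classes of
  \<open>\<pi>\<^sub>m(S/Fil (n + 1))\<close> that lift to \<open>\<pi>\<^sub>m(S/Fil (n + r))\<close> for all \<open>r\<close>.  By compactness these lift to \<open>\<pi>\<^sub>m(S)\<close>, so they
  vanish.  The powers of the augmentation ideal have trivial intersection because the augmentation ideal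
  of the group algebra of a finite p-group is nilpotent; this also separates the dimension subgroups.

  That \<open>\<pi>\<^sub>m(\<bbbF>\<^sub>p[[X]]) = 0\<close> follows from an extra degeneracy \<open>s\<^sub>m : X\<^sub>m \<rightarrow> X\<^sub>m\<^sub>+\<^sub>1\<close>, a family of continuous maps with
  \<open>d\<^sub>m\<^sub>+\<^sub>1 s\<^sub>m = id\<close> and \<open>d\<^sub>i s\<^sub>m = s\<^sub>m\<^sub>-\<^sub>1 d\<^sub>i\<close> for \<open>i \<le> m\<close>: since \<open>X\<close> is acyclic, the prescribed faces always have a filler, and
  fillers can be chosen continuously because surjections of profinite groups have continuous sections.  The
  \<open>s\<^sub>m\<close> are not homomorphisms, but they still act on \<open>\<bbbF>\<^sub>p[[X\<^sub>m]]\<close>, and a Moore cycle is the last face of its image.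
\<close>

text \<open>Passing from H to the completed group algebra is not additive, so acyclicity of X does
  not carry over by exactness. A contraction of the underlying spaces does carry over, since linear
  extension applies to any continuous map. As \<open>\<pi>_0(X) = G\<close> need not be a point, the
  contraction ends at G: in degree 0, \<open>d_0 s_0\<close> is x -> sec (f x) for the projection f
  from \<open>X_0\<close> to G and a continuous section sec. Only positive degrees are killed.

  Sections come from minimal closed sets meeting every fibre. Minimality alone gives no grip on how
  such a set meets the fibres. If all these intersections are cosets of one subgroup, shrinking them
  amounts to finitely many choices modulo an open normal subgroup, which keeps the set closed.

  The homotopy groups of the quotients may be infinite, so lifting through the whole tower rests on
  nested closed sets of representatives rather than on stabilising images. Nilpotency of the
  augmentation ideal rests on orbit counting: a p-group acting on a nontrivial finite p-group fixes
  a nontrivial element.\<close>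

lemma set_multI: "h \<in> H \<Longrightarrow> k \<in> K \<Longrightarrow> h \<otimes>\<^bsub>G\<^esub> k \<in> H <#>\<^bsub>G\<^esub> K"
  by (auto simp: set_mult_def)

lemma (in group) carrier_normal: "carrier G \<lhd> G"
  by (simp add: normal_inv_iff subgroup_self)

lemma topological_group_on_mult:
  assumes "topological_group_on G T" "continuous_map Y T f" "continuous_map Y T g"
  shows "continuous_map Y T (\<lambda>y. f y \<otimes>\<^bsub>G\<^esub> g y)"
proof -
  have "continuous_map Y (prod_topology T T) (\<lambda>y. (f y, g y))"
    using assms(2,3) by (simp add: continuous_map_pairwise comp_def)
  moreover have "continuous_map (prod_topology T T) T (\<lambda>(x, y). x \<otimes>\<^bsub>G\<^esub> y)"
    using assms(1) by (simp add: topological_group_on_def)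
  ultimately have "continuous_map Y T ((\<lambda>(x, y). x \<otimes>\<^bsub>G\<^esub> y) \<circ> (\<lambda>y. (f y, g y)))"
    by (rule continuous_map_compose)
  then show ?thesis by (simp add: comp_def)
qed

section \<open>Exact couples\<close>

text \<open>Exactness of \<open>imap\<close> followed by \<open>bmap\<close> is asked in positive
  degree, where \<open>bmap\<close> starts. \<open>D_zero\<close> reflects that the quotient by the
  zeroth filtration subgroup is trivial; because of it the boundaries in a fixed filtration degree
  become stationary.\<close>

locale exact_couple =
  fixes C :: "('d, 'e) couple"
  assumes group_D: "group (Dgrp C n m)"
    and group_E: "group (Egrp C n m)"
    and imap_hom: "imap C n m \<in> hom (Dgrp C (Suc n) m) (Dgrp C n m)"
    and kmap_hom: "kmap C n m \<in> hom (Egrp C n m) (Dgrp C (Suc n) m)"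
    and bmap_hom: "bmap C n m \<in> hom (Dgrp C n (Suc m)) (Egrp C n m)"
    and exact_k: "kmap C n m ` carrier (Egrp C n m) =
      {w \<in> carrier (Dgrp C (Suc n) m). imap C n m w = \<one>\<^bsub>Dgrp C n m\<^esub>}"
    and exact_b: "bmap C n m ` carrier (Dgrp C n (Suc m)) =
      {x \<in> carrier (Egrp C n m). kmap C n m x = \<one>\<^bsub>Dgrp C (Suc n) m\<^esub>}"
    and exact_i: "imap C n (Suc m) ` carrier (Dgrp C (Suc n) (Suc m)) =
      {w \<in> carrier (Dgrp C n (Suc m)). bmap C n m w = \<one>\<^bsub>Egrp C n m\<^esub>}"
    and D_zero: "carrier (Dgrp C 0 m) = {\<one>\<^bsub>Dgrp C 0 m\<^esub>}"
begin

lemma imap_iter_hom: "imap_iter C t n m \<in> hom (Dgrp C (n + t) m) (Dgrp C n m)"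
proof (induction t)
  case 0
  show ?case by (auto simp: hom_def)
next
  case (Suc t)
  have "imap_iter C t n m \<circ> imap C (n + t) m \<in> hom (Dgrp C (n + Suc t) m) (Dgrp C n m)"
    using Group.hom_compose[OF imap_hom[of "n + t" m] Suc] by simp
  then show ?case by (simp add: comp_def hom_def Pi_def)
qed

lemma imap_iter_closed: "w \<in> carrier (Dgrp C (n + t) m) \<Longrightarrow> imap_iter C t n m w \<in> carrier (Dgrp C n m)"
  using imap_iter_hom by (auto simp: hom_def)

text \<open>The recursion splits off the map that is applied first. Comparing kernels of composites
  of different lengths needs the map that is applied last.\<close>

lemma imap_iter_left: "imap_iter C (Suc t) n m w = imap C n m (imap_iter C t (Suc n) m w)"
  by (induction t arbitrary: w) auto

lemma group_hom_iter: "group_hom (Dgrp C (n + t) m) (Dgrp C n m) (imap_iter C t n m)"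
  using group_D imap_iter_hom by (simp add: group_hom_def group_hom_axioms_def)

lemma group_hom_b: "group_hom (Dgrp C n (Suc m)) (Egrp C n m) (bmap C n m)"
  using group_D group_E bmap_hom by (simp add: group_hom_def group_hom_axioms_def)

lemma group_hom_k: "group_hom (Egrp C n m) (Dgrp C (Suc n) m) (kmap C n m)"
  using group_D group_E kmap_hom by (simp add: group_hom_def group_hom_axioms_def)

lemma group_hom_i: "group_hom (Dgrp C (Suc n) m) (Dgrp C n m) (imap C n m)"
  using group_D imap_hom by (simp add: group_hom_def group_hom_axioms_def)

text \<open>Boundaries stop growing at \<open>t = n\<close>, when filtration degree 0 is reached; hence the \<open>min\<close>.\<close>

definition iter_kernel where
  "iter_kernel t n m =
    {w \<in> carrier (Dgrp C n m). imap_iter C (min t n) (n - min t n) m w = \<one>\<^bsub>Dgrp C (n - min t n) m\<^esub>}"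

lemma subgroup_iter_kernel: "subgroup (iter_kernel t n m) (Dgrp C n m)"
proof -
  have "iter_kernel t n m =
      kernel (Dgrp C ((n - min t n) + min t n) m) (Dgrp C (n - min t n) m) (imap_iter C (min t n) (n - min t n) m)"
    by (simp add: iter_kernel_def kernel_def)
  then show ?thesis
    using group_hom.subgroup_kernel[OF group_hom_iter[of "n - min t n" "min t n" m]] by simp
qed

lemma subgroup_b_iter_kernel: "subgroup (bmap C n m ` iter_kernel t n (Suc m)) (Egrp C n m)"
  using group_hom.subgroup_img_is_subgroup[OF group_hom_b subgroup_iter_kernel] .

lemma b_iter_kernel_ker: "e \<in> bmap C n m ` iter_kernel t n (Suc m) \<Longrightarrow>
    e \<in> carrier (Egrp C n m) \<and> kmap C n m e = \<one>\<^bsub>Dgrp C (Suc n) m\<^esub>"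
  using exact_b[of n m] by (auto simp: iter_kernel_def)

text \<open>Elements of B are values of \<open>bmap\<close>, so \<open>kmap\<close> kills them and
  is constant on the coset of x. The admissible w therefore form a single fibre of the iterated
  \<open>imap\<close>, and the differential can be computed from x itself.\<close>

lemma page_diff_coset:
  assumes B: "B n (Suc m) = bmap C n (Suc m) ` iter_kernel t n (Suc (Suc m))"
    and x: "x \<in> carrier (Egrp C n (Suc m))"
  shows "page_diff C B (Suc t) n m (B n (Suc m) #>\<^bsub>Egrp C n (Suc m)\<^esub> x) =
    B (n + Suc t) m <#>\<^bsub>Egrp C (n + Suc t) m\<^esub>
      bmap C (n + Suc t) m ` {w \<in> carrier (Dgrp C (n + Suc t) (Suc m)).
         imap_iter C t (Suc n) (Suc m) w = kmap C n (Suc m) x}"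
proof -
  interpret k: group_hom "Egrp C n (Suc m)" "Dgrp C (Suc n) (Suc m)" "kmap C n (Suc m)"
    by (rule group_hom_k)
  interpret sB: subgroup "B n (Suc m)" "Egrp C n (Suc m)"
    unfolding B by (rule subgroup_b_iter_kernel)
  have kb: "kmap C n (Suc m) (b \<otimes>\<^bsub>Egrp C n (Suc m)\<^esub> x) = kmap C n (Suc m) x" if "b \<in> B n (Suc m)" for b
    using b_iter_kernel_ker[OF that[unfolded B]] x by simp
  have "kmap C n (Suc m) ` (B n (Suc m) #>\<^bsub>Egrp C n (Suc m)\<^esub> x) =
      (\<lambda>b. kmap C n (Suc m) (b \<otimes>\<^bsub>Egrp C n (Suc m)\<^esub> x)) ` B n (Suc m)"
    by (auto simp: r_coset_def)
  also have "\<dots> = (\<lambda>b. kmap C n (Suc m) x) ` B n (Suc m)"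
    using kb by (rule image_cong[OF refl])
  also have "\<dots> = {kmap C n (Suc m) x}"
    using sB.one_closed by blast
  finally have k1: "kmap C n (Suc m) ` (B n (Suc m) #>\<^bsub>Egrp C n (Suc m)\<^esub> x) = {kmap C n (Suc m) x}" .
  then have "{bmap C (n + Suc t) m w | w. w \<in> carrier (Dgrp C (n + Suc t) (Suc m)) \<and>
          imap_iter C (Suc t - 1) (Suc n) (Suc m) w \<in> kmap C n (Suc m) ` (B n (Suc m) #>\<^bsub>Egrp C n (Suc m)\<^esub> x)}
     = bmap C (n + Suc t) m ` {w \<in> carrier (Dgrp C (n + Suc t) (Suc m)).
         imap_iter C t (Suc n) (Suc m) w = kmap C n (Suc m) x}"
    unfolding k1 by auto
  then show ?thesis
    by (simp add: page_diff_def)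
qed

text \<open>Two lifts w of \<open>k x\<close> differ by an element of the kernel of the t-fold
  composite, and \<open>bmap\<close> carries that kernel onto B. So the differential vanishes
  exactly when some lift w can be chosen with \<open>b w = 1\<close>, and by exactness such a w
  lifts one step further.\<close>

lemma page_diff_eq_one_iff:
  assumes B: "\<And>n m. B n m = bmap C n m ` iter_kernel t n (Suc m)"
    and x: "x \<in> carrier (Egrp C n (Suc m))"
  shows "page_diff C B (Suc t) n m (B n (Suc m) #>\<^bsub>Egrp C n (Suc m)\<^esub> x) = B (n + Suc t) m \<longleftrightarrow>
    kmap C n (Suc m) x \<in> imap_iter C (Suc t) (Suc n) (Suc m) ` carrier (Dgrp C (Suc n + Suc t) (Suc m))"
    (is "?l \<longleftrightarrow> ?r")
proof -
  define N where "N = n + Suc t"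
  let ?D = "Dgrp C N (Suc m)"
  let ?W = "{w \<in> carrier ?D. imap_iter C t (Suc n) (Suc m) w = kmap C n (Suc m) x}"
  interpret b: group_hom ?D "Egrp C N m" "bmap C N m" by (rule group_hom_b)
  interpret i: group_hom "Dgrp C (Suc N) (Suc m)" ?D "imap C N (Suc m)" by (rule group_hom_i)
  have N: "Suc n + t = N" "Suc n + Suc t = Suc N" and NS: "n + Suc t = N" by (simp_all add: N_def)
  have iter_Suc: "imap_iter C (Suc t) (Suc n) (Suc m) u = imap_iter C t (Suc n) (Suc m) (imap C N (Suc m) u)" for u
    by (simp add: N_def)
  interpret it: group_hom ?D "Dgrp C (Suc n) (Suc m)" "imap_iter C t (Suc n) (Suc m)"
    using group_hom_iter[of "Suc n" t "Suc m"] N(1) by simp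
  have mn: "min t N = t" "N - t = Suc n" by (auto simp: N_def)
  have K: "iter_kernel t N (Suc m) =
      {w \<in> carrier ?D. imap_iter C t (Suc n) (Suc m) w = \<one>\<^bsub>Dgrp C (Suc n) (Suc m)\<^esub>}"
    unfolding iter_kernel_def mn ..
  interpret sB: subgroup "B N m" "Egrp C N m"
    unfolding B by (rule subgroup_b_iter_kernel)
  have l: "?l \<longleftrightarrow> B N m <#>\<^bsub>Egrp C N m\<^esub> bmap C N m ` ?W = B N m"
    using page_diff_coset[of B n m t x, OF B x] unfolding NS by simp
  show ?thesis
  proof
    assume ?l
    with l have eq: "B N m <#>\<^bsub>Egrp C N m\<^esub> bmap C N m ` ?W = B N m" by simp
    \<comment> \<open>A product with the empty set is empty, so the equality also says that
      \<open>k x\<close> lifts along the t-fold composite at all.\<close>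
    have "\<one>\<^bsub>Egrp C N m\<^esub> \<in> B N m <#>\<^bsub>Egrp C N m\<^esub> bmap C N m ` ?W"
      unfolding eq by (rule sB.one_closed)
    then obtain w where w: "w \<in> ?W" unfolding set_mult_def by blast
    then have "\<one>\<^bsub>Egrp C N m\<^esub> \<otimes>\<^bsub>Egrp C N m\<^esub> bmap C N m w \<in> B N m"
      using set_multI[OF sB.one_closed, of "bmap C N m w" "bmap C N m ` ?W"] eq by blast
    then have "bmap C N m w \<in> B N m" using w by (simp del: sB.m_closed)
    then obtain v where v: "v \<in> carrier ?D" "imap_iter C t (Suc n) (Suc m) v = \<one>\<^bsub>Dgrp C (Suc n) (Suc m)\<^esub>"
      "bmap C N m w = bmap C N m v"
      unfolding B K by auto
    have "bmap C N m (w \<otimes>\<^bsub>?D\<^esub> inv\<^bsub>?D\<^esub> v) = \<one>\<^bsub>Egrp C N m\<^esub>"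
      using v w by simp
    then have "w \<otimes>\<^bsub>?D\<^esub> inv\<^bsub>?D\<^esub> v \<in> imap C N (Suc m) ` carrier (Dgrp C (Suc N) (Suc m))"
      using exact_i[of N m] v w by auto
    then obtain u where u: "u \<in> carrier (Dgrp C (Suc N) (Suc m))" "imap C N (Suc m) u = w \<otimes>\<^bsub>?D\<^esub> inv\<^bsub>?D\<^esub> v"
      by auto
    have "imap_iter C (Suc t) (Suc n) (Suc m) u = kmap C n (Suc m) x"
      using u w v group_hom.hom_closed[OF group_hom_k x] by (simp add: iter_Suc del: imap_iter.simps)
    then show ?r using u unfolding N by (metis imageI)
  next
    assume ?r
    then obtain u where u: "u \<in> carrier (Dgrp C (Suc N) (Suc m))"
      "imap_iter C t (Suc n) (Suc m) (imap C N (Suc m) u) = kmap C n (Suc m) x"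
      unfolding N by (auto simp: iter_Suc simp del: imap_iter.simps)
    let ?v = "imap C N (Suc m) u"
    have v: "?v \<in> ?W" using u by simp
    have bv: "bmap C N m ?v = \<one>\<^bsub>Egrp C N m\<^esub>" using exact_i[of N m] u by auto
    have sub: "bmap C N m ` ?W \<subseteq> B N m"
    proof
      fix e assume "e \<in> bmap C N m ` ?W"
      then obtain w where w: "w \<in> ?W" "e = bmap C N m w" by auto
      have "w \<otimes>\<^bsub>?D\<^esub> inv\<^bsub>?D\<^esub> ?v \<in> iter_kernel t N (Suc m)"
        unfolding K using w v group_hom.hom_closed[OF group_hom_k x] by simp
      moreover have "bmap C N m (w \<otimes>\<^bsub>?D\<^esub> inv\<^bsub>?D\<^esub> ?v) = e" using w v bv by simp
      ultimately show "e \<in> B N m" unfolding B by force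
    qed
    have "B N m <#>\<^bsub>Egrp C N m\<^esub> bmap C N m ` ?W = B N m"
    proof
      show "B N m <#>\<^bsub>Egrp C N m\<^esub> bmap C N m ` ?W \<subseteq> B N m"
        using sub by (force simp: set_mult_def)
      show "B N m \<subseteq> B N m <#>\<^bsub>Egrp C N m\<^esub> bmap C N m ` ?W"
      proof
        fix e assume e: "e \<in> B N m"
        then have "e = e \<otimes>\<^bsub>Egrp C N m\<^esub> bmap C N m ?v" using bv by simp
        then show "e \<in> B N m <#>\<^bsub>Egrp C N m\<^esub> bmap C N m ` ?W"
          using e v by (force simp: set_mult_def)
      qed
    qed
    then show ?l using l by simp
  qed
qed

lemma iter_kernel_mono: "t \<le> n \<Longrightarrow> s \<le> t \<Longrightarrow> iter_kernel s n m \<subseteq> iter_kernel t n m"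
proof (induction "t - s" arbitrary: s)
  case 0
  then show ?case by simp
next
  case (Suc d)
  have "iter_kernel s n m \<subseteq> iter_kernel (Suc s) n m"
  proof -
    have s: "Suc s \<le> n" "min (Suc s) n = Suc s" "min s n = s" "n - s = Suc (n - Suc s)" using Suc by auto
    interpret i: group_hom "Dgrp C (Suc (n - Suc s)) m" "Dgrp C (n - Suc s) m" "imap C (n - Suc s) m"
      by (rule group_hom_i)
    show ?thesis
      unfolding iter_kernel_def s using i.hom_one by (auto simp: imap_iter_left simp del: imap_iter.simps)
  qed
  moreover have "iter_kernel (Suc s) n m \<subseteq> iter_kernel t n m"
    using Suc.hyps(2) Suc.prems by (intro Suc.hyps(1)) auto
  ultimately show ?case by blast
qed

text \<open>This is the closed form of the pages inside the first one: cycles are the preimage under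
  k of the image of the iterated i, and boundaries are the image under b of its kernel. Both are
  proved in one induction because \<open>d^r\<close> is defined on \<open>E^r\<close>, which already
  involves the cycles and boundaries of the previous stage.\<close>

lemma cycles_boundaries_eq:
  "fst (cycles_boundaries C t) n 0 = carrier (Egrp C n 0) \<and>
   fst (cycles_boundaries C t) n (Suc m) = {x \<in> carrier (Egrp C n (Suc m)).
      kmap C n (Suc m) x \<in> imap_iter C t (Suc n) (Suc m) ` carrier (Dgrp C (Suc n + t) (Suc m))} \<and>
   snd (cycles_boundaries C t) n m' = bmap C n m' ` iter_kernel t n (Suc m')"
proof (induction t arbitrary: n m m')
  case 0
  have "iter_kernel 0 n (Suc m') = {\<one>\<^bsub>Dgrp C n (Suc m')\<^esub>}"
    using group.is_monoid[OF group_D] monoid.one_closed by (fastforce simp: iter_kernel_def)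
  then have "bmap C n m' ` iter_kernel 0 n (Suc m') = {\<one>\<^bsub>Egrp C n m'\<^esub>}"
    using group_hom.hom_one[OF group_hom_b] by simp
  moreover have "kmap C n (Suc m) x \<in> carrier (Dgrp C (Suc n) (Suc m))" if "x \<in> carrier (Egrp C n (Suc m))" for x
    using group_hom.hom_closed[OF group_hom_k that] .
  ultimately show ?case by auto
next
  case (Suc t)
  let ?Z = "fst (cycles_boundaries C t)" and ?B = "snd (cycles_boundaries C t)"
  have B: "?B n m = bmap C n m ` iter_kernel t n (Suc m)" for n m using Suc by blast
  have Z: "?Z n (Suc m) = {x \<in> carrier (Egrp C n (Suc m)).
      kmap C n (Suc m) x \<in> imap_iter C t (Suc n) (Suc m) ` carrier (Dgrp C (Suc n + t) (Suc m))}" for n m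
    using Suc by blast
  have 1: "fst (cycles_boundaries C (Suc t)) n 0 = carrier (Egrp C n 0)"
    using Suc by (simp add: Let_def)
  have 2: "fst (cycles_boundaries C (Suc t)) n (Suc m) = {x \<in> carrier (Egrp C n (Suc m)).
      kmap C n (Suc m) x \<in> imap_iter C (Suc t) (Suc n) (Suc m) ` carrier (Dgrp C (Suc n + Suc t) (Suc m))}"
  proof -
    have "fst (cycles_boundaries C (Suc t)) n (Suc m) = {x \<in> ?Z n (Suc m).
        page_diff C ?B (Suc t) n m (?B n (Suc m) #>\<^bsub>Egrp C n (Suc m)\<^esub> x) = ?B (n + Suc t) m}"
      by (simp add: Let_def page_of_def)
    also have "\<dots> = {x \<in> ?Z n (Suc m).
        kmap C n (Suc m) x \<in> imap_iter C (Suc t) (Suc n) (Suc m) ` carrier (Dgrp C (Suc n + Suc t) (Suc m))}"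
      using page_diff_eq_one_iff[OF B] Z by blast
    also have "\<dots> = {x \<in> carrier (Egrp C n (Suc m)).
      kmap C n (Suc m) x \<in> imap_iter C (Suc t) (Suc n) (Suc m) ` carrier (Dgrp C (Suc n + Suc t) (Suc m))}"
    proof -
      have "imap_iter C (Suc t) (Suc n) (Suc m) ` carrier (Dgrp C (Suc n + Suc t) (Suc m))
          \<subseteq> imap_iter C t (Suc n) (Suc m) ` carrier (Dgrp C (Suc n + t) (Suc m))"
        using group_hom.hom_closed[OF group_hom_i[of "Suc n + t" "Suc m"]] by auto
      then show ?thesis unfolding Z by blast
    qed
    finally show ?thesis .
  qed
  have 3: "snd (cycles_boundaries C (Suc t)) n m' = bmap C n m' ` iter_kernel (Suc t) n (Suc m')"
  proof (cases "n < Suc t")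
    \<comment> \<open>Nothing maps into filtration degree n at this stage, and the composite already
      ends in filtration degree 0, so neither side changes.\<close>
    case True
    then have "min (Suc t) n = min t n" by simp
    then show ?thesis using True B by (simp add: Let_def iter_kernel_def)
  next
    case False
    define n0 where "n0 = n - Suc t"
    have n: "n = n0 + Suc t" using False by (simp add: n0_def)
    interpret b: group_hom "Dgrp C n (Suc m')" "Egrp C n m'" "bmap C n m'" by (rule group_hom_b)
    interpret sB: subgroup "?B n m'" "Egrp C n m'" unfolding B by (rule subgroup_b_iter_kernel)
    interpret sB': subgroup "bmap C n m' ` iter_kernel (Suc t) n (Suc m')" "Egrp C n m'"
      by (rule subgroup_b_iter_kernel)
    let ?W = "\<lambda>x. {w \<in> carrier (Dgrp C n (Suc m')). imap_iter C t (Suc n0) (Suc m') w = kmap C n0 (Suc m') x}"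
    have K: "iter_kernel (Suc t) n (Suc m') = {w \<in> carrier (Dgrp C n (Suc m')).
        imap C n0 (Suc m') (imap_iter C t (Suc n0) (Suc m') w) = \<one>\<^bsub>Dgrp C n0 (Suc m')\<^esub>}"
      using False imap_iter_left[of t n0 "Suc m'"]
      by (simp add: iter_kernel_def min_absorb1 n0_def del: imap_iter.simps)
    have sub: "?B n m' \<subseteq> bmap C n m' ` iter_kernel (Suc t) n (Suc m')"
      unfolding B using iter_kernel_mono[of "Suc t" n t "Suc m'"] False by auto
    have "snd (cycles_boundaries C (Suc t)) n m' =
        (\<Union>x\<in>?Z n0 (Suc m'). page_diff C ?B (Suc t) n0 m' (?B n0 (Suc m') #>\<^bsub>Egrp C n0 (Suc m')\<^esub> x))"
      using False by (simp add: Let_def page_of_def carrier_FactGroup n0_def)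
    also have "\<dots> = (\<Union>x\<in>?Z n0 (Suc m'). ?B n m' <#>\<^bsub>Egrp C n m'\<^esub> bmap C n m' ` ?W x)"
      using page_diff_coset[of ?B n0 m' t, OF B] Z n by auto
    \<comment> \<open>By exactness the t-fold image of w is a value of k precisely when one further
      i kills it. So the images of the differential enlarge the kernel of the composite by one
      step.\<close>
    also have "\<dots> = bmap C n m' ` iter_kernel (Suc t) n (Suc m')"
    proof (intro equalityI subsetI)
      fix e assume "e \<in> (\<Union>x\<in>?Z n0 (Suc m'). ?B n m' <#>\<^bsub>Egrp C n m'\<^esub> bmap C n m' ` ?W x)"
      then obtain x b w where x: "x \<in> ?Z n0 (Suc m')" "b \<in> ?B n m'" "w \<in> ?W x"
        and e: "e = b \<otimes>\<^bsub>Egrp C n m'\<^esub> bmap C n m' w"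
        by (auto simp: set_mult_def)
      have "kmap C n0 (Suc m') x \<in> {w \<in> carrier (Dgrp C (Suc n0) (Suc m')).
          imap C n0 (Suc m') w = \<one>\<^bsub>Dgrp C n0 (Suc m')\<^esub>}"
        using x Z exact_k[of n0 "Suc m'"] by blast
      then have "w \<in> iter_kernel (Suc t) n (Suc m')" unfolding K using x by auto
      then show "e \<in> bmap C n m' ` iter_kernel (Suc t) n (Suc m')"
        using e x sub by (auto intro!: sB'.m_closed)
    next
      fix e assume "e \<in> bmap C n m' ` iter_kernel (Suc t) n (Suc m')"
      then obtain w where w: "w \<in> iter_kernel (Suc t) n (Suc m')" "e = bmap C n m' w" by auto
      have wD: "w \<in> carrier (Dgrp C n (Suc m'))" using w by (simp add: iter_kernel_def)
      have "imap_iter C t (Suc n0) (Suc m') w \<in> carrier (Dgrp C (Suc n0) (Suc m'))"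
        using imap_iter_closed[of w "Suc n0" t "Suc m'"] wD n by simp
      then have "imap_iter C t (Suc n0) (Suc m') w \<in> kmap C n0 (Suc m') ` carrier (Egrp C n0 (Suc m'))"
        using exact_k[of n0 "Suc m'"] w unfolding K by auto
      then obtain x where x: "x \<in> carrier (Egrp C n0 (Suc m'))"
        "kmap C n0 (Suc m') x = imap_iter C t (Suc n0) (Suc m') w" by auto
      have "x \<in> ?Z n0 (Suc m')" unfolding Z using x wD n by auto
      moreover have "e \<in> ?B n m' <#>\<^bsub>Egrp C n m'\<^esub> bmap C n m' ` ?W x"
      proof -
        have "bmap C n m' w \<in> bmap C n m' ` ?W x" using x(2) wD by simp
        then have "\<one>\<^bsub>Egrp C n m'\<^esub> \<otimes>\<^bsub>Egrp C n m'\<^esub> bmap C n m' w \<in> ?B n m' <#>\<^bsub>Egrp C n m'\<^esub> bmap C n m' ` ?W x"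
          by (rule set_multI[OF sB.one_closed])
        then show ?thesis using w(2) wD by simp
      qed
      ultimately show "e \<in> (\<Union>x\<in>?Z n0 (Suc m'). ?B n m' <#>\<^bsub>Egrp C n m'\<^esub> bmap C n m' ` ?W x)"
        by (rule UN_I)
    qed
    finally show ?thesis .
  qed
  show ?case using 1 2 3 by blast
qed

text \<open>Both the permanent cycles and all boundaries turn out to be the kernel of k: the cycles
  by the separation hypothesis, the boundaries because from stage n + 1 on the composite ends in the
  trivial group D(0) and its kernel is all of D(n). The second claim is what the canonical form of
  convergence asks of representatives.\<close>

lemma E_infinity_trivial:
  assumes sep: "\<And>w. w \<in> carrier (Dgrp C (Suc n) (Suc m)) \<Longrightarrow>
      (\<And>t. w \<in> imap_iter C t (Suc n) (Suc m) ` carrier (Dgrp C (Suc n + t) (Suc m))) \<Longrightarrow>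
      w = \<one>\<^bsub>Dgrp C (Suc n) (Suc m)\<^esub>"
  shows "trivial_group (E_infinity C n (Suc m))"
    and "e \<in> \<one>\<^bsub>E_infinity C n (Suc m)\<^esub> \<Longrightarrow> kmap C n (Suc m) e = \<one>\<^bsub>Dgrp C (Suc n) (Suc m)\<^esub>"
proof -
  let ?E = "Egrp C n (Suc m)"
  let ?Z = "\<Inter>r\<in>{1..}. Zr C r n (Suc m)" and ?B = "\<Union>r\<in>{1..}. Br C r n (Suc m)"
  let ?K = "{x \<in> carrier ?E. kmap C n (Suc m) x = \<one>\<^bsub>Dgrp C (Suc n) (Suc m)\<^esub>}"
  interpret k: group_hom ?E "Dgrp C (Suc n) (Suc m)" "kmap C n (Suc m)" by (rule group_hom_k)
  have Z: "Zr C (Suc t) n (Suc m) = {x \<in> carrier ?E.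
      kmap C n (Suc m) x \<in> imap_iter C t (Suc n) (Suc m) ` carrier (Dgrp C (Suc n + t) (Suc m))}" for t
    using cycles_boundaries_eq[of t n m] by (simp add: Zr_def)
  have B: "Br C (Suc t) n (Suc m) = bmap C n (Suc m) ` iter_kernel t n (Suc (Suc m))" for t
    using cycles_boundaries_eq[of t n m "Suc m"] by (simp add: Br_def)
  have at: "{1..} = range Suc" by (metis One_nat_def atLeast_Suc_greaterThan greaterThan_0)
  have "?Z = ?K"
  proof (intro equalityI subsetI)
    fix x assume "x \<in> ?Z"
    then have "x \<in> Zr C (Suc t) n (Suc m)" for t by auto
    then have x: "x \<in> carrier ?E" and "kmap C n (Suc m) x \<in>
        imap_iter C t (Suc n) (Suc m) ` carrier (Dgrp C (Suc n + t) (Suc m))" for t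
      unfolding Z by blast+
    then show "x \<in> ?K" using sep[OF k.hom_closed[OF x]] by blast
  next
    fix x assume x: "x \<in> ?K"
    have "x \<in> Zr C (Suc t) n (Suc m)" for t
      unfolding Z using x subgroup.one_closed[OF group_hom.img_is_subgroup[OF group_hom_iter[of "Suc n" t "Suc m"]]]
      by (simp del: add_Suc)
    then show "x \<in> ?Z" unfolding at by blast
  qed
  moreover have "?B = ?K"
  proof -
    have "iter_kernel n n (Suc (Suc m)) = carrier (Dgrp C n (Suc (Suc m)))"
      using imap_iter_closed[of _ 0 n "Suc (Suc m)"] D_zero by (auto simp: iter_kernel_def)
    then have "Br C (Suc n) n (Suc m) = ?K" using exact_b[of n "Suc m"] by (simp add: B)
    moreover have "Br C (Suc t) n (Suc m) \<subseteq> ?K" for t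
      using b_iter_kernel_ker unfolding B by blast
    ultimately show ?thesis unfolding at by blast
  qed
  ultimately have E: "E_infinity C n (Suc m) = (?E\<lparr>carrier := ?K\<rparr>) Mod ?K"
    by (simp add: E_infinity_def page_of_def)
  have sK: "subgroup ?K ?E" using k.subgroup_kernel by (simp add: kernel_def)
  then interpret K: group "?E\<lparr>carrier := ?K\<rparr>" by (rule k.G.subgroup_imp_group)
  have nK: "?K \<lhd> ?E\<lparr>carrier := ?K\<rparr>"
    using K.carrier_normal by simp
  have "?K #>\<^bsub>?E\<^esub> x = ?K" if "x \<in> ?K" for x
    using k.G.coset_join2[OF _ sK that] that by simp
  then have "carrier ((?E\<lparr>carrier := ?K\<rparr>) Mod ?K) \<subseteq> {\<one>\<^bsub>(?E\<lparr>carrier := ?K\<rparr>) Mod ?K\<^esub>}"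
    by (auto simp: carrier_FactGroup)
  then show "trivial_group (E_infinity C n (Suc m))"
    using group.trivial_group_subset[OF normal.factorgroup_is_group[OF nK]] E by simp
  show "e \<in> \<one>\<^bsub>E_infinity C n (Suc m)\<^esub> \<Longrightarrow> kmap C n (Suc m) e = \<one>\<^bsub>Dgrp C (Suc n) (Suc m)\<^esub>"
    by (simp add: E)
qed

end

text \<open>Every map induced on quotients is written as the product of a subgroup with the image of
  a coset. This evaluates all of them on representatives: faces and degeneracies of quotients, maps
  of homotopy groups, and projections between finite quotients.\<close>

lemma (in group_hom) coset_image:
  assumes "N \<lhd> G" "M \<lhd> H" "h ` N \<subseteq> M" "x \<in> carrier G"
  shows "M <#>\<^bsub>H\<^esub> h ` (N #>\<^bsub>G\<^esub> x) = M #>\<^bsub>H\<^esub> h x"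
proof -
  interpret N: normal N G by fact
  interpret M: normal M H by fact
  show ?thesis
  proof (intro equalityI subsetI)
    fix z assume "z \<in> M <#>\<^bsub>H\<^esub> h ` (N #>\<^bsub>G\<^esub> x)"
    then obtain a n where z: "a \<in> M" "n \<in> N" "z = a \<otimes>\<^bsub>H\<^esub> h (n \<otimes>\<^bsub>G\<^esub> x)"
      by (auto simp: set_mult_def r_coset_def)
    then have "z = (a \<otimes>\<^bsub>H\<^esub> h n) \<otimes>\<^bsub>H\<^esub> h x" "a \<otimes>\<^bsub>H\<^esub> h n \<in> M"
      using assms by (auto simp: H.m_assoc)
    then show "z \<in> M #>\<^bsub>H\<^esub> h x" by (auto simp: r_coset_def)
  next
    fix z assume "z \<in> M #>\<^bsub>H\<^esub> h x"
    then obtain a where z: "a \<in> M" "z = a \<otimes>\<^bsub>H\<^esub> h x" by (auto simp: r_coset_def)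
    moreover have "x \<in> N #>\<^bsub>G\<^esub> x" using assms N.rcos_module[OF G.group_axioms assms(4) assms(4)] by simp
    ultimately show "z \<in> M <#>\<^bsub>H\<^esub> h ` (N #>\<^bsub>G\<^esub> x)" by (auto simp: set_mult_def)
  qed
qed

lemma (in normal) rcos_eq_iff:
  "x \<in> carrier G \<Longrightarrow> y \<in> carrier G \<Longrightarrow> H #> x = H #> y \<longleftrightarrow> x \<otimes> inv y \<in> H"
  by (metis is_group rcos_module repr_independence rcos_self subgroup_axioms)

lemma (in normal) rcos_eq_self_iff: "x \<in> carrier G \<Longrightarrow> H #> x = H \<longleftrightarrow> x \<in> H"
  by (metis coset_join1 coset_join2 subgroup_axioms is_group subset)

section \<open>Simplicial groups\<close>

abbreviation homotopy_class :: "'a simplicial \<Rightarrow> nat \<Rightarrow> 'a \<Rightarrow> 'a set" where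
  "homotopy_class S m z \<equiv> moore_boundaries S m #>\<^bsub>obj S m\<^esub> z"

locale simplicial_grp =
  fixes S :: "'a simplicial"
  assumes simplicial: "simplicial_group S"
begin

lemma grp [simp, intro]: "group (obj S m)"
  using simplicial by (simp add: simplicial_group_def)

lemma face_hom: "i \<le> Suc m \<Longrightarrow> group_hom (obj S (Suc m)) (obj S m) (face S (Suc m) i)"
  using simplicial by (simp add: simplicial_group_def group_hom_def group_hom_axioms_def)

lemma degen_hom: "i \<le> m \<Longrightarrow> group_hom (obj S m) (obj S (Suc m)) (degen S m i)"
  using simplicial by (simp add: simplicial_group_def group_hom_def group_hom_axioms_def)

lemma closed [simp, intro]:
  "x \<in> carrier (obj S m) \<Longrightarrow> y \<in> carrier (obj S m) \<Longrightarrow> x \<otimes>\<^bsub>obj S m\<^esub> y \<in> carrier (obj S m)"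
  "x \<in> carrier (obj S m) \<Longrightarrow> inv\<^bsub>obj S m\<^esub> x \<in> carrier (obj S m)"
  "\<one>\<^bsub>obj S m\<^esub> \<in> carrier (obj S m)"
  by (simp_all add: group.is_monoid monoid.m_closed)

lemmas grp_simps [simp] = group.l_inv[OF grp] group.r_inv[OF grp] group.inv_inv[OF grp]
  monoid.l_one[OF group.is_monoid[OF grp]] monoid.r_one[OF group.is_monoid[OF grp]]
  monoid.inv_one[OF group.is_monoid[OF grp]] group.inv_mult_group[OF grp]

lemmas assoc = monoid.m_assoc[OF group.is_monoid[OF grp]]

lemma inv_cancel [simp]:
  assumes "x \<in> carrier (obj S m)" "y \<in> carrier (obj S m)"
  shows "inv\<^bsub>obj S m\<^esub> x \<otimes>\<^bsub>obj S m\<^esub> (x \<otimes>\<^bsub>obj S m\<^esub> y) = y"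
    "x \<otimes>\<^bsub>obj S m\<^esub> (inv\<^bsub>obj S m\<^esub> x \<otimes>\<^bsub>obj S m\<^esub> y) = y"
  using assms by (simp_all flip: assoc)

lemma face_simps [simp]:
  assumes "i \<le> Suc m" "x \<in> carrier (obj S (Suc m))"
  shows "face S (Suc m) i x \<in> carrier (obj S m)"
    "y \<in> carrier (obj S (Suc m)) \<Longrightarrow>
       face S (Suc m) i (x \<otimes>\<^bsub>obj S (Suc m)\<^esub> y) = face S (Suc m) i x \<otimes>\<^bsub>obj S m\<^esub> face S (Suc m) i y"
    "face S (Suc m) i (inv\<^bsub>obj S (Suc m)\<^esub> x) = inv\<^bsub>obj S m\<^esub> face S (Suc m) i x"
  using face_hom[OF assms(1)] assms(2) by (simp_all add: group_hom.hom_closed group_hom.hom_mult group_hom.hom_inv)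

lemma face_one [simp]: "i \<le> Suc m \<Longrightarrow> face S (Suc m) i \<one>\<^bsub>obj S (Suc m)\<^esub> = \<one>\<^bsub>obj S m\<^esub>"
  by (rule group_hom.hom_one[OF face_hom])

lemma degen_closed [simp]: "i \<le> m \<Longrightarrow> x \<in> carrier (obj S m) \<Longrightarrow> degen S m i x \<in> carrier (obj S (Suc m))"
  by (rule group_hom.hom_closed[OF degen_hom])

lemma degen_one [simp]: "i \<le> m \<Longrightarrow> degen S m i \<one>\<^bsub>obj S m\<^esub> = \<one>\<^bsub>obj S (Suc m)\<^esub>"
  by (rule group_hom.hom_one[OF degen_hom])

lemmas simplicial_rules = simplicial[unfolded simplicial_group_def, THEN conjunct2, THEN conjunct2, THEN conjunct2]

lemma face_face:
  assumes "x \<in> carrier (obj S (Suc (Suc m)))" "i < j" "j \<le> Suc (Suc m)"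
  shows "face S (Suc m) i (face S (Suc (Suc m)) j x) = face S (Suc m) (j - 1) (face S (Suc (Suc m)) i x)"
  using simplicial_rules[THEN conjunct1, rule_format, OF assms(1) conjI[OF assms(2,3)]] .

lemma face_degen:
  assumes "x \<in> carrier (obj S m)" "i \<le> Suc m" "j \<le> m"
  shows "face S (Suc m) i (degen S m j x) =
          (if i < j then degen S (m - 1) (j - 1) (face S m i x)
           else if i = j \<or> i = Suc j then x
           else degen S (m - 1) j (face S m (i - 1) x))"
  using simplicial_rules[THEN conjunct2, THEN conjunct1, rule_format, OF assms(1) conjI[OF assms(2,3)]] .

lemma degen_degen:
  assumes "x \<in> carrier (obj S m)" "i \<le> j" "j \<le> m"
  shows "degen S (Suc m) i (degen S m j x) = degen S (Suc m) (Suc j) (degen S m i x)"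
  using simplicial_rules[THEN conjunct2, THEN conjunct2, rule_format, OF assms(1) conjI[OF assms(2,3)]] .

text \<open>The faces are prescribed one after the other: correcting \<open>y\<close> by
  \<open>s\<^sub>k(d\<^sub>k(y)\<inverse> x\<^sub>k)\<close> repairs the face \<open>k\<close> and leaves the faces before it alone.\<close>

lemma horn_filler:
  assumes "k \<le> Suc m" "\<And>i. i < k \<Longrightarrow> x i \<in> carrier (obj S m)"
    and "\<And>i j. i < j \<Longrightarrow> j < k \<Longrightarrow> face S m i (x j) = face S m (j - 1) (x i)"
  shows "\<exists>y\<in>carrier (obj S (Suc m)). \<forall>i<k. face S (Suc m) i y = x i"
  using assms
proof (induction k)
  case 0
  show ?case using closed(3)[of "Suc m"] by auto
next
  case (Suc k)
  then obtain y where y: "y \<in> carrier (obj S (Suc m))" "\<And>i. i < k \<Longrightarrow> face S (Suc m) i y = x i"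
    by fastforce
  define u where "u = inv\<^bsub>obj S m\<^esub> face S (Suc m) k y \<otimes>\<^bsub>obj S m\<^esub> x k"
  have k: "k \<le> m" and xk: "x k \<in> carrier (obj S m)" using Suc by auto
  have u: "u \<in> carrier (obj S m)" using y k xk by (simp add: u_def)
  have "face S (Suc m) i (y \<otimes>\<^bsub>obj S (Suc m)\<^esub> degen S m k u) = x i" if i: "i < Suc k" for i
  proof (cases "i = k")
    case True
    have "face S (Suc m) k (degen S m k u) = u" using face_degen[OF u, of k k] k by simp
    then show ?thesis
      using True y k u xk by (simp add: u_def)
  next
    case False
    then have ik: "i < k" using i by simp
    then obtain m' where m: "m = Suc m'" using k by (cases m) auto
    \<comment> \<open>The matching condition makes the i-th face of u trivial, so
      \<open>d_i s_k u = s_(k-1) d_i u\<close> is trivial as well and face i of y is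
      undisturbed.\<close>
    have "face S m i (face S (Suc m) k y) = face S m (k - 1) (x i)"
      using face_face[of y m' i k] y ik k unfolding m by auto
    also have "\<dots> = face S m i (x k)" using Suc.prems(3)[of i k] ik by simp
    finally have "face S m i u = \<one>\<^bsub>obj S m'\<^esub>"
      using y xk ik k by (simp add: u_def m)
    then have "face S (Suc m) i (degen S m k u) = \<one>\<^bsub>obj S m\<^esub>"
      using face_degen[OF u, of i k] ik k by (simp add: m)
    then show ?thesis using y k u ik Suc.prems(2)[of i] by simp
  qed
  then show ?case using y u k by (intro bexI[of _ "y \<otimes>\<^bsub>obj S (Suc m)\<^esub> degen S m k u"]) auto
qed

lemma moore_0: "moore S 0 = carrier (obj S 0)"
  by (simp add: moore_def)

lemma moore_Suc: "moore S (Suc m) =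
    {x \<in> carrier (obj S (Suc m)). \<forall>i\<le>m. face S (Suc m) i x = \<one>\<^bsub>obj S m\<^esub>}"
  by (auto simp: moore_def)

lemma moore_carrier: "x \<in> moore S m \<Longrightarrow> x \<in> carrier (obj S m)"
  by (simp add: moore_def)

lemma moore_cycles_0: "moore_cycles S 0 = carrier (obj S 0)"
  by (simp add: moore_cycles_def moore_def)

lemma moore_cycles_Suc: "moore_cycles S (Suc m) =
    {x \<in> carrier (obj S (Suc m)). \<forall>i\<le>Suc m. face S (Suc m) i x = \<one>\<^bsub>obj S m\<^esub>}"
  by (auto simp: moore_cycles_def moore_Suc le_Suc_eq)

lemma moore_cycles_carrier: "x \<in> moore_cycles S m \<Longrightarrow> x \<in> carrier (obj S m)"
  by (simp add: moore_cycles_def moore_def)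

lemma moore_cycles_moore: "x \<in> moore_cycles S m \<Longrightarrow> x \<in> moore S m"
  by (simp add: moore_cycles_def)

lemma subgroup_moore: "subgroup (moore S m) (obj S m)"
proof (cases m)
  case 0
  then show ?thesis using group.subgroup_self[OF grp, of 0] moore_0 by simp
next
  case (Suc m')
  show ?thesis unfolding Suc moore_Suc by (rule group.subgroupI[OF grp]) (auto intro: closed)
qed

lemma subgroup_moore_cycles: "subgroup (moore_cycles S m) (obj S m)"
proof (cases m)
  case 0
  then show ?thesis using group.subgroup_self[OF grp, of 0] moore_cycles_0 by simp
next
  case (Suc m')
  show ?thesis unfolding Suc moore_cycles_Suc by (rule group.subgroupI[OF grp]) (auto intro: closed)
qed

lemma boundary_cycle:
  assumes y: "y \<in> moore S (Suc m)"
  shows "face S (Suc m) (Suc m) y \<in> moore_cycles S m"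
proof (cases m)
  case 0
  then show ?thesis using y face_simps(1)[of "Suc 0" 0 y] by (simp add: moore_Suc moore_cycles_0)
next
  case (Suc m')
  have "face S m i (face S (Suc m) (Suc m) y) = \<one>\<^bsub>obj S m'\<^esub>" if "i \<le> m" for i
    using face_face[of y m' i "Suc m"] y that by (simp add: Suc moore_Suc)
  then show ?thesis using y by (simp add: Suc moore_Suc moore_cycles_Suc)
qed

lemma boundaries_cycles: "moore_boundaries S m \<subseteq> moore_cycles S m"
  by (auto simp: moore_boundaries_def boundary_cycle)

text \<open>A conjugate of \<open>d_(m+1) y\<close> by x is the boundary of the conjugate of y by
  \<open>s_m x\<close>, because \<open>d_(m+1) s_m x = x\<close> and trivial faces stay trivial
  under conjugation.\<close>

lemma boundaries_normal: "moore_boundaries S m \<lhd> obj S m"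
proof -
  interpret f: group_hom "obj S (Suc m)" "obj S m" "face S (Suc m) (Suc m)"
    by (rule face_hom) simp
  have sub: "subgroup (moore_boundaries S m) (obj S m)"
    unfolding moore_boundaries_def by (rule f.subgroup_img_is_subgroup[OF subgroup_moore])
  have "x \<otimes>\<^bsub>obj S m\<^esub> h \<otimes>\<^bsub>obj S m\<^esub> inv\<^bsub>obj S m\<^esub> x \<in> moore_boundaries S m"
    if x: "x \<in> carrier (obj S m)" and h: "h \<in> moore_boundaries S m" for x h
  proof -
    obtain y where y: "y \<in> moore S (Suc m)" "h = face S (Suc m) (Suc m) y"
      using h by (auto simp: moore_boundaries_def)
    let ?s = "degen S m m x"
    let ?y = "?s \<otimes>\<^bsub>obj S (Suc m)\<^esub> y \<otimes>\<^bsub>obj S (Suc m)\<^esub> inv\<^bsub>obj S (Suc m)\<^esub> ?s"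
    have "?y \<in> moore S (Suc m)" using y x by (simp add: moore_Suc)
    moreover have "face S (Suc m) (Suc m) ?y = x \<otimes>\<^bsub>obj S m\<^esub> h \<otimes>\<^bsub>obj S m\<^esub> inv\<^bsub>obj S m\<^esub> x"
      using y x face_degen[OF x, of "Suc m" m] by (simp add: moore_Suc)
    ultimately show ?thesis unfolding moore_boundaries_def by (metis imageI)
  qed
  then show ?thesis using sub f.H.normal_inv_iff by blast
qed

lemma subgroup_boundaries: "subgroup (moore_boundaries S m) (obj S m)"
  using boundaries_normal by (rule normal_imp_subgroup)

lemma boundaries_carrier: "x \<in> moore_boundaries S m \<Longrightarrow> x \<in> carrier (obj S m)"
  using subgroup.mem_carrier[OF subgroup_boundaries] .

lemma boundaries_normal_cycles: "moore_boundaries S m \<lhd> (obj S m)\<lparr>carrier := moore_cycles S m\<rparr>"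
  using group.normal_restrict_supergroup[OF grp subgroup_moore_cycles boundaries_normal boundaries_cycles] .

lemma group_homotopy: "group (homotopy_group S m)"
  unfolding homotopy_group_def by (rule normal.factorgroup_is_group[OF boundaries_normal_cycles])

lemma carrier_homotopy: "carrier (homotopy_group S m) = homotopy_class S m ` moore_cycles S m"
  by (simp add: homotopy_group_def carrier_FactGroup)

lemma one_homotopy [simp]: "\<one>\<^bsub>homotopy_group S m\<^esub> = moore_boundaries S m"
  by (simp add: homotopy_group_def)

lemma mult_homotopy: "x \<in> carrier (obj S m) \<Longrightarrow> y \<in> carrier (obj S m) \<Longrightarrow>
   homotopy_class S m x \<otimes>\<^bsub>homotopy_group S m\<^esub> homotopy_class S m y =
   homotopy_class S m (x \<otimes>\<^bsub>obj S m\<^esub> y)"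
  using normal.rcos_sum[OF boundaries_normal] by (simp add: homotopy_group_def)

lemma homotopy_class_eq_iff: "x \<in> carrier (obj S m) \<Longrightarrow> y \<in> carrier (obj S m) \<Longrightarrow>
   homotopy_class S m x = homotopy_class S m y \<longleftrightarrow> x \<otimes>\<^bsub>obj S m\<^esub> inv\<^bsub>obj S m\<^esub> y \<in> moore_boundaries S m"
  using normal.rcos_eq_iff[OF boundaries_normal] .

lemma homotopy_class_one_iff: "x \<in> carrier (obj S m) \<Longrightarrow>
   homotopy_class S m x = moore_boundaries S m \<longleftrightarrow> x \<in> moore_boundaries S m"
  using normal.rcos_eq_self_iff[OF boundaries_normal] .

lemma trivial_homotopy_iff:
  "trivial_group (homotopy_group S m) \<longleftrightarrow> moore_cycles S m \<subseteq> moore_boundaries S m"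
proof -
  have "trivial_group (homotopy_group S m) \<longleftrightarrow>
      (\<forall>z\<in>moore_cycles S m. homotopy_class S m z = moore_boundaries S m)"
    using group.trivial_group_subset[OF group_homotopy] by (auto simp: carrier_homotopy)
  then show ?thesis using homotopy_class_one_iff moore_cycles_carrier by blast
qed

text \<open>Fill all faces but the last. The defect of the last face is a cycle by the matching
  conditions, so it bounds a Moore chain w. Multiplying by w corrects the last face and leaves the
  others alone, since all other faces of w are trivial.\<close>

lemma sphere_filler:
  assumes acyclic: "moore_cycles S (Suc m) \<subseteq> moore_boundaries S (Suc m)"
    and x: "\<And>i. i \<le> Suc (Suc m) \<Longrightarrow> x i \<in> carrier (obj S (Suc m))"
    and match: "\<And>i j. i < j \<Longrightarrow> j \<le> Suc (Suc m) \<Longrightarrow> face S (Suc m) i (x j) = face S (Suc m) (j - 1) (x i)"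
  shows "\<exists>y\<in>carrier (obj S (Suc (Suc m))). \<forall>i\<le>Suc (Suc m). face S (Suc (Suc m)) i y = x i"
proof -
  obtain y where y: "y \<in> carrier (obj S (Suc (Suc m)))"
    and f: "\<And>i. i < Suc (Suc m) \<Longrightarrow> face S (Suc (Suc m)) i y = x i"
    using horn_filler[of "Suc (Suc m)" "Suc m" x] x match by auto
  let ?d = "face S (Suc (Suc m)) (Suc (Suc m))"
  define z where "z = inv\<^bsub>obj S (Suc m)\<^esub> ?d y \<otimes>\<^bsub>obj S (Suc m)\<^esub> x (Suc (Suc m))"
  have "face S (Suc m) i z = \<one>\<^bsub>obj S m\<^esub>" if "i \<le> Suc m" for i
    using face_face[of y m i "Suc (Suc m)"] match[of i "Suc (Suc m)"] f[of i] that y x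
    by (simp add: z_def)
  then have "z \<in> moore_cycles S (Suc m)" using y x by (simp add: moore_cycles_Suc z_def)
  then obtain w where w: "w \<in> moore S (Suc (Suc m))" "z = ?d w"
    using acyclic by (auto simp: moore_boundaries_def)
  have "face S (Suc (Suc m)) i (y \<otimes>\<^bsub>obj S (Suc (Suc m))\<^esub> w) = x i" if i: "i \<le> Suc (Suc m)" for i
  proof (cases "i = Suc (Suc m)")
    case True
    then show ?thesis
      using y w x[of i] by (simp add: moore_carrier w(2)[symmetric] z_def)
  next
    case False
    then show ?thesis using y w f[of i] x[of i] i by (simp add: moore_Suc)
  qed
  then show ?thesis
    using y w by (intro bexI[of _ "y \<otimes>\<^bsub>obj S (Suc (Suc m))\<^esub> w"]) (auto simp: moore_carrier)
qed

end

section \<open>The long exact homotopy sequence\<close>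

text \<open>The kernel A is realised on a subset of B with the same operations, faces and
  degeneracies, so that its inclusion is the identity on elements. The graded pieces of a filtration
  occur in exactly this form.\<close>

locale simplicial_ses = B: simplicial_grp B + C: simplicial_grp C
  for B :: "'b simplicial" and C :: "'c simplicial" +
  fixes A :: "'b simplicial" and q :: "nat \<Rightarrow> 'b \<Rightarrow> 'c"
  assumes q_hom: "q m \<in> hom (obj B m) (obj C m)"
    and q_surj: "q m ` carrier (obj B m) = carrier (obj C m)"
    and q_face: "x \<in> carrier (obj B (Suc m)) \<Longrightarrow> i \<le> Suc m \<Longrightarrow>
      q m (face B (Suc m) i x) = face C (Suc m) i (q (Suc m) x)"
    and q_degen: "x \<in> carrier (obj B m) \<Longrightarrow> i \<le> m \<Longrightarrow>
      q (Suc m) (degen B m i x) = degen C m i (q m x)"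
    and A_def: "A = \<lparr>obj = \<lambda>m. (obj B m)\<lparr>carrier := {x \<in> carrier (obj B m). q m x = \<one>\<^bsub>obj C m\<^esub>}\<rparr>,
      face = face B, degen = degen B\<rparr>"
begin

lemma q_group_hom: "group_hom (obj B m) (obj C m) (q m)"
  using q_hom by (simp add: group_hom_def group_hom_axioms_def)

lemma q_simps [simp]:
  "x \<in> carrier (obj B m) \<Longrightarrow> q m x \<in> carrier (obj C m)"
  "x \<in> carrier (obj B m) \<Longrightarrow> y \<in> carrier (obj B m) \<Longrightarrow>
    q m (x \<otimes>\<^bsub>obj B m\<^esub> y) = q m x \<otimes>\<^bsub>obj C m\<^esub> q m y"
  "x \<in> carrier (obj B m) \<Longrightarrow> q m (inv\<^bsub>obj B m\<^esub> x) = inv\<^bsub>obj C m\<^esub> q m x"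
  "q m \<one>\<^bsub>obj B m\<^esub> = \<one>\<^bsub>obj C m\<^esub>"
  using group_hom.hom_closed[OF q_group_hom] group_hom.hom_mult[OF q_group_hom]
    group_hom.hom_inv[OF q_group_hom] group_hom.hom_one[OF q_group_hom] by simp_all

lemma carrier_A: "carrier (obj A m) = {x \<in> carrier (obj B m). q m x = \<one>\<^bsub>obj C m\<^esub>}"
  and mult_A [simp]: "x \<otimes>\<^bsub>obj A m\<^esub> y = x \<otimes>\<^bsub>obj B m\<^esub> y"
  and one_A [simp]: "\<one>\<^bsub>obj A m\<^esub> = \<one>\<^bsub>obj B m\<^esub>"
  and face_A [simp]: "face A = face B" and degen_A [simp]: "degen A = degen B"
  by (simp_all add: A_def)

lemma set_mult_A [simp]: "H <#>\<^bsub>obj A m\<^esub> K = H <#>\<^bsub>obj B m\<^esub> K"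
  and coset_A [simp]: "H #>\<^bsub>obj A m\<^esub> x = H #>\<^bsub>obj B m\<^esub> x"
  by (simp_all add: set_mult_def r_coset_def)

lemma subgroup_A: "subgroup (carrier (obj A m)) (obj B m)"
  using group_hom.subgroup_kernel[OF q_group_hom] by (simp add: carrier_A kernel_def)

lemma obj_A: "obj A m = (obj B m)\<lparr>carrier := carrier (obj A m)\<rparr>"
  by (simp add: A_def)

lemma simplicial_A: "simplicial_group A"
proof -
  have 1: "group (obj A m)" for m
    by (subst obj_A) (rule group.subgroup_imp_group[OF B.grp subgroup_A])
  have 2: "face B (Suc m) i \<in> hom (obj A (Suc m)) (obj A m)" if "i \<le> Suc m" for m i
    using that q_face by (auto simp: hom_def carrier_A)
  have 3: "degen B m i \<in> hom (obj A m) (obj A (Suc m))" if "i \<le> m" for m i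
    using that q_degen group_hom.hom_mult[OF B.degen_hom] by (auto simp: hom_def carrier_A)
  show ?thesis
    unfolding simplicial_group_def using 1 2 3 B.face_face B.face_degen B.degen_degen
    by (auto simp: carrier_A)
qed

sublocale A: simplicial_grp A
  by unfold_locales (rule simplicial_A)

lemma moore_A: "moore A m = moore B m \<inter> carrier (obj A m)"
  by (auto simp: moore_def carrier_A)

lemma moore_cycles_A: "moore_cycles A m = moore_cycles B m \<inter> carrier (obj A m)"
  by (auto simp: moore_cycles_def moore_A)

lemma boundaries_A: "moore_boundaries A m \<subseteq> moore_boundaries B m"
  by (auto simp: moore_boundaries_def moore_A)

lemma q_moore:
  assumes "x \<in> moore B m"
  shows "q m x \<in> moore C m"
proof (cases m)
  case 0
  then show ?thesis using assms q_simps(1)[of x 0] by (simp add: B.moore_0 C.moore_0)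
next
  case (Suc m')
  then show ?thesis using assms by (auto simp: B.moore_Suc C.moore_Suc q_face[symmetric])
qed

lemma q_cycle:
  assumes "x \<in> moore_cycles B m"
  shows "q m x \<in> moore_cycles C m"
proof (cases m)
  case 0
  then show ?thesis using assms q_simps(1)[of x 0] by (simp add: B.moore_cycles_0 C.moore_cycles_0)
next
  case (Suc m')
  then show ?thesis using assms by (auto simp: B.moore_cycles_Suc C.moore_cycles_Suc q_face[symmetric])
qed

lemma q_boundary:
  assumes "x \<in> moore_boundaries B m"
  shows "q m x \<in> moore_boundaries C m"
proof -
  obtain y where y: "y \<in> moore B (Suc m)" "x = face B (Suc m) (Suc m) y"
    using assms by (auto simp: moore_boundaries_def)
  then have "q m x = face C (Suc m) (Suc m) (q (Suc m) y)"
    using q_face B.moore_carrier by blast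
  then show ?thesis using q_moore[OF y(1)] unfolding moore_boundaries_def by blast
qed

text \<open>A lift is corrected by a filler, in the kernel, of the horn formed by its faces.\<close>

lemma moore_lift:
  assumes c: "c \<in> moore C m"
  obtains b where "b \<in> moore B m" "q m b = c"
proof (cases m)
  case 0
  then have "c \<in> q 0 ` carrier (obj B 0)" using c q_surj[of 0] by (simp add: C.moore_0)
  then obtain b where "b \<in> carrier (obj B 0)" "q 0 b = c" by blast
  then show ?thesis using 0 by (intro that[of b]) (simp_all add: B.moore_0)
next
  case (Suc m')
  obtain b where b: "b \<in> carrier (obj B m)" "q m b = c"
    using q_surj[of m] C.moore_carrier[OF c] by (metis imageE)
  define x where "x i = face B (Suc m') i b" for i
  have x: "x i \<in> carrier (obj A m')" if "i < Suc m'" for i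
    using that b c by (auto simp: x_def carrier_A Suc q_face C.moore_Suc)
  have match: "face A m' i (x j) = face A m' (j - 1) (x i)" if "i < j" "j < Suc m'" for i j
  proof -
    obtain m'' where m'': "m' = Suc m''" using \<open>i < j\<close> \<open>j < Suc m'\<close> by (cases m') auto
    show ?thesis using B.face_face[of b m'' i j] that b unfolding x_def Suc m'' by simp
  qed
  obtain a where a: "a \<in> carrier (obj A m)" "\<And>i. i < Suc m' \<Longrightarrow> face A m i a = x i"
    using A.horn_filler[of "Suc m'" m' x, OF _ x match] unfolding Suc by auto
  let ?b = "b \<otimes>\<^bsub>obj B m\<^esub> inv\<^bsub>obj B m\<^esub> a"
  have "?b \<in> moore B m"
    using a b x unfolding Suc by (auto simp: B.moore_Suc carrier_A x_def)
  moreover have "q m ?b = c" using a b C.moore_carrier[OF c] by (simp add: carrier_A)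
  ultimately show ?thesis by (rule that)
qed

lemma homotopy_map_incl:
  assumes "z \<in> carrier (obj A m)"
  shows "homotopy_map B (\<lambda>m C. C) m (homotopy_class A m z) = homotopy_class B m z"
proof -
  have "(\<lambda>x. x) \<in> hom (obj A m) (obj B m)" by (auto simp: hom_def carrier_A)
  then interpret h: group_hom "obj A m" "obj B m" "\<lambda>x. x"
    by (simp add: group_hom_def group_hom_axioms_def)
  show ?thesis
    unfolding homotopy_map_def
    using h.coset_image[OF A.boundaries_normal B.boundaries_normal _ assms] boundaries_A by simp
qed

lemma homotopy_map_q:
  assumes "z \<in> carrier (obj B m)"
  shows "homotopy_map C q m (homotopy_class B m z) = homotopy_class C m (q m z)"
  unfolding homotopy_map_def
  using group_hom.coset_image[OF q_group_hom B.boundaries_normal C.boundaries_normal _ assms] q_boundary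
  by blast

definition connecting :: "nat \<Rightarrow> 'c set \<Rightarrow> 'b set" where
  "connecting m \<zeta> = moore_boundaries A m <#>\<^bsub>obj A m\<^esub>
     {face B (Suc m) (Suc m) y | y. y \<in> moore B (Suc m) \<and> q (Suc m) y \<in> \<zeta>}"

lemma boundary_of_lift:
  assumes "y \<in> moore B (Suc m)" "q (Suc m) y \<in> moore_cycles C (Suc m)"
  shows "face B (Suc m) (Suc m) y \<in> moore_cycles A m"
  using assms B.boundary_cycle[of y m]
  by (auto simp: moore_cycles_A carrier_A B.moore_cycles_carrier q_face B.moore_carrier C.moore_cycles_Suc)

text \<open>This is independence of the choices in the connecting map. Lifts of homologous cycles
  differ by a cycle of B lying over the boundary and by a Moore chain of A; the former has trivial
  last face and the latter contributes a boundary of A.\<close>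

lemma connecting_class:
  assumes y: "y \<in> moore B (Suc m)" and z: "q (Suc m) y \<in> moore_cycles C (Suc m)"
  shows "connecting m (homotopy_class C (Suc m) (q (Suc m) y)) = homotopy_class A m (face B (Suc m) (Suc m) y)"
proof -
  let ?d = "face B (Suc m) (Suc m)"
  let ?Y = "{?d y' | y'. y' \<in> moore B (Suc m) \<and> q (Suc m) y' \<in> homotopy_class C (Suc m) (q (Suc m) y)}"
  interpret CM: group "obj C (Suc m)" by simp
  interpret bA: subgroup "moore_boundaries A m" "obj A m" by (rule A.subgroup_boundaries)
  have yc: "y \<in> carrier (obj B (Suc m))" and dyc: "?d y \<in> carrier (obj B m)"
    using y by (simp_all add: B.moore_carrier)
  have Y: "?Y \<subseteq> homotopy_class A m (?d y)"
  proof
    fix e assume "e \<in> ?Y"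
    then obtain y' c where y': "y' \<in> moore B (Suc m)" "e = ?d y'" "c \<in> moore_boundaries C (Suc m)"
      "q (Suc m) y' = c \<otimes>\<^bsub>obj C (Suc m)\<^esub> q (Suc m) y"
      by (auto simp: r_coset_def)
    obtain v where v: "v \<in> moore C (Suc (Suc m))" "c = face C (Suc (Suc m)) (Suc (Suc m)) v"
      using y' by (auto simp: moore_boundaries_def)
    obtain w where w: "w \<in> moore B (Suc (Suc m))" "q (Suc (Suc m)) w = v"
      using moore_lift[OF v(1)] .
    define b where "b = face B (Suc (Suc m)) (Suc (Suc m)) w"
    have b: "b \<in> moore_cycles B (Suc m)" "q (Suc m) b = c"
      using B.boundary_cycle[OF w(1)] q_face[of w "Suc m" "Suc (Suc m)"] w v by (auto simp: b_def B.moore_carrier)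
    have bc: "b \<in> carrier (obj B (Suc m))" and db: "\<And>i. i \<le> Suc m \<Longrightarrow> face B (Suc m) i b = \<one>\<^bsub>obj B m\<^esub>"
      using b by (auto simp: B.moore_cycles_Suc)
    have y'c: "y' \<in> carrier (obj B (Suc m))" using y' by (simp add: B.moore_carrier)
    \<comment> \<open>The cycle b lies over c, so dividing it out of \<open>y'\<close> on the left
      yields a chain with the same image as y. The quotient by y then lies in the kernel A, and the
      last face of b drops out.\<close>
    define a where "a = inv\<^bsub>obj B (Suc m)\<^esub> b \<otimes>\<^bsub>obj B (Suc m)\<^esub> y' \<otimes>\<^bsub>obj B (Suc m)\<^esub> inv\<^bsub>obj B (Suc m)\<^esub> y"
    have ac: "a \<in> carrier (obj B (Suc m))" using bc y'c yc by (simp add: a_def)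
    have "q (Suc m) a = \<one>\<^bsub>obj C (Suc m)\<^esub>"
      using bc y'c yc b y'(4) by (simp add: a_def C.assoc[symmetric] flip: b(2))
    moreover have "a \<in> moore B (Suc m)"
      using ac y y' db bc y'c yc by (auto simp: B.moore_Suc a_def)
    ultimately have "a \<in> moore A (Suc m)" using ac by (simp add: moore_A carrier_A)
    then have "?d a \<in> moore_boundaries A m" by (auto simp: moore_boundaries_def)
    moreover have "?d a \<otimes>\<^bsub>obj B m\<^esub> ?d y = e"
      using ac bc y'c yc db y' by (simp add: a_def B.assoc)
    ultimately show "e \<in> homotopy_class A m (?d y)" by (auto simp: r_coset_def)
  qed
  have dy: "?d y \<in> ?Y"
    using y CM.rcos_self[OF C.moore_cycles_carrier[OF z] C.subgroup_boundaries] by blast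
  have dyA: "?d y \<in> carrier (obj A m)" using A.moore_cycles_carrier[OF boundary_of_lift[OF y z]] .
  show ?thesis
  proof
    show "connecting m (homotopy_class C (Suc m) (q (Suc m) y)) \<subseteq> homotopy_class A m (?d y)"
    proof
      fix e assume "e \<in> connecting m (homotopy_class C (Suc m) (q (Suc m) y))"
      then obtain b e' where e: "b \<in> moore_boundaries A m" "e' \<in> ?Y" "e = b \<otimes>\<^bsub>obj B m\<^esub> e'"
        unfolding connecting_def set_mult_def by force
      then obtain b' where b': "b' \<in> moore_boundaries A m" "e' = b' \<otimes>\<^bsub>obj B m\<^esub> ?d y"
        using Y by (auto simp: r_coset_def)
      have "e = (b \<otimes>\<^bsub>obj A m\<^esub> b') \<otimes>\<^bsub>obj B m\<^esub> ?d y"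
        using e b' dyc boundaries_A[of m] B.boundaries_carrier[of _ m] by (simp add: B.assoc subset_iff)
      then show "e \<in> homotopy_class A m (?d y)"
        using bA.m_closed[OF e(1) b'(1)] by (auto simp: r_coset_def)
    qed
    show "homotopy_class A m (?d y) \<subseteq> connecting m (homotopy_class C (Suc m) (q (Suc m) y))"
    proof
      fix e assume "e \<in> homotopy_class A m (?d y)"
      then obtain b where "b \<in> moore_boundaries A m" "e = b \<otimes>\<^bsub>obj A m\<^esub> ?d y"
        by (auto simp: r_coset_def)
      then show "e \<in> connecting m (homotopy_class C (Suc m) (q (Suc m) y))"
        unfolding connecting_def using set_multI[OF _ dy, of b "moore_boundaries A m" "obj A m"] by (simp only:)
    qed
  qed
qed

lemma incl_hom: "homotopy_map B (\<lambda>m C. C) m \<in> hom (homotopy_group A m) (homotopy_group B m)"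
proof (rule homI)
  fix \<xi> assume "\<xi> \<in> carrier (homotopy_group A m)"
  then show "homotopy_map B (\<lambda>m C. C) m \<xi> \<in> carrier (homotopy_group B m)"
    by (auto simp: A.carrier_homotopy B.carrier_homotopy homotopy_map_incl[OF A.moore_cycles_carrier, simplified] moore_cycles_A)
next
  fix \<xi> \<eta> assume "\<xi> \<in> carrier (homotopy_group A m)" "\<eta> \<in> carrier (homotopy_group A m)"
  then obtain x y where xy: "x \<in> carrier (obj A m)" "y \<in> carrier (obj A m)"
    "\<xi> = homotopy_class A m x" "\<eta> = homotopy_class A m y"
    unfolding A.carrier_homotopy using A.moore_cycles_carrier by blast
  have "x \<in> carrier (obj B m)" "y \<in> carrier (obj B m)" using xy by (auto simp: carrier_A)
  then show "homotopy_map B (\<lambda>m C. C) m (\<xi> \<otimes>\<^bsub>homotopy_group A m\<^esub> \<eta>) =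
      homotopy_map B (\<lambda>m C. C) m \<xi> \<otimes>\<^bsub>homotopy_group B m\<^esub> homotopy_map B (\<lambda>m C. C) m \<eta>"
    unfolding xy(3,4) A.mult_homotopy[OF xy(1,2)]
      homotopy_map_incl[OF xy(1)] homotopy_map_incl[OF xy(2)] homotopy_map_incl[OF A.closed(1)[OF xy(1,2)]]
    by (simp add: B.mult_homotopy)
qed

lemma q_map_hom: "homotopy_map C q m \<in> hom (homotopy_group B m) (homotopy_group C m)"
proof (rule homI)
  fix \<xi> assume "\<xi> \<in> carrier (homotopy_group B m)"
  then show "homotopy_map C q m \<xi> \<in> carrier (homotopy_group C m)"
    by (auto simp: C.carrier_homotopy B.carrier_homotopy homotopy_map_q B.moore_cycles_carrier q_cycle)
next
  fix \<xi> \<eta> assume "\<xi> \<in> carrier (homotopy_group B m)" "\<eta> \<in> carrier (homotopy_group B m)"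
  then show "homotopy_map C q m (\<xi> \<otimes>\<^bsub>homotopy_group B m\<^esub> \<eta>) =
      homotopy_map C q m \<xi> \<otimes>\<^bsub>homotopy_group C m\<^esub> homotopy_map C q m \<eta>"
    by (auto simp: B.carrier_homotopy B.mult_homotopy C.mult_homotopy homotopy_map_q B.moore_cycles_carrier)
qed

lemma homotopy_class_lift:
  assumes "\<zeta> \<in> carrier (homotopy_group C (Suc m))"
  obtains y where "y \<in> moore B (Suc m)" "q (Suc m) y \<in> moore_cycles C (Suc m)"
    "\<zeta> = homotopy_class C (Suc m) (q (Suc m) y)"
proof -
  obtain z where z: "z \<in> moore_cycles C (Suc m)" "\<zeta> = homotopy_class C (Suc m) z"
    using assms by (auto simp: C.carrier_homotopy)
  obtain y where "y \<in> moore B (Suc m)" "q (Suc m) y = z"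
    using moore_lift[OF C.moore_cycles_moore[OF z(1)]] .
  then show ?thesis using z by (intro that[of y]) simp_all
qed

lemma connecting_hom: "connecting m \<in> hom (homotopy_group C (Suc m)) (homotopy_group A m)"
proof (rule homI)
  fix \<xi> assume "\<xi> \<in> carrier (homotopy_group C (Suc m))"
  then obtain y where "y \<in> moore B (Suc m)" "q (Suc m) y \<in> moore_cycles C (Suc m)"
    "\<xi> = homotopy_class C (Suc m) (q (Suc m) y)" by (rule homotopy_class_lift)
  then show "connecting m \<xi> \<in> carrier (homotopy_group A m)"
    using boundary_of_lift by (simp only: connecting_class A.carrier_homotopy) blast
next
  fix \<xi> \<eta> assume "\<xi> \<in> carrier (homotopy_group C (Suc m))" "\<eta> \<in> carrier (homotopy_group C (Suc m))"
  then obtain y w where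
    y: "y \<in> moore B (Suc m)" "q (Suc m) y \<in> moore_cycles C (Suc m)" "\<xi> = homotopy_class C (Suc m) (q (Suc m) y)"
    and w: "w \<in> moore B (Suc m)" "q (Suc m) w \<in> moore_cycles C (Suc m)" "\<eta> = homotopy_class C (Suc m) (q (Suc m) w)"
    by (metis homotopy_class_lift)
  let ?d = "face B (Suc m) (Suc m)"
  have yw: "y \<otimes>\<^bsub>obj B (Suc m)\<^esub> w \<in> moore B (Suc m)"
    using subgroup.m_closed[OF B.subgroup_moore y(1) w(1)] .
  have c: "y \<in> carrier (obj B (Suc m))" "w \<in> carrier (obj B (Suc m))"
    using y w B.moore_carrier by auto
  have qyw: "q (Suc m) (y \<otimes>\<^bsub>obj B (Suc m)\<^esub> w) \<in> moore_cycles C (Suc m)"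
    using subgroup.m_closed[OF C.subgroup_moore_cycles y(2) w(2)] c by simp
  have "\<xi> \<otimes>\<^bsub>homotopy_group C (Suc m)\<^esub> \<eta> = homotopy_class C (Suc m) (q (Suc m) (y \<otimes>\<^bsub>obj B (Suc m)\<^esub> w))"
    using c by (simp add: y(3) w(3) C.mult_homotopy)
  moreover have "?d y \<in> carrier (obj A m)" "?d w \<in> carrier (obj A m)"
    using boundary_of_lift[OF y(1,2)] boundary_of_lift[OF w(1,2)] A.moore_cycles_carrier by blast+
  ultimately show "connecting m (\<xi> \<otimes>\<^bsub>homotopy_group C (Suc m)\<^esub> \<eta>) =
      connecting m \<xi> \<otimes>\<^bsub>homotopy_group A m\<^esub> connecting m \<eta>"
    using connecting_class[OF yw qyw] connecting_class[OF y(1,2)] connecting_class[OF w(1,2)] c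
      A.mult_homotopy[of "?d y" m "?d w"]
    by (simp add: y(3) w(3))
qed

lemma exact_middle:
  "homotopy_map B (\<lambda>m C. C) m ` carrier (homotopy_group A m) =
   {w \<in> carrier (homotopy_group B m). homotopy_map C q m w = \<one>\<^bsub>homotopy_group C m\<^esub>}"
proof (intro equalityI subsetI)
  fix w assume "w \<in> homotopy_map B (\<lambda>m C. C) m ` carrier (homotopy_group A m)"
  then obtain z where z: "z \<in> moore_cycles A m" "w = homotopy_class B m z"
    using homotopy_map_incl A.moore_cycles_carrier unfolding A.carrier_homotopy by fastforce
  then have zc: "z \<in> carrier (obj B m)" "z \<in> moore_cycles B m" "q m z = \<one>\<^bsub>obj C m\<^esub>"
    by (auto simp: moore_cycles_A carrier_A)
  then have "homotopy_map C q m w = moore_boundaries C m"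
    using homotopy_map_q C.homotopy_class_one_iff subgroup.one_closed[OF C.subgroup_boundaries]
    by (simp add: z(2))
  then show "w \<in> {w \<in> carrier (homotopy_group B m). homotopy_map C q m w = \<one>\<^bsub>homotopy_group C m\<^esub>}"
    using z zc by (auto simp: B.carrier_homotopy)
next
  fix w assume "w \<in> {w \<in> carrier (homotopy_group B m). homotopy_map C q m w = \<one>\<^bsub>homotopy_group C m\<^esub>}"
  then obtain z where z: "z \<in> moore_cycles B m" "w = homotopy_class B m z"
    and "homotopy_map C q m w = moore_boundaries C m"
    by (auto simp: B.carrier_homotopy)
  then have "q m z \<in> moore_boundaries C m"
    using C.homotopy_class_one_iff[of "q m z" m] B.moore_cycles_carrier[OF z(1)] by (simp add: homotopy_map_q)
  then obtain c where c: "c \<in> moore C (Suc m)" "q m z = face C (Suc m) (Suc m) c"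
    by (auto simp: moore_boundaries_def)
  obtain b where b: "b \<in> moore B (Suc m)" "q (Suc m) b = c" using moore_lift[OF c(1)] .
  let ?b = "face B (Suc m) (Suc m) b"
  have bb: "?b \<in> moore_boundaries B m" using b by (auto simp: moore_boundaries_def)
  have bc: "?b \<in> carrier (obj B m)" and zc: "z \<in> carrier (obj B m)"
    using B.boundaries_carrier[OF bb] B.moore_cycles_carrier[OF z(1)] by auto
  \<comment> \<open>The image of z bounds c. Dividing z by the boundary of a lift of c moves it into
    the kernel without changing its class in B.\<close>
  let ?z = "inv\<^bsub>obj B m\<^esub> ?b \<otimes>\<^bsub>obj B m\<^esub> z"
  have "?z \<in> moore_cycles B m"
    using subgroup.m_closed[OF B.subgroup_moore_cycles subgroup.m_inv_closed[OF B.subgroup_moore_cycles]]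
      z(1) B.boundary_cycle[OF b(1)] by blast
  moreover have "q m ?z = \<one>\<^bsub>obj C m\<^esub>"
    using q_face[OF B.moore_carrier[OF b(1)], of "Suc m"] b c bc zc q_simps(1)[OF zc] by simp
  ultimately have "?z \<in> moore_cycles A m" using bc zc by (simp add: moore_cycles_A carrier_A)
  moreover have "homotopy_class B m ?z = w"
    using bc zc bb z(2) B.homotopy_class_eq_iff[of ?z m z]
      subgroup.m_inv_closed[OF B.subgroup_boundaries bb] by (simp add: B.assoc)
  ultimately show "w \<in> homotopy_map B (\<lambda>m C. C) m ` carrier (homotopy_group A m)"
    using homotopy_map_incl[OF A.moore_cycles_carrier] unfolding A.carrier_homotopy by (metis imageI)
qed

lemma exact_right:
  "homotopy_map C q (Suc m) ` carrier (homotopy_group B (Suc m)) =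
   {w \<in> carrier (homotopy_group C (Suc m)). connecting m w = \<one>\<^bsub>homotopy_group A m\<^esub>}"
proof (intro equalityI subsetI)
  fix w assume "w \<in> homotopy_map C q (Suc m) ` carrier (homotopy_group B (Suc m))"
  then obtain z where z: "z \<in> moore_cycles B (Suc m)" "w = homotopy_class C (Suc m) (q (Suc m) z)"
    using homotopy_map_q B.moore_cycles_carrier unfolding B.carrier_homotopy by fastforce
  have "connecting m w = homotopy_class A m \<one>\<^bsub>obj B m\<^esub>"
    using connecting_class[OF B.moore_cycles_moore[OF z(1)] q_cycle[OF z(1)]] z
    by (simp add: B.moore_cycles_Suc)
  also have "\<dots> = moore_boundaries A m"
    using A.homotopy_class_one_iff[OF A.closed(3)] subgroup.one_closed[OF A.subgroup_boundaries] by simp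
  finally show "w \<in> {w \<in> carrier (homotopy_group C (Suc m)). connecting m w = \<one>\<^bsub>homotopy_group A m\<^esub>}"
    using q_cycle[OF z(1)] z(2) by (auto simp: C.carrier_homotopy)
next
  fix w assume w: "w \<in> {w \<in> carrier (homotopy_group C (Suc m)). connecting m w = \<one>\<^bsub>homotopy_group A m\<^esub>}"
  then obtain y where y: "y \<in> moore B (Suc m)" "q (Suc m) y \<in> moore_cycles C (Suc m)"
    "w = homotopy_class C (Suc m) (q (Suc m) y)"
    using homotopy_class_lift[of w] by blast
  let ?d = "face B (Suc m) (Suc m)"
  have "homotopy_class A m (?d y) = moore_boundaries A m"
    using w connecting_class[OF y(1,2)] y(3) by simp
  then have "?d y \<in> moore_boundaries A m"
    using A.homotopy_class_one_iff[OF A.moore_cycles_carrier[OF boundary_of_lift[OF y(1,2)]]] by simp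
  then obtain a where a: "a \<in> moore A (Suc m)" "?d y = ?d a" by (auto simp: moore_boundaries_def)
  \<comment> \<open>Both y and a have the same last face, and a maps to the identity. Hence the
    quotient is a cycle with the same image as y.\<close>
  let ?z = "y \<otimes>\<^bsub>obj B (Suc m)\<^esub> inv\<^bsub>obj B (Suc m)\<^esub> a"
  have ac: "a \<in> carrier (obj B (Suc m))" "a \<in> moore B (Suc m)" "q (Suc m) a = \<one>\<^bsub>obj C (Suc m)\<^esub>"
    and yc: "y \<in> carrier (obj B (Suc m))"
    using a y by (auto simp: moore_A carrier_A B.moore_carrier)
  have "?z \<in> moore_cycles B (Suc m)"
    using a(2) ac y yc unfolding moore_cycles_def
    by (auto simp: B.moore_Suc)
  moreover have "q (Suc m) ?z = q (Suc m) y" using ac yc by simp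
  ultimately have "w = homotopy_map C q (Suc m) (homotopy_class B (Suc m) ?z)"
    "homotopy_class B (Suc m) ?z \<in> carrier (homotopy_group B (Suc m))"
    using y(3) homotopy_map_q[of ?z "Suc m"] ac yc by (auto simp: B.carrier_homotopy)
  then show "w \<in> homotopy_map C q (Suc m) ` carrier (homotopy_group B (Suc m))" by blast
qed

lemma exact_left:
  "connecting m ` carrier (homotopy_group C (Suc m)) =
   {w \<in> carrier (homotopy_group A m). homotopy_map B (\<lambda>m C. C) m w = \<one>\<^bsub>homotopy_group B m\<^esub>}"
proof (intro equalityI subsetI)
  fix w assume "w \<in> connecting m ` carrier (homotopy_group C (Suc m))"
  then obtain \<zeta> where \<zeta>: "\<zeta> \<in> carrier (homotopy_group C (Suc m))" "w = connecting m \<zeta>" by blast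
  obtain y where y: "y \<in> moore B (Suc m)" "q (Suc m) y \<in> moore_cycles C (Suc m)"
    "\<zeta> = homotopy_class C (Suc m) (q (Suc m) y)"
    using homotopy_class_lift[OF \<zeta>(1)] .
  let ?dy = "face B (Suc m) (Suc m) y"
  have w: "w = homotopy_class A m ?dy" using \<zeta> y connecting_class by simp
  have dy: "?dy \<in> moore_cycles A m" by (rule boundary_of_lift[OF y(1,2)])
  have "?dy \<in> moore_boundaries B m" using y by (auto simp: moore_boundaries_def)
  then have "homotopy_map B (\<lambda>m C. C) m w = moore_boundaries B m"
    using homotopy_map_incl[OF A.moore_cycles_carrier[OF dy]] B.homotopy_class_one_iff B.boundaries_carrier
    by (simp add: w)
  then show "w \<in> {w \<in> carrier (homotopy_group A m). homotopy_map B (\<lambda>m C. C) m w = \<one>\<^bsub>homotopy_group B m\<^esub>}"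
    using dy w by (auto simp: A.carrier_homotopy)
next
  fix w assume "w \<in> {w \<in> carrier (homotopy_group A m). homotopy_map B (\<lambda>m C. C) m w = \<one>\<^bsub>homotopy_group B m\<^esub>}"
  then obtain z where z: "z \<in> moore_cycles A m" "w = homotopy_class A m z"
    "homotopy_map B (\<lambda>m C. C) m w = moore_boundaries B m"
    by (auto simp: A.carrier_homotopy)
  have zA: "z \<in> carrier (obj A m)" using z A.moore_cycles_carrier by blast
  then have zB: "z \<in> carrier (obj B m)" "q m z = \<one>\<^bsub>obj C m\<^esub>" by (auto simp: carrier_A)
  have "z \<in> moore_boundaries B m"
    using z(3) homotopy_map_incl[OF zA] B.homotopy_class_one_iff[OF zB(1)] z(2) by simp
  then obtain y where y: "y \<in> moore B (Suc m)" "z = face B (Suc m) (Suc m) y"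
    by (auto simp: moore_boundaries_def)
  \<comment> \<open>As z lies in A, the chain y bounding it in B becomes a cycle in C, and y is
    itself a lift from which the connecting map may be computed.\<close>
  have "q (Suc m) y \<in> moore_cycles C (Suc m)"
    using q_moore[OF y(1)] q_face[OF B.moore_carrier[OF y(1)], of "Suc m"] y(2) zB
    by (auto simp: moore_cycles_def)
  then have "homotopy_class C (Suc m) (q (Suc m) y) \<in> carrier (homotopy_group C (Suc m))"
    "connecting m (homotopy_class C (Suc m) (q (Suc m) y)) = w"
    using connecting_class[OF y(1)] y z by (auto simp: C.carrier_homotopy)
  then show "w \<in> connecting m ` carrier (homotopy_group C (Suc m))" by blast
qed

end

section \<open>The spectral sequence of a filtered simplicial group\<close>

locale filtered_simplicial = simplicial_grp S for S :: "'a simplicial" +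
  fixes Fil :: "nat \<Rightarrow> nat \<Rightarrow> 'a set"
  assumes Fil_normal: "Fil n m \<lhd> obj S m"
    and Fil_face: "x \<in> Fil n (Suc m) \<Longrightarrow> i \<le> Suc m \<Longrightarrow> face S (Suc m) i x \<in> Fil n m"
    and Fil_degen: "x \<in> Fil n m \<Longrightarrow> i \<le> m \<Longrightarrow> degen S m i x \<in> Fil n (Suc m)"
    and Fil_0: "Fil 0 m = carrier (obj S m)"
    and Fil_Suc: "Fil (Suc n) m \<subseteq> Fil n m"
begin

abbreviation co :: "nat \<Rightarrow> nat \<Rightarrow> 'a \<Rightarrow> 'a set" where
  "co n m x \<equiv> Fil n m #>\<^bsub>obj S m\<^esub> x"

lemma Fil_carrier: "x \<in> Fil n m \<Longrightarrow> x \<in> carrier (obj S m)"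
  using subgroup.mem_carrier[OF normal_imp_subgroup[OF Fil_normal]] .

lemma co_eq_iff: "x \<in> carrier (obj S m) \<Longrightarrow> y \<in> carrier (obj S m) \<Longrightarrow>
    co n m x = co n m y \<longleftrightarrow> x \<otimes>\<^bsub>obj S m\<^esub> inv\<^bsub>obj S m\<^esub> y \<in> Fil n m"
  using normal.rcos_eq_iff[OF Fil_normal] .

lemma co_one_iff: "x \<in> carrier (obj S m) \<Longrightarrow> co n m x = Fil n m \<longleftrightarrow> x \<in> Fil n m"
  using normal.rcos_eq_self_iff[OF Fil_normal] .

lemma obj_quot: "obj (quot S Fil n) m = obj S m Mod Fil n m"
  by (simp add: quot_def subquotient_def)

lemma group_quot: "group (obj (quot S Fil n) m)"
  unfolding obj_quot by (rule normal.factorgroup_is_group[OF Fil_normal])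

lemma carrier_quot: "carrier (obj (quot S Fil n) m) = co n m ` carrier (obj S m)"
  by (simp add: obj_quot carrier_FactGroup)

lemma co_closed: "x \<in> carrier (obj S m) \<Longrightarrow> co n m x \<in> carrier (obj (quot S Fil n) m)"
  by (simp add: carrier_quot)

lemma one_quot [simp]: "\<one>\<^bsub>obj (quot S Fil n) m\<^esub> = Fil n m"
  by (simp add: obj_quot)

lemma mult_quot: "x \<in> carrier (obj S m) \<Longrightarrow> y \<in> carrier (obj S m) \<Longrightarrow>
    co n m x \<otimes>\<^bsub>obj (quot S Fil n) m\<^esub> co n m y = co n m (x \<otimes>\<^bsub>obj S m\<^esub> y)"
  using normal.rcos_sum[OF Fil_normal] by (simp add: obj_quot)

lemma inv_quot:
  assumes "x \<in> carrier (obj S m)"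
  shows "inv\<^bsub>obj (quot S Fil n) m\<^esub> co n m x = co n m (inv\<^bsub>obj S m\<^esub> x)"
proof -
  have "co n m \<one>\<^bsub>obj S m\<^esub> = Fil n m"
    using co_one_iff[of "\<one>\<^bsub>obj S m\<^esub>" m n] subgroup.one_closed[OF normal_imp_subgroup[OF Fil_normal]] by simp
  then show ?thesis
    using assms by (intro group.inv_equality[OF group_quot]) (simp_all add: mult_quot co_closed)
qed

lemma face_quot: "i \<le> Suc m \<Longrightarrow> x \<in> carrier (obj S (Suc m)) \<Longrightarrow>
    face (quot S Fil n) (Suc m) i (co n (Suc m) x) = co n m (face S (Suc m) i x)"
  using group_hom.coset_image[OF face_hom Fil_normal Fil_normal, of i m n n x] Fil_face
  by (auto simp: quot_def subquotient_def)

lemma degen_quot: "i \<le> m \<Longrightarrow> x \<in> carrier (obj S m) \<Longrightarrow>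
    degen (quot S Fil n) m i (co n m x) = co n (Suc m) (degen S m i x)"
  using group_hom.coset_image[OF degen_hom Fil_normal Fil_normal, of i m n n x] Fil_degen
  by (auto simp: quot_def subquotient_def)

lemma degen_mult: "i \<le> m \<Longrightarrow> x \<in> carrier (obj S m) \<Longrightarrow> y \<in> carrier (obj S m) \<Longrightarrow>
    degen S m i (x \<otimes>\<^bsub>obj S m\<^esub> y) = degen S m i x \<otimes>\<^bsub>obj S (Suc m)\<^esub> degen S m i y"
  by (rule group_hom.hom_mult[OF degen_hom])

lemma simplicial_quot: "simplicial_group (quot S Fil n)"
  unfolding simplicial_group_def
proof (intro conjI allI impI ballI)
  show "group (obj (quot S Fil n) m)" for m by (rule group_quot)
next
  fix m i :: nat assume "i \<le> Suc m"
  then show "face (quot S Fil n) (Suc m) i \<in> hom (obj (quot S Fil n) (Suc m)) (obj (quot S Fil n) m)"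
    by (auto simp: hom_def carrier_quot face_quot mult_quot)
next
  fix m i :: nat assume "i \<le> m"
  then show "degen (quot S Fil n) m i \<in> hom (obj (quot S Fil n) m) (obj (quot S Fil n) (Suc m))"
    by (auto simp: hom_def carrier_quot degen_quot mult_quot degen_mult)
next
  fix m i j :: nat and C assume C: "C \<in> carrier (obj (quot S Fil n) (Suc (Suc m)))" and ij: "i < j \<and> j \<le> Suc (Suc m)"
  obtain x where x: "x \<in> carrier (obj S (Suc (Suc m)))" "C = co n (Suc (Suc m)) x"
    using C by (auto simp: carrier_quot)
  show "face (quot S Fil n) (Suc m) i (face (quot S Fil n) (Suc (Suc m)) j C) =
      face (quot S Fil n) (Suc m) (j - 1) (face (quot S Fil n) (Suc (Suc m)) i C)"
    using x ij face_face[of x m i j] face_quot[of "j - 1" m "face S (Suc (Suc m)) i x" n]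
    by (auto simp: face_quot)
next
  fix m i j :: nat and C assume C: "C \<in> carrier (obj (quot S Fil n) m)" and ij: "i \<le> Suc m \<and> j \<le> m"
  obtain x where x: "x \<in> carrier (obj S m)" "C = co n m x"
    using C by (auto simp: carrier_quot)
  have fd: "face (quot S Fil n) (Suc m) i (degen (quot S Fil n) m j C) = co n m (face S (Suc m) i (degen S m j x))"
    using x ij by (simp add: face_quot degen_quot)
  consider "i < j" | "i = j \<or> i = Suc j" | "Suc j < i" by linarith
  then show "face (quot S Fil n) (Suc m) i (degen (quot S Fil n) m j C) =
      (if i < j then degen (quot S Fil n) (m - 1) (j - 1) (face (quot S Fil n) m i C)
       else if i = j \<or> i = Suc j then C
       else degen (quot S Fil n) (m - 1) j (face (quot S Fil n) m (i - 1) C))"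
  proof cases
    case 1
    then obtain m' where m: "m = Suc m'" using ij by (cases m) auto
    have "j - 1 \<le> m'" "i \<le> Suc m'" using 1 ij m by auto
    then show ?thesis using 1 x ij face_degen[OF x(1), of i j] unfolding fd
      by (simp add: m face_quot degen_quot)
  next
    case 2
    then show ?thesis using x ij face_degen[OF x(1), of i j] unfolding fd by auto
  next
    case 3
    then obtain m' where m: "m = Suc m'" using ij by (cases m) auto
    have "j \<le> m'" "i - 1 \<le> Suc m'" using 3 ij m by auto
    then show ?thesis using 3 x ij face_degen[OF x(1), of i j] unfolding fd
      by (simp add: m face_quot degen_quot)
  qed
next
  fix m i j :: nat and C assume C: "C \<in> carrier (obj (quot S Fil n) m)" and ij: "i \<le> j \<and> j \<le> m"
  obtain x where x: "x \<in> carrier (obj S m)" "C = co n m x"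
    using C by (auto simp: carrier_quot)
  show "degen (quot S Fil n) (Suc m) i (degen (quot S Fil n) m j C) =
      degen (quot S Fil n) (Suc m) (Suc j) (degen (quot S Fil n) m i C)"
    using x ij degen_degen[of x m i j] by (simp add: degen_quot)
qed

lemma id_hom: "group_hom (obj S m) (obj S m) (\<lambda>x. x)"
  by (simp add: group_hom_def group_hom_axioms_def hom_def Pi_def)

lemma quot_proj_co: "x \<in> carrier (obj S m) \<Longrightarrow> quot_proj S Fil n m (co (Suc n) m x) = co n m x"
  using group_hom.coset_image[OF id_hom Fil_normal Fil_normal, of "Suc n" m n x] Fil_Suc[of n m]
  by (simp add: quot_proj_def)

text \<open>The cosets in \<open>Fil n / Fil (n + 1)\<close> are literally elements of
  \<open>S / Fil (n + 1)\<close>, namely those that become trivial in \<open>S / Fil n\<close>. So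
  the graded piece equals the required kernel as a record, without passing through an
  isomorphism.\<close>

lemma simplicial_ses_quot:
  "simplicial_ses (quot S Fil (Suc n)) (quot S Fil n) (graded S Fil n) (quot_proj S Fil n)"
proof -
  have hom: "quot_proj S Fil n m \<in> hom (obj (quot S Fil (Suc n)) m) (obj (quot S Fil n) m)" for m
    by (auto simp: hom_def carrier_quot quot_proj_co mult_quot)
  have surj: "quot_proj S Fil n m ` carrier (obj (quot S Fil (Suc n)) m) = carrier (obj (quot S Fil n) m)" for m
    by (auto simp: carrier_quot quot_proj_co image_image)
  have carr: "co (Suc n) m ` Fil n m = {C \<in> carrier (obj (quot S Fil (Suc n)) m). quot_proj S Fil n m C = Fil n m}" for m
  proof (intro equalityI subsetI)
    fix C assume "C \<in> co (Suc n) m ` Fil n m"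
    then obtain x where x: "x \<in> Fil n m" "C = co (Suc n) m x" by blast
    then show "C \<in> {C \<in> carrier (obj (quot S Fil (Suc n)) m). quot_proj S Fil n m C = Fil n m}"
      using Fil_carrier[OF x(1)] co_one_iff[of x m n] by (simp add: co_closed quot_proj_co)
  next
    fix C assume "C \<in> {C \<in> carrier (obj (quot S Fil (Suc n)) m). quot_proj S Fil n m C = Fil n m}"
    then obtain x where x: "x \<in> carrier (obj S m)" "C = co (Suc n) m x" "co n m x = Fil n m"
      by (auto simp: carrier_quot quot_proj_co)
    then show "C \<in> co (Suc n) m ` Fil n m" using co_one_iff[of x m n] by simp
  qed
  have "obj (graded S Fil n) m = (obj (quot S Fil (Suc n)) m)
      \<lparr>carrier := {C \<in> carrier (obj (quot S Fil (Suc n)) m). quot_proj S Fil n m C = \<one>\<^bsub>obj (quot S Fil n) m\<^esub>}\<rparr>" for m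
    unfolding one_quot carr[symmetric]
    by (auto simp: graded_def subquotient_def obj_quot FactGroup_def RCOSETS_def set_mult_def r_coset_def fun_eq_iff)
  then have graded: "graded S Fil n = \<lparr>obj = \<lambda>m. (obj (quot S Fil (Suc n)) m)
      \<lparr>carrier := {C \<in> carrier (obj (quot S Fil (Suc n)) m). quot_proj S Fil n m C = \<one>\<^bsub>obj (quot S Fil n) m\<^esub>}\<rparr>,
      face = face (quot S Fil (Suc n)), degen = degen (quot S Fil (Suc n))\<rparr>"
    by (intro simplicial.equality ext) (simp_all add: graded_def quot_def subquotient_def)
  show ?thesis
  proof (unfold_locales)
    show "simplicial_group (quot S Fil (Suc n))" "simplicial_group (quot S Fil n)"
      by (rule simplicial_quot)+
  qed (use hom surj graded in \<open>auto simp: carrier_quot quot_proj_co face_quot degen_quot\<close>)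
qed

sublocale ses: simplicial_ses "quot S Fil (Suc n)" "quot S Fil n" "graded S Fil n" "quot_proj S Fil n" for n
  by (rule simplicial_ses_quot)

lemma connecting_map_eq: "connecting_map S Fil n m = ses.connecting n m"
  by (rule ext) (simp add: connecting_map_def ses.connecting_def)

lemma D_zero: "carrier (homotopy_group (quot S Fil 0) m) = {\<one>\<^bsub>homotopy_group (quot S Fil 0) m\<^esub>}"
proof -
  have "x \<in> moore_boundaries (quot S Fil 0) m" if x: "x \<in> moore_cycles (quot S Fil 0) m" for x
  proof -
    obtain y where "y \<in> carrier (obj S m)" "x = co 0 m y"
      using ses.C.moore_cycles_carrier[OF x] by (auto simp: carrier_quot)
    then have "x = \<one>\<^bsub>obj (quot S Fil 0) m\<^esub>"
      using co_one_iff[of y m 0] Fil_0[of m] by simp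
    then show ?thesis using subgroup.one_closed[OF ses.C.subgroup_boundaries[of 0 m]] by simp
  qed
  then show ?thesis using ses.C.trivial_homotopy_iff[of 0 m] by (auto simp: trivial_group_def)
qed

lemma exact_couple_filtration: "exact_couple (filtration_couple S Fil)"
  unfolding exact_couple_def
proof (intro conjI allI)
  fix n m
  show "group (Dgrp (filtration_couple S Fil) n m)" "group (Egrp (filtration_couple S Fil) n m)"
    by (simp_all add: filtration_couple_def ses.C.group_homotopy ses.A.group_homotopy)
  show "imap (filtration_couple S Fil) n m \<in> hom (Dgrp (filtration_couple S Fil) (Suc n) m) (Dgrp (filtration_couple S Fil) n m)"
    "kmap (filtration_couple S Fil) n m \<in> hom (Egrp (filtration_couple S Fil) n m) (Dgrp (filtration_couple S Fil) (Suc n) m)"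
    "bmap (filtration_couple S Fil) n m \<in> hom (Dgrp (filtration_couple S Fil) n (Suc m)) (Egrp (filtration_couple S Fil) n m)"
    by (simp_all only: filtration_couple_def couple.simps connecting_map_eq ses.q_map_hom ses.incl_hom ses.connecting_hom)
  show "kmap (filtration_couple S Fil) n m ` carrier (Egrp (filtration_couple S Fil) n m) =
      {w \<in> carrier (Dgrp (filtration_couple S Fil) (Suc n) m).
       imap (filtration_couple S Fil) n m w = \<one>\<^bsub>Dgrp (filtration_couple S Fil) n m\<^esub>}"
    unfolding filtration_couple_def couple.simps by (rule ses.exact_middle)
  show "bmap (filtration_couple S Fil) n m ` carrier (Dgrp (filtration_couple S Fil) n (Suc m)) =
      {x \<in> carrier (Egrp (filtration_couple S Fil) n m).
       kmap (filtration_couple S Fil) n m x = \<one>\<^bsub>Dgrp (filtration_couple S Fil) (Suc n) m\<^esub>}"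
    unfolding filtration_couple_def couple.simps connecting_map_eq by (rule ses.exact_left)
  show "imap (filtration_couple S Fil) n (Suc m) ` carrier (Dgrp (filtration_couple S Fil) (Suc n) (Suc m)) =
      {w \<in> carrier (Dgrp (filtration_couple S Fil) n (Suc m)).
       bmap (filtration_couple S Fil) n m w = \<one>\<^bsub>Egrp (filtration_couple S Fil) n m\<^esub>}"
    unfolding filtration_couple_def couple.simps connecting_map_eq by (rule ses.exact_right)
  show "carrier (Dgrp (filtration_couple S Fil) 0 m) = {\<one>\<^bsub>Dgrp (filtration_couple S Fil) 0 m\<^esub>}"
    unfolding filtration_couple_def couple.simps by (rule D_zero)
qed

sublocale exact_couple "filtration_couple S Fil"
  by (rule exact_couple_filtration)

lemma imap_iter_class:
  assumes x: "x \<in> carrier (obj S m)"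
  shows "imap_iter (filtration_couple S Fil) t n m (homotopy_class (quot S Fil (n + t)) m (co (n + t) m x)) =
    homotopy_class (quot S Fil n) m (co n m x)"
proof (induction t)
  case 0
  show ?case by simp
next
  case (Suc t)
  have "imap (filtration_couple S Fil) (n + t) m (homotopy_class (quot S Fil (Suc (n + t))) m (co (Suc (n + t)) m x)) =
      homotopy_class (quot S Fil (n + t)) m (co (n + t) m x)"
    using ses.homotopy_map_q[OF co_closed[OF x], of "n + t"] x by (simp add: filtration_couple_def quot_proj_co)
  then show ?case using Suc by simp
qed

lemma moore_quot_iff:
  assumes "x \<in> carrier (obj S (Suc m))"
  shows "co n (Suc m) x \<in> moore (quot S Fil n) (Suc m) \<longleftrightarrow> (\<forall>i\<le>m. face S (Suc m) i x \<in> Fil n m)"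
  using assms by (auto simp: ses.C.moore_Suc face_quot co_one_iff co_closed)

lemma moore_cycles_quot_iff:
  assumes "x \<in> carrier (obj S (Suc m))"
  shows "co n (Suc m) x \<in> moore_cycles (quot S Fil n) (Suc m) \<longleftrightarrow> (\<forall>i\<le>Suc m. face S (Suc m) i x \<in> Fil n m)"
  using assms by (auto simp: ses.C.moore_cycles_Suc face_quot co_one_iff co_closed)

text \<open>Boundaries of the quotient are expressed through chains of S whose faces, except the
  last, lie in the filtration. In this form they come from a closed condition in S, which is where
  compactness is available.\<close>

lemma boundaries_quot: "moore_boundaries (quot S Fil n) m =
    co n m ` face S (Suc m) (Suc m) ` {y \<in> carrier (obj S (Suc m)). \<forall>i\<le>m. face S (Suc m) i y \<in> Fil n m}"
    (is "_ = ?R")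
proof (intro equalityI subsetI)
  fix b assume "b \<in> moore_boundaries (quot S Fil n) m"
  then obtain Y where Y: "Y \<in> moore (quot S Fil n) (Suc m)" "b = face (quot S Fil n) (Suc m) (Suc m) Y"
    by (auto simp: moore_boundaries_def)
  then obtain y where y: "y \<in> carrier (obj S (Suc m))" "Y = co n (Suc m) y"
    using ses.C.moore_carrier[OF Y(1)] by (auto simp: carrier_quot)
  then show "b \<in> ?R" using Y moore_quot_iff[OF y(1)] by (auto simp: face_quot)
next
  fix b assume "b \<in> ?R"
  then obtain y where y: "y \<in> carrier (obj S (Suc m))" "\<forall>i\<le>m. face S (Suc m) i y \<in> Fil n m"
    "b = co n m (face S (Suc m) (Suc m) y)" by auto
  then have "co n (Suc m) y \<in> moore (quot S Fil n) (Suc m)" "b = face (quot S Fil n) (Suc m) (Suc m) (co n (Suc m) y)"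
    using moore_quot_iff by (simp_all add: face_quot)
  then show "b \<in> moore_boundaries (quot S Fil n) m" by (auto simp: moore_boundaries_def)
qed

lemma limit_map_one: "limit_map S Fil m n (moore_boundaries S m) = moore_boundaries (quot S Fil n) m"
proof -
  have sub: "co n m ` moore_boundaries S m \<subseteq> moore_boundaries (quot S Fil n) m"
  proof -
    have "moore S (Suc m) \<subseteq> {y \<in> carrier (obj S (Suc m)). \<forall>i\<le>m. face S (Suc m) i y \<in> Fil n m}"
      using subgroup.one_closed[OF normal_imp_subgroup[OF Fil_normal[of n m]]] by (auto simp: moore_Suc)
    then show ?thesis unfolding boundaries_quot unfolding moore_boundaries_def by (intro image_mono)
  qed
  let ?b = "moore_boundaries (quot S Fil n) m"
  interpret b: subgroup ?b "obj (quot S Fil n) m" by (rule ses.C.subgroup_boundaries)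
  have one: "Fil n m \<in> co n m ` moore_boundaries S m"
    using subgroup.one_closed[OF subgroup_boundaries[of m]] co_one_iff[of "\<one>\<^bsub>obj S m\<^esub>" m n]
      subgroup.one_closed[OF normal_imp_subgroup[OF Fil_normal[of n m]]] by (metis closed(3) imageI)
  show ?thesis
    unfolding limit_map_def homotopy_map_def
  proof (intro equalityI subsetI)
    fix e assume "e \<in> ?b <#>\<^bsub>obj (quot S Fil n) m\<^esub> (co n m ` moore_boundaries S m)"
    then obtain u v where "u \<in> ?b" "v \<in> ?b" "e = u \<otimes>\<^bsub>obj (quot S Fil n) m\<^esub> v"
      using sub unfolding set_mult_def by blast
    then show "e \<in> ?b" by (simp only: b.m_closed)
  next
    fix e assume e: "e \<in> ?b"
    have "e \<otimes>\<^bsub>obj (quot S Fil n) m\<^esub> Fil n m = e"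
      using ses.C.grp_simps(5)[of e n m] b.mem_carrier[OF e] by simp
    then show "e \<in> ?b <#>\<^bsub>obj (quot S Fil n) m\<^esub> (co n m ` moore_boundaries S m)"
      using set_multI[OF e one, of "obj (quot S Fil n) m"] by simp
  qed
qed

text \<open>Since the target is trivial, so is each of its filtration steps. The compatibility with
  the canonical isomorphism then only says that k vanishes on all representatives of the identity of
  \<open>E_infinity\<close>.\<close>

lemma converges_to_zero:
  assumes acyclic: "moore_cycles S (Suc m) \<subseteq> moore_boundaries S (Suc m)"
    and sep: "\<And>n w. w \<in> carrier (Dgrp (filtration_couple S Fil) (Suc n) (Suc m)) \<Longrightarrow>
      (\<And>t. w \<in> imap_iter (filtration_couple S Fil) t (Suc n) (Suc m) `
         carrier (Dgrp (filtration_couple S Fil) (Suc n + t) (Suc m))) \<Longrightarrow>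
      w = \<one>\<^bsub>Dgrp (filtration_couple S Fil) (Suc n) (Suc m)\<^esub>"
  shows "trivial_group (E_infinity (filtration_couple S Fil) n (Suc m))"
    and "converges_to (filtration_couple S Fil) (Suc m) (homotopy_group S (Suc m)) (limit_map S Fil (Suc m))"
proof -
  let ?C = "filtration_couple S Fil" and ?P = "homotopy_group S (Suc m)"
  note triv = E_infinity_trivial[OF sep]
  show "trivial_group (E_infinity ?C n (Suc m))" by (rule triv)
  have P: "trivial_group ?P" using acyclic by (simp add: trivial_homotopy_iff)
  then interpret P: group ?P by (simp add: trivial_group_def)
  have cP: "carrier ?P = {moore_boundaries S (Suc m)}" using P by (simp add: trivial_group_def)
  have lim: "limit_map S Fil (Suc m) n (moore_boundaries S (Suc m)) = \<one>\<^bsub>Dgrp ?C n (Suc m)\<^esub>" for n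
    by (simp add: limit_map_one filtration_couple_def)
  have F: "kernel ?P (Dgrp ?C n (Suc m)) (limit_map S Fil (Suc m) n) = {\<one>\<^bsub>?P\<^esub>}" for n
    using lim by (auto simp: kernel_def cP)
  show "converges_to ?C (Suc m) ?P (limit_map S Fil (Suc m))"
    unfolding converges_to_def Let_def F
  proof
    fix n
    let ?E = "E_infinity ?C n (Suc m)"
    let ?Q = "(?P\<lparr>carrier := {\<one>\<^bsub>?P\<^esub>}\<rparr>) Mod {\<one>\<^bsub>?P\<^esub>}"
    interpret E: group ?E using triv(1) by (simp add: trivial_group_def)
    have cE: "carrier ?E = {\<one>\<^bsub>?E\<^esub>}" using triv(1) by (simp add: trivial_group_def)
    have co1: "{\<one>\<^bsub>?P\<^esub>} #>\<^bsub>?P\<^esub> \<one>\<^bsub>?P\<^esub> = {\<one>\<^bsub>?P\<^esub>}"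
      by (simp add: r_coset_def del: one_homotopy)
    have cQ: "carrier ?Q = {{\<one>\<^bsub>?P\<^esub>}}"
      using co1 by (simp add: carrier_FactGroup del: one_homotopy)
    have "(\<lambda>_. \<one>\<^bsub>?E\<^esub>) \<in> iso ?Q ?E"
      by (auto simp: iso_def hom_def cQ cE bij_betw_def simp del: one_homotopy)
    moreover have "\<forall>x\<in>{\<one>\<^bsub>?P\<^esub>}. \<forall>e\<in>\<one>\<^bsub>?E\<^esub>. kmap ?C n (Suc m) e = limit_map S Fil (Suc m) (Suc n) x"
      using triv(2) lim by simp
    ultimately show "\<exists>\<phi>\<in>iso ?Q ?E. \<forall>x\<in>{\<one>\<^bsub>?P\<^esub>}. \<forall>e\<in>\<phi> ({\<one>\<^bsub>?P\<^esub>} #>\<^bsub>?P\<^esub> x).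
        kmap ?C n (Suc m) e = limit_map S Fil (Suc m) (Suc n) x"
      by (intro bexI[where x = "\<lambda>_. \<one>\<^bsub>?E\<^esub>"])
  qed
qed

end

section \<open>Filtrations of compact simplicial groups by closed subgroups with trivial
  intersection\<close>

locale compact_filtered_simplicial = filtered_simplicial S Fil for S :: "'a simplicial" and Fil +
  fixes T :: "nat \<Rightarrow> 'a topology"
  assumes top_group: "topological_group_on (obj S m) (T m)"
    and compact_T: "compact_space (T m)"
    and Hausdorff_T: "Hausdorff_space (T m)"
    and face_continuous: "i \<le> Suc m \<Longrightarrow> continuous_map (T (Suc m)) (T m) (face S (Suc m) i)"
    and Fil_closed: "closedin (T m) (Fil n m)"
    and Fil_Inter: "(\<And>n. x \<in> Fil n m) \<Longrightarrow> x = \<one>\<^bsub>obj S m\<^esub>"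
begin

lemma topspace_T: "topspace (T m) = carrier (obj S m)"
  using top_group by (simp add: topological_group_on_def)

lemma closedin_face_preimage:
  assumes "i \<le> Suc m" "closedin (T m) A"
  shows "closedin (T (Suc m)) {x \<in> carrier (obj S (Suc m)). face S (Suc m) i x \<in> A}"
  using closedin_continuous_map_preimage[OF face_continuous assms(2)] assms(1) by (simp add: topspace_T)

lemma Fil_anti: "n \<le> n' \<Longrightarrow> Fil n' m \<subseteq> Fil n m"
  by (rule lift_Suc_antimono_le[of "\<lambda>n. Fil n m"]) (rule Fil_Suc)

text \<open>For a fixed representative x0 the set consists of the products of an element of
  \<open>Fil n\<close>, the last face of a chain whose other faces lie in \<open>Fil n\<close>, and
  x0. It is the continuous image of a compact set in a Hausdorff space, hence closed.\<close>

lemma closedin_homotopy_class_preimage: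
  assumes w: "w \<in> carrier (homotopy_group (quot S Fil n) m)"
  shows "closedin (T m) {x \<in> carrier (obj S m). homotopy_class (quot S Fil n) m (co n m x) = w}"
proof -
  let ?d = "face S (Suc m) (Suc m)"
  let ?Z = "carrier (obj S (Suc m)) \<inter> (\<Inter>i\<in>{..m}. {y \<in> carrier (obj S (Suc m)). face S (Suc m) i y \<in> Fil n m})"
  obtain Y where Y: "Y \<in> moore_cycles (quot S Fil n) m" "w = homotopy_class (quot S Fil n) m Y"
    using w by (auto simp: ses.C.carrier_homotopy)
  obtain x0 where x0: "x0 \<in> carrier (obj S m)" "w = homotopy_class (quot S Fil n) m (co n m x0)"
    using ses.C.moore_cycles_carrier[OF Y(1)] Y(2) by (auto simp: carrier_quot)
  let ?f = "\<lambda>z. fst z \<otimes>\<^bsub>obj S m\<^esub> ?d (snd z) \<otimes>\<^bsub>obj S m\<^esub> x0"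
  have Z: "closedin (T (Suc m)) ?Z"
    using closedin_topspace[of "T (Suc m)"]
    by (intro closedin_Int closedin_INT closedin_face_preimage Fil_closed) (auto simp: topspace_T)
  have "closedin (prod_topology (T m) (T (Suc m))) (Fil n m \<times> ?Z)"
    using Z Fil_closed by (simp add: closedin_prod_Times_iff)
  then have comp: "compactin (prod_topology (T m) (T (Suc m))) (Fil n m \<times> ?Z)"
    by (intro closedin_compact_space) (simp_all add: compact_space_prod_topology compact_T)
  have cont: "continuous_map (prod_topology (T m) (T (Suc m))) (T m) ?f"
  proof (intro topological_group_on_mult[OF top_group])
    show "continuous_map (prod_topology (T m) (T (Suc m))) (T m) fst" by (rule continuous_map_fst)
    show "continuous_map (prod_topology (T m) (T (Suc m))) (T m) (\<lambda>z. ?d (snd z))"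
      using continuous_map_compose[OF continuous_map_snd face_continuous[of "Suc m" m]] by (simp add: comp_def)
    show "continuous_map (prod_topology (T m) (T (Suc m))) (T m) (\<lambda>z. x0)"
      using x0 by (simp add: topspace_T)
  qed
  have closed: "closedin (T m) (?f ` (Fil n m \<times> ?Z))"
    by (rule compactin_imp_closedin[OF Hausdorff_T image_compactin[OF comp cont]])
  have mem: "x \<in> ?f ` (Fil n m \<times> ?Z) \<longleftrightarrow> x \<in> carrier (obj S m) \<and> homotopy_class (quot S Fil n) m (co n m x) = w" for x
  proof
    assume "x \<in> ?f ` (Fil n m \<times> ?Z)"
    then obtain f y where fy: "f \<in> Fil n m" "y \<in> ?Z" "x = f \<otimes>\<^bsub>obj S m\<^esub> ?d y \<otimes>\<^bsub>obj S m\<^esub> x0"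
      by (elim imageE SigmaE) simp
    have c: "f \<in> carrier (obj S m)" "y \<in> carrier (obj S (Suc m))" "?d y \<in> carrier (obj S m)"
      using fy Fil_carrier by auto
    have xc: "x \<in> carrier (obj S m)" using c x0 fy by simp
    have "co n m (x \<otimes>\<^bsub>obj S m\<^esub> inv\<^bsub>obj S m\<^esub> x0) = co n m (?d y)"
      using c x0 xc fy by (subst co_eq_iff) (simp_all add: assoc)
    then have "co n m x \<otimes>\<^bsub>obj (quot S Fil n) m\<^esub> inv\<^bsub>obj (quot S Fil n) m\<^esub> co n m x0 \<in> moore_boundaries (quot S Fil n) m"
      using fy(2) xc x0 by (simp add: inv_quot mult_quot boundaries_quot)
    then show "x \<in> carrier (obj S m) \<and> homotopy_class (quot S Fil n) m (co n m x) = w"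
      using xc x0 ses.C.homotopy_class_eq_iff[OF co_closed co_closed] by simp
  next
    assume x: "x \<in> carrier (obj S m) \<and> homotopy_class (quot S Fil n) m (co n m x) = w"
    then have "co n m (x \<otimes>\<^bsub>obj S m\<^esub> inv\<^bsub>obj S m\<^esub> x0) \<in> moore_boundaries (quot S Fil n) m"
      using x0 ses.C.homotopy_class_eq_iff[OF co_closed co_closed, of x m x0 n] by (simp add: inv_quot mult_quot)
    then obtain y where y: "y \<in> ?Z" "co n m (x \<otimes>\<^bsub>obj S m\<^esub> inv\<^bsub>obj S m\<^esub> x0) = co n m (?d y)"
      by (auto simp: boundaries_quot)
    let ?g = "x \<otimes>\<^bsub>obj S m\<^esub> inv\<^bsub>obj S m\<^esub> x0 \<otimes>\<^bsub>obj S m\<^esub> inv\<^bsub>obj S m\<^esub> ?d y"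
    have yc: "y \<in> carrier (obj S (Suc m))" using y by simp
    have "?g \<in> Fil n m" using y x x0 yc co_eq_iff[of "x \<otimes>\<^bsub>obj S m\<^esub> inv\<^bsub>obj S m\<^esub> x0" m "?d y" n] by simp
    moreover have "x = ?f (?g, y)" using x x0 yc by (simp add: assoc)
    ultimately show "x \<in> ?f ` (Fil n m \<times> ?Z)" using y(1) by (intro image_eqI[of _ _ "(?g, y)"]) simp_all
  qed
  have "?f ` (Fil n m \<times> ?Z) = {x \<in> carrier (obj S m). homotopy_class (quot S Fil n) m (co n m x) = w}"
    by (rule Set.set_eqI) (simp only: mem_Collect_eq mem)
  then show ?thesis using closed by simp
qed

text \<open>The representatives with all faces in the \<open>(n + t)\<close>-th filtration subgroup form a decreasing sequence of
  nonempty closed sets; a common element is a cycle of \<open>S\<close>.\<close>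

lemma homotopy_quot_lift:
  assumes w: "w \<in> carrier (homotopy_group (quot S Fil n) (Suc m))"
    and lift: "\<And>t. w \<in> imap_iter (filtration_couple S Fil) t n (Suc m) `
         carrier (homotopy_group (quot S Fil (n + t)) (Suc m))"
  obtains x where "x \<in> moore_cycles S (Suc m)" "w = homotopy_class (quot S Fil n) (Suc m) (co n (Suc m) x)"
proof -
  let ?Q = "{x \<in> carrier (obj S (Suc m)). homotopy_class (quot S Fil n) (Suc m) (co n (Suc m) x) = w}"
  define K where "K t = ?Q \<inter> (\<Inter>i\<in>{..Suc m}. {x \<in> carrier (obj S (Suc m)). face S (Suc m) i x \<in> Fil (n + t) m})" for t
  have "(\<Inter>t. K t) \<noteq> {}"
  proof (rule compact_space_imp_nest[OF compact_T[of "Suc m"]])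
    show "closedin (T (Suc m)) (K t)" for t
      unfolding K_def
      by (intro closedin_Int closedin_INT closedin_face_preimage Fil_closed closedin_homotopy_class_preimage[OF w]) auto
    show "K t \<noteq> {}" for t
    proof -
      obtain v where v: "v \<in> carrier (homotopy_group (quot S Fil (n + t)) (Suc m))"
        "w = imap_iter (filtration_couple S Fil) t n (Suc m) v" using lift by blast
      then obtain Y where Y: "Y \<in> moore_cycles (quot S Fil (n + t)) (Suc m)"
        "v = homotopy_class (quot S Fil (n + t)) (Suc m) Y" by (auto simp: ses.C.carrier_homotopy)
      obtain x where x: "x \<in> carrier (obj S (Suc m))" "Y = co (n + t) (Suc m) x"
        using ses.C.moore_cycles_carrier[OF Y(1)] by (auto simp: carrier_quot)
      have "x \<in> K t" using x Y v imap_iter_class[OF x(1)] moore_cycles_quot_iff[OF x(1)] by (simp add: K_def)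
      then show ?thesis by blast
    qed
    show "decseq K"
      unfolding decseq_def
    proof (intro allI impI)
      fix s t :: nat assume "s \<le> t"
      then have "Fil (n + t) m \<subseteq> Fil (n + s) m" by (intro Fil_anti) simp
      then show "K t \<subseteq> K s" unfolding K_def by blast
    qed
  qed
  then obtain x where x: "\<And>t. x \<in> K t" by blast
  have xc: "x \<in> carrier (obj S (Suc m))" "homotopy_class (quot S Fil n) (Suc m) (co n (Suc m) x) = w"
    using x[of 0] by (auto simp: K_def)
  have "face S (Suc m) i x = \<one>\<^bsub>obj S m\<^esub>" if i: "i \<le> Suc m" for i
  proof (rule Fil_Inter)
    fix t
    have "face S (Suc m) i x \<in> Fil (n + t) m" using x[of t] i by (simp add: K_def)
    then show "face S (Suc m) i x \<in> Fil t m" using Fil_anti[of t "n + t" m] by auto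
  qed
  then have "x \<in> moore_cycles S (Suc m)" using xc by (simp add: moore_cycles_Suc)
  then show ?thesis using that xc by blast
qed

text \<open>A class that lifts through the whole tower is represented by a true cycle of S. Such a
  cycle bounds in S, and the bounding chain also bounds it in each quotient. This is the separation
  hypothesis of the exact couple.\<close>

theorem converges_to_zero_of_acyclic:
  assumes acyclic: "moore_cycles S (Suc m) \<subseteq> moore_boundaries S (Suc m)"
  shows "trivial_group (E_infinity (filtration_couple S Fil) n (Suc m))"
    and "converges_to (filtration_couple S Fil) (Suc m) (homotopy_group S (Suc m)) (limit_map S Fil (Suc m))"
proof -
  have sep: "w = \<one>\<^bsub>Dgrp (filtration_couple S Fil) (Suc n) (Suc m)\<^esub>"
    if w: "w \<in> carrier (Dgrp (filtration_couple S Fil) (Suc n) (Suc m))"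
      and lift: "\<And>t. w \<in> imap_iter (filtration_couple S Fil) t (Suc n) (Suc m) `
         carrier (Dgrp (filtration_couple S Fil) (Suc n + t) (Suc m))" for n w
  proof -
    have D: "Dgrp (filtration_couple S Fil) k (Suc m) = homotopy_group (quot S Fil k) (Suc m)" for k
      by (simp add: filtration_couple_def)
    obtain x where x: "x \<in> moore_cycles S (Suc m)" "w = homotopy_class (quot S Fil (Suc n)) (Suc m) (co (Suc n) (Suc m) x)"
      using homotopy_quot_lift[of w "Suc n" m, OF w[unfolded D] lift[unfolded D]] by blast
    then obtain y where y: "y \<in> moore S (Suc (Suc m))" "x = face S (Suc (Suc m)) (Suc (Suc m)) y"
      using acyclic by (auto simp: moore_boundaries_def)
    have "\<forall>i\<le>Suc m. face S (Suc (Suc m)) i y \<in> Fil (Suc n) (Suc m)"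
      using y subgroup.one_closed[OF normal_imp_subgroup[OF Fil_normal]] by (simp add: moore_Suc)
    then have "co (Suc n) (Suc m) x \<in> moore_boundaries (quot S Fil (Suc n)) (Suc m)"
      using y moore_carrier[OF y(1)] by (auto simp: boundaries_quot)
    then have "w = moore_boundaries (quot S Fil (Suc n)) (Suc m)"
      using x ses.C.homotopy_class_one_iff[OF co_closed[OF moore_cycles_carrier[OF x(1)]]] by simp
    then show ?thesis by (simp add: D)
  qed
  show "trivial_group (E_infinity (filtration_couple S Fil) n (Suc m))"
    by (rule converges_to_zero(1)[OF acyclic sep])
  show "converges_to (filtration_couple S Fil) (Suc m) (homotopy_group S (Suc m)) (limit_map S Fil (Suc m))"
    by (rule converges_to_zero(2)[OF acyclic sep])
qed

end

section \<open>Pro-p groups\<close>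

locale pro_p =
  fixes p :: nat and H :: "'a monoid" (structure) and T :: "'a topology"
  assumes prime_p: "prime p" and pro_p: "pro_p_group p H T"
begin

lemma top_group: "topological_group_on H T" and compact_T: "compact_space T" and Hausdorff_T: "Hausdorff_space T"
  using pro_p by (simp_all add: pro_p_group_def)

lemma topspace_T: "topspace T = carrier H"
  using top_group by (simp add: topological_group_on_def)

sublocale group H
  using top_group by (simp add: topological_group_on_def)

abbreviation "ONS \<equiv> open_normal_subgroups H T"

lemma ONS_normal: "U \<in> ONS \<Longrightarrow> U \<lhd> H" and ONS_open: "U \<in> ONS \<Longrightarrow> openin T U"
  by (simp_all add: open_normal_subgroups_def)

lemma ONS_carrier: "carrier H \<in> ONS"
  using carrier_normal openin_topspace[of T] by (simp add: open_normal_subgroups_def topspace_T)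

lemma ONS_Int: "U \<in> ONS \<Longrightarrow> V \<in> ONS \<Longrightarrow> U \<inter> V \<in> ONS"
  by (simp add: open_normal_subgroups_def normal_subgroup_intersect openin_Int)

lemma ONS_index:
  assumes "U \<in> ONS"
  obtains k where "card (carrier (H Mod U)) = p ^ k"
  using assms pro_p by (auto simp: pro_p_group_def FactGroup_def)

text \<open>Finiteness is hidden in the cardinality condition: an infinite set has
  \<open>card\<close> 0, which is not a power of p.\<close>

lemma finite_quotient: "U \<in> ONS \<Longrightarrow> finite (carrier (H Mod U))"
  by (metis ONS_index card.infinite not_prime_0 power_not_zero prime_p)

lemma continuous_mult:
  "continuous_map Y T f \<Longrightarrow> continuous_map Y T g \<Longrightarrow> continuous_map Y T (\<lambda>y. f y \<otimes> g y)"
  using topological_group_on_mult[OF top_group] .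

lemma continuous_const: "c \<in> carrier H \<Longrightarrow> continuous_map Y T (\<lambda>y. c)"
  by (simp add: topspace_T)

lemma openin_coset:
  assumes U: "openin T U" "U \<lhd> H" and x: "x \<in> carrier H"
  shows "openin T (U #> x)"
proof -
  have "U #> x = {y \<in> carrier H. y \<otimes> inv x \<in> U}"
    using subgroup.rcos_module[OF normal_imp_subgroup[OF U(2)] group_axioms x]
      r_coset_subset_G[OF subgroup.subset[OF normal_imp_subgroup[OF U(2)]] x] by blast
  then show ?thesis
    using openin_continuous_map_preimage[OF continuous_mult[OF continuous_map_id[unfolded id_def] continuous_const[OF inv_closed[OF x]]] U(1)]
    by (simp add: topspace_T)
qed

lemma rcosets_disjoint_or_eq:
  assumes "U \<lhd> H" "x \<in> carrier H" "C \<in> carrier (H Mod U)" "x \<in> C"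
  shows "C = U #> x"
  using assms repr_independence[OF _ _ normal_imp_subgroup[OF assms(1)]] by (auto simp: carrier_FactGroup)

lemma closedin_coset:
  assumes U: "openin T U" "U \<lhd> H" and x: "x \<in> carrier H"
  shows "closedin T (U #> x)"
proof -
  note sU = normal_imp_subgroup[OF U(2)]
  have "carrier H - (U #> x) = \<Union>{U #> y | y. y \<in> carrier H \<and> y \<notin> U #> x}"
  proof (intro equalityI subsetI)
    fix y assume "y \<in> carrier H - (U #> x)"
    then show "y \<in> \<Union>{U #> y | y. y \<in> carrier H \<and> y \<notin> U #> x}" using rcos_self[OF _ sU, of y] by blast
  next
    fix z assume "z \<in> \<Union>{U #> y | y. y \<in> carrier H \<and> y \<notin> U #> x}"
    then obtain y where y: "y \<in> carrier H" "y \<notin> U #> x" "z \<in> U #> y" by blast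
    then have "z \<in> carrier H" using r_coset_subset_G[OF subgroup.subset[OF sU]] by blast
    moreover have "z \<notin> U #> x"
      using repr_independence[OF y(3) y(1) sU] repr_independence[OF _ x sU, of z] rcos_self[OF y(1) sU] y(2) by auto
    ultimately show "z \<in> carrier H - (U #> x)" by blast
  qed
  moreover have "openin T (\<Union>{U #> y | y. y \<in> carrier H \<and> y \<notin> U #> x})"
    using openin_coset[OF U] by (intro openin_Union) blast
  ultimately show ?thesis
    using r_coset_subset_G[OF subgroup.subset[OF sU] x] by (simp add: closedin_def topspace_T)
qed

text \<open>Total disconnectedness is formulated with components. In a compact Hausdorff space these
  agree with the quasi-components, and distinct quasi-components are separated by clopen
  sets.\<close>

lemma clopen_separation:
  assumes "x \<in> carrier H" "y \<in> carrier H" "x \<noteq> y"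
  obtains W where "openin T W" "closedin T W" "x \<in> W" "y \<notin> W"
proof -
  let ?C = "quasi_component_of_set T x"
  have "?C \<in> quasi_components_of T" using assms by (simp add: quasi_components_of_def topspace_T)
  moreover have "compactin T ?C"
    using closedin_quasi_component_of[of T x] compact_T by (simp add: closedin_compact_space)
  ultimately have "?C \<in> connected_components_of T"
    using compact_quasi_eq_connected_components_of[of T ?C] compact_T Hausdorff_T
    by (simp add: compact_imp_locally_compact_space)
  then obtain z where "z \<in> carrier H" "?C = connected_component_of_set T z"
    by (auto simp: connected_components_of_def topspace_T)
  then have "?C = {z}" using pro_p by (simp add: pro_p_group_def)
  moreover have "x \<in> ?C" using assms by (simp add: topspace_T)
  ultimately have "\<not> quasi_component_of T x y" using assms by auto
  then show ?thesis using that assms by (auto simp: quasi_component_of topspace_T)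
qed

text \<open>The subgroup is \<open>{x. \<forall>a b. a x b \<in> W \<longleftrightarrow> a b \<in> W}\<close>; it is open because its complement is the projection of a
  closed subset of a compact space.\<close>

lemma clopen_saturated:
  assumes W: "openin T W" "closedin T W"
  obtains U where "U \<in> ONS" "\<And>u x. u \<in> U \<Longrightarrow> x \<in> carrier H \<Longrightarrow> u \<otimes> x \<in> W \<longleftrightarrow> x \<in> W"
proof -
  define N where "N = {x \<in> carrier H. \<forall>a\<in>carrier H. \<forall>b\<in>carrier H. a \<otimes> x \<otimes> b \<in> W \<longleftrightarrow> a \<otimes> b \<in> W}"
  let ?P = "prod_topology (prod_topology T T) T"
  let ?f = "\<lambda>z. fst (fst z) \<otimes> snd z \<otimes> snd (fst z)" and ?g = "\<lambda>z. fst (fst z) \<otimes> snd (fst z)"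
  have c1: "continuous_map ?P T (\<lambda>z. fst (fst z))" and c2: "continuous_map ?P T (\<lambda>z. snd (fst z))"
    and c3: "continuous_map ?P T snd"
    using continuous_map_compose[OF continuous_map_fst continuous_map_fst]
      continuous_map_compose[OF continuous_map_fst continuous_map_snd] continuous_map_snd
    by (force simp: comp_def)+
  have f: "continuous_map ?P T ?f" and g: "continuous_map ?P T ?g"
    by (intro continuous_mult c1 c2 c3)+
  have W': "closedin T (carrier H - W)" using W openin_subset[OF W(1)] by (simp add: closedin_def topspace_T double_diff)
  \<comment> \<open>E collects the triples violating the defining condition of N. It is closed
    because both W and its complement are, and N is the complement of its projection.\<close>
  define E where "E = ({z \<in> topspace ?P. ?f z \<in> W} \<inter> {z \<in> topspace ?P. ?g z \<in> carrier H - W}) \<union>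
    ({z \<in> topspace ?P. ?g z \<in> W} \<inter> {z \<in> topspace ?P. ?f z \<in> carrier H - W})"
  have "closedin ?P E"
    unfolding E_def
    by (intro closedin_Un closedin_Int closedin_continuous_map_preimage[OF f] closedin_continuous_map_preimage[OF g] W W')
  moreover have "closed_map ?P T snd"
    by (intro closed_map_snd) (simp add: compact_space_prod_topology compact_T)
  ultimately have cl: "closedin T (snd ` E)" by (simp add: closed_map_def)
  have "N = carrier H - snd ` E"
  proof (intro equalityI subsetI)
    fix x assume "x \<in> N"
    then show "x \<in> carrier H - snd ` E" by (auto simp: N_def E_def topspace_T)
  next
    fix x assume x: "x \<in> carrier H - snd ` E"
    have "a \<otimes> x \<otimes> b \<in> W \<longleftrightarrow> a \<otimes> b \<in> W" if "a \<in> carrier H" "b \<in> carrier H" for a b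
    proof (rule ccontr)
      assume "\<not> ?thesis"
      then have "((a, b), x) \<in> E" using that x by (auto simp: E_def topspace_T)
      then show False using x by force
    qed
    then show "x \<in> N" using x by (simp add: N_def)
  qed
  then have open_N: "openin T N" using cl by (simp add: closedin_def topspace_T)
  have "subgroup N H"
  proof (rule subgroupI)
    show "N \<subseteq> carrier H" "N \<noteq> {}" by (auto simp: N_def)
    show "inv x \<in> N" if x: "x \<in> N" for x
    proof -
      have "a \<otimes> inv x \<otimes> b \<in> W \<longleftrightarrow> a \<otimes> b \<in> W" if "a \<in> carrier H" "b \<in> carrier H" for a b
      proof -
        have "a \<otimes> inv x \<otimes> x \<otimes> b \<in> W \<longleftrightarrow> a \<otimes> inv x \<otimes> b \<in> W" using x that by (simp add: N_def)
        moreover have "a \<otimes> inv x \<otimes> x = a" using x that by (simp add: N_def m_assoc)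
        ultimately show ?thesis by simp
      qed
      then show ?thesis using x by (simp add: N_def)
    qed
    show "x \<otimes> y \<in> N" if "x \<in> N" "y \<in> N" for x y
    proof -
      have "a \<otimes> (x \<otimes> y) \<otimes> b \<in> W \<longleftrightarrow> a \<otimes> b \<in> W" if ab: "a \<in> carrier H" "b \<in> carrier H" for a b
      proof -
        have "a \<otimes> x \<otimes> y \<otimes> b \<in> W \<longleftrightarrow> a \<otimes> x \<otimes> b \<in> W" using \<open>x \<in> N\<close> \<open>y \<in> N\<close> ab by (simp add: N_def)
        moreover have "a \<otimes> x \<otimes> b \<in> W \<longleftrightarrow> a \<otimes> b \<in> W" using \<open>x \<in> N\<close> ab by (simp add: N_def)
        moreover have "a \<otimes> (x \<otimes> y) = a \<otimes> x \<otimes> y" using \<open>x \<in> N\<close> \<open>y \<in> N\<close> ab by (simp add: N_def m_assoc)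
        ultimately show ?thesis by simp
      qed
      then show ?thesis using that by (simp add: N_def)
    qed
  qed
  \<comment> \<open>The conjugating elements are absorbed into a and b; this is why translations on
    both sides appear in the definition of N.\<close>
  moreover have "g \<otimes> x \<otimes> inv g \<in> N" if g: "g \<in> carrier H" and x: "x \<in> N" for g x
  proof -
    have "a \<otimes> (g \<otimes> x \<otimes> inv g) \<otimes> b \<in> W \<longleftrightarrow> a \<otimes> b \<in> W" if ab: "a \<in> carrier H" "b \<in> carrier H" for a b
    proof -
      have xc: "x \<in> carrier H" using x by (simp add: N_def)
      have "(a \<otimes> g) \<otimes> x \<otimes> (inv g \<otimes> b) \<in> W \<longleftrightarrow> (a \<otimes> g) \<otimes> (inv g \<otimes> b) \<in> W"
        using x g ab unfolding N_def by blast
      moreover have "(a \<otimes> g) \<otimes> x \<otimes> (inv g \<otimes> b) = a \<otimes> (g \<otimes> x \<otimes> inv g) \<otimes> b"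
        using xc g ab by (simp add: m_assoc)
      moreover have "(a \<otimes> g) \<otimes> (inv g \<otimes> b) = a \<otimes> b"
        using g ab by (metis inv_closed m_assoc m_closed r_inv r_one)
      ultimately show ?thesis by simp
    qed
    then show ?thesis using g x by (simp add: N_def)
  qed
  ultimately have "N \<lhd> H" using normal_inv_iff by blast
  then have "N \<in> ONS" using open_N by (simp add: open_normal_subgroups_def)
  moreover have "u \<otimes> x \<in> W \<longleftrightarrow> x \<in> W" if "u \<in> N" "x \<in> carrier H" for u x
  proof -
    have "\<one> \<otimes> u \<otimes> x \<in> W \<longleftrightarrow> \<one> \<otimes> x \<in> W" using that unfolding N_def by blast
    then show ?thesis using that by (simp add: N_def)
  qed
  ultimately show ?thesis by (rule that)
qed

lemma ONS_separation:
  assumes "x \<in> carrier H" "x \<noteq> \<one>"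
  obtains U where "U \<in> ONS" "x \<notin> U"
proof -
  obtain W where W: "openin T W" "closedin T W" "\<one> \<in> W" "x \<notin> W"
    using clopen_separation[of \<one> x] assms by auto
  obtain U where U: "U \<in> ONS" "\<And>u x. u \<in> U \<Longrightarrow> x \<in> carrier H \<Longrightarrow> u \<otimes> x \<in> W \<longleftrightarrow> x \<in> W"
    using clopen_saturated[OF W(1,2)] by blast
  have "x \<notin> U" using U(2)[of x \<one>] W assms by auto
  then show ?thesis using that U(1) by blast
qed

end

subsection \<open>Continuous sections\<close>

context pro_p
begin

text \<open>The last condition says that the fibres of \<open>f\<close> over \<open>R\<close> are cosets of one and the same subgroup.
  A minimal such \<open>R\<close> is the image of a section: if that subgroup were nontrivial, some open normal
  subgroup \<open>U\<close> would not contain it, and choosing one \<open>U\<close>-coset in each fibre would make \<open>R\<close> smaller.\<close>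

definition transversal :: "('a \<Rightarrow> 'b) \<Rightarrow> 'a set \<Rightarrow> bool" where
  "transversal f R \<longleftrightarrow> closedin T R \<and> f ` R = f ` carrier H \<and>
     (\<forall>x\<in>R. \<forall>y\<in>R. \<forall>z\<in>R. f x = f y \<longrightarrow> z \<otimes> inv x \<otimes> y \<in> R)"

text \<open>Zorn's lemma is applied to complements, so chains are joined by unions of open sets. If
  such a union covered a whole fibre, then by compactness of the fibre a finite subchain would,
  hence a single member would, contradicting that its complement meets every fibre.\<close>

lemma transversal_Inter:
  assumes f: "continuous_map T TB f" "Hausdorff_space TB"
    and ch: "subset.chain {Q. Q \<subseteq> carrier H \<and> transversal f (carrier H - Q)} \<C>"
  shows "transversal f (carrier H - \<Union>\<C>)"
proof (cases "\<C> = {}")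
  case True
  have "closedin T (carrier H)" using closedin_topspace[of T] by (simp add: topspace_T)
  then show ?thesis using True by (simp add: transversal_def)
next
  case False
  have C: "Q \<subseteq> carrier H" "transversal f (carrier H - Q)" if "Q \<in> \<C>" for Q
    using ch that by (auto simp: subset.chain_def)
  have op: "openin T Q" if "Q \<in> \<C>" for Q
    using C[OF that] by (simp add: transversal_def closedin_def topspace_T double_diff)
  have "closedin T (carrier H - \<Union>\<C>)"
    using openin_Union[of \<C> T] op C(1) by (auto simp: closedin_def topspace_T double_diff Sup_le_iff)
  moreover have "f ` (carrier H - \<Union>\<C>) = f ` carrier H"
  proof
    show "f ` carrier H \<subseteq> f ` (carrier H - \<Union>\<C>)"
    proof
      fix b assume b: "b \<in> f ` carrier H"
      then have bt: "b \<in> topspace TB" using continuous_map_image_subset_topspace[OF f(1)] by (auto simp: topspace_T)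
      let ?F = "{x \<in> topspace T. f x \<in> {b}}"
      have "closedin T ?F"
        by (intro closedin_continuous_map_preimage[OF f(1)] closedin_Hausdorff_singleton f(2) bt)
      then have "compactin T ?F" by (rule closedin_compact_space[OF compact_T])
      show "b \<in> f ` (carrier H - \<Union>\<C>)"
      proof (rule ccontr)
        assume "b \<notin> f ` (carrier H - \<Union>\<C>)"
        then have "?F \<subseteq> \<Union>\<C>" by (auto simp: topspace_T)
        then obtain \<F> where \<F>: "finite \<F>" "\<F> \<subseteq> \<C>" "?F \<subseteq> \<Union>\<F>"
          using compactinD[OF \<open>compactin T ?F\<close>, of \<C>] op by blast
        obtain Q where Q: "Q \<in> \<C>" "?F \<subseteq> Q"
        proof (cases "\<F> = {}")
          case True
          then show ?thesis using that \<F> False by fastforce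
        next
          case False
          have "subset.chain {Q. Q \<subseteq> carrier H \<and> transversal f (carrier H - Q)} \<F>"
            using ch \<F>(2) unfolding subset.chain_def by blast
          then have "\<Union>\<F> \<in> \<F>" using Union_in_chain[OF \<F>(1) False] by blast
          then show ?thesis using that \<F> by blast
        qed
        have "b \<in> f ` (carrier H - Q)" using C(2)[OF Q(1)] b by (simp add: transversal_def)
        then show False using Q(2) by (auto simp: topspace_T)
      qed
    qed
  qed auto
  moreover have "z \<otimes> inv x \<otimes> y \<in> carrier H - \<Union>\<C>"
    if "x \<in> carrier H - \<Union>\<C>" "y \<in> carrier H - \<Union>\<C>" "z \<in> carrier H - \<Union>\<C>" "f x = f y" for x y z
  proof -
    have "z \<otimes> inv x \<otimes> y \<in> carrier H - Q" if Q: "Q \<in> \<C>" for Q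
    proof -
      have "x \<in> carrier H - Q" "y \<in> carrier H - Q" "z \<in> carrier H - Q"
        using \<open>x \<in> carrier H - \<Union>\<C>\<close> \<open>y \<in> carrier H - \<Union>\<C>\<close> \<open>z \<in> carrier H - \<Union>\<C>\<close> Q by blast+
      then show ?thesis using C(2)[OF Q] \<open>f x = f y\<close> unfolding transversal_def by blast
    qed
    then show ?thesis using that by auto
  qed
  ultimately show ?thesis unfolding transversal_def by blast
qed

text \<open>The coset condition makes the quotients \<open>x^-1 y\<close> of points of R in a common
  fibre into a subgroup L, and each fibre of R is a left coset of L. In the finite group
  \<open>H Mod U\<close> one element is chosen from every left coset of the image of L, and
  \<open>R'\<close> keeps the points of R lying over the chosen elements. Finitely many U-cosets are
  involved, so \<open>R'\<close> is closed.\<close>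

lemma transversal_refine:
  assumes R: "transversal f R" and U: "U \<in> ONS"
    and f: "\<And>x y z. x \<in> carrier H \<Longrightarrow> y \<in> carrier H \<Longrightarrow> z \<in> carrier H \<Longrightarrow> f x = f y \<Longrightarrow> f (z \<otimes> inv x \<otimes> y) = f z"
    and ne: "R \<noteq> {}"
  obtains R' where "transversal f R'" "R' \<subseteq> R"
    "\<And>x y. x \<in> R' \<Longrightarrow> y \<in> R' \<Longrightarrow> f x = f y \<Longrightarrow> U #> x = U #> y"
proof -
  interpret U: normal U H using U by (rule ONS_normal)
  interpret K: group "H Mod U" by (rule U.factorgroup_is_group)
  have Rc: "R \<subseteq> carrier H" using R closedin_subset[of T R] by (simp add: transversal_def topspace_T)
  have heap: "z \<otimes> inv x \<otimes> y \<in> R" if "x \<in> R" "y \<in> R" "z \<in> R" "f x = f y" for x y z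
    using R that by (simp add: transversal_def)
  define L where "L = {inv x \<otimes> y | x y. x \<in> R \<and> y \<in> R \<and> f x = f y}"
  have Lmem: "l \<in> L \<longleftrightarrow> (\<exists>x\<in>R. \<exists>y\<in>R. f x = f y \<and> l = inv x \<otimes> y)" for l by (auto simp: L_def)
  have L: "subgroup L H"
  proof (rule subgroupI)
    show "L \<subseteq> carrier H" using Rc by (auto simp: L_def)
    show "L \<noteq> {}" using ne by (auto simp: L_def)
    show "inv l \<in> L" if l: "l \<in> L" for l
    proof -
      obtain x y where "x \<in> R" "y \<in> R" "f x = f y" "l = inv x \<otimes> y" using l Lmem by blast
      moreover from this have "inv l = inv y \<otimes> x" using Rc by (simp add: inv_mult_group subset_iff)
      ultimately show ?thesis unfolding Lmem by metis
    qed
    show "l \<otimes> l' \<in> L" if l: "l \<in> L" "l' \<in> L" for l l'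
    proof -
      obtain x y where xy: "x \<in> R" "y \<in> R" "f x = f y" "l = inv x \<otimes> y" using l Lmem by blast
      obtain u v where uv: "u \<in> R" "v \<in> R" "f u = f v" "l' = inv u \<otimes> v" using l Lmem by blast
      have c: "x \<in> carrier H" "y \<in> carrier H" "u \<in> carrier H" "v \<in> carrier H" using xy uv Rc by auto
      have "l \<otimes> l' = inv x \<otimes> (y \<otimes> inv u \<otimes> v)" using c xy uv by (simp add: m_assoc)
      moreover have "y \<otimes> inv u \<otimes> v \<in> R" using heap xy uv by blast
      moreover have "f (y \<otimes> inv u \<otimes> v) = f x" using f[of u v y] c xy uv by simp
      ultimately show ?thesis unfolding Lmem using xy by metis
    qed
  qed
  have RL: "x \<otimes> l \<in> R \<and> f (x \<otimes> l) = f x" if "x \<in> R" "l \<in> L" for x l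
  proof -
    obtain u v where uv: "u \<in> R" "v \<in> R" "f u = f v" "l = inv u \<otimes> v"
      using \<open>l \<in> L\<close> unfolding L_def by blast
    have c: "x \<in> carrier H" "u \<in> carrier H" "v \<in> carrier H" using uv that Rc by auto
    have eq: "x \<otimes> l = x \<otimes> inv u \<otimes> v" unfolding uv(4) using c by (simp add: m_assoc)
    show ?thesis unfolding eq using heap[OF uv(1,2) that(1) uv(3)] f[OF c(2,3,1) uv(3)] ..
  qed
  let ?q = "\<lambda>x. U #> x"
  interpret q: group_hom H "H Mod U" ?q
    using U.r_coset_hom_Mod by unfold_locales
  define L' where "L' = ?q ` L"
  have L': "subgroup L' (H Mod U)" unfolding L'_def by (rule q.subgroup_img_is_subgroup[OF L])
  \<comment> \<open>The choice depends only on the coset of \<open>L'\<close>, not on the element C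
    naming it. Hence exactly one element is selected in each coset, which gives both surjectivity
    and uniqueness below.\<close>
  define P where "P C \<longleftrightarrow> C = (SOME D. D \<in> C <#\<^bsub>H Mod U\<^esub> L')" for C
  have cos: "?q x <#\<^bsub>H Mod U\<^esub> L' = ?q (x \<otimes> l) <#\<^bsub>H Mod U\<^esub> L'" if "x \<in> carrier H" "l \<in> L" for x l
  proof (rule K.l_repr_independence[OF _ _ L'])
    show "?q x \<in> carrier (H Mod U)" using that by simp
    have lc: "l \<in> carrier H" using that subgroup.mem_carrier[OF L] by blast
    show "?q (x \<otimes> l) \<in> ?q x <#\<^bsub>H Mod U\<^esub> L'"
      using that q.hom_mult[OF that(1) lc] unfolding l_coset_def L'_def by blast
  qed
  define R' where "R' = R \<inter> \<Union>{C \<in> carrier (H Mod U). P C}"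
  have R'mem: "x \<in> R' \<longleftrightarrow> x \<in> R \<and> P (?q x)" for x
  proof
    assume "x \<in> R'"
    then obtain C where C: "x \<in> R" "C \<in> carrier (H Mod U)" "P C" "x \<in> C" unfolding R'_def by blast
    then have "C = ?q x" using rcosets_disjoint_or_eq[OF ONS_normal[OF U], of x C] Rc by blast
    then show "x \<in> R \<and> P (?q x)" using C by simp
  next
    assume x: "x \<in> R \<and> P (?q x)"
    then have "x \<in> carrier H" using Rc by blast
    then have "?q x \<in> carrier (H Mod U)" "x \<in> ?q x" using rcos_self[OF _ U.subgroup_axioms] by simp_all
    then show "x \<in> R'" using x unfolding R'_def by blast
  qed
  have sep: "?q x = ?q y" if "x \<in> R'" "y \<in> R'" "f x = f y" for x y
  proof -
    have xy: "x \<in> R" "y \<in> R" "P (?q x)" "P (?q y)" using that R'mem by auto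
    then have c: "x \<in> carrier H" "y \<in> carrier H" using Rc by auto
    have "inv x \<otimes> y \<in> L" using xy that Lmem by blast
    moreover have "x \<otimes> (inv x \<otimes> y) = y" using c by (simp flip: m_assoc)
    ultimately have "?q x <#\<^bsub>H Mod U\<^esub> L' = ?q y <#\<^bsub>H Mod U\<^esub> L'" using cos[OF c(1)] by metis
    then show ?thesis using xy by (simp add: P_def)
  qed
  have "transversal f R'"
    unfolding transversal_def
  proof (intro conjI ballI impI)
    have "closedin T (\<Union>{C \<in> carrier (H Mod U). P C})"
    proof (rule closedin_Union)
      show "finite {C \<in> carrier (H Mod U). P C}" using finite_quotient[OF U] by simp
      fix C assume "C \<in> {C \<in> carrier (H Mod U). P C}"
      then show "closedin T C"
        using closedin_coset[OF ONS_open[OF U] ONS_normal[OF U]] by (auto simp: carrier_FactGroup)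
    qed
    then show "closedin T R'" unfolding R'_def using R by (simp add: transversal_def closedin_Int)
    show "f ` R' = f ` carrier H"
    proof
      show "f ` R' \<subseteq> f ` carrier H" using Rc by (auto simp: R'_def)
      show "f ` carrier H \<subseteq> f ` R'"
      proof
        fix b assume "b \<in> f ` carrier H"
        then obtain x where x: "x \<in> R" "b = f x" using R unfolding transversal_def by (metis imageE)
        have xc: "x \<in> carrier H" using x Rc by blast
        have "?q x \<in> ?q x <#\<^bsub>H Mod U\<^esub> L'"
        proof -
          have "?q x \<otimes>\<^bsub>H Mod U\<^esub> \<one>\<^bsub>H Mod U\<^esub> \<in> ?q x <#\<^bsub>H Mod U\<^esub> L'"
            unfolding l_coset_def using subgroup.one_closed[OF L'] by blast
          then show ?thesis by (simp only: K.r_one q.hom_closed[OF xc])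
        qed
        then have "(SOME D. D \<in> ?q x <#\<^bsub>H Mod U\<^esub> L') \<in> ?q x <#\<^bsub>H Mod U\<^esub> L'" by (rule someI)
        then obtain l where l: "l \<in> L" "(SOME D. D \<in> ?q x <#\<^bsub>H Mod U\<^esub> L') = ?q x \<otimes>\<^bsub>H Mod U\<^esub> ?q l"
          unfolding l_coset_def L'_def by blast
        have lc: "l \<in> carrier H" using l subgroup.mem_carrier[OF L] by blast
        have "P (?q (x \<otimes> l))"
          unfolding P_def cos[OF xc l(1), symmetric] l(2) using q.hom_mult[OF xc lc] .
        then have "x \<otimes> l \<in> R'" "f (x \<otimes> l) = b" using RL[OF x(1) l(1)] x by (simp_all add: R'mem)
        then show "b \<in> f ` R'" by blast
      qed
    qed
    fix x y z assume xyz: "x \<in> R'" "y \<in> R'" "z \<in> R'" "f x = f y"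
    then have r: "x \<in> R" "y \<in> R" "z \<in> R" by (simp_all add: R'mem)
    then have c: "x \<in> carrier H" "y \<in> carrier H" "z \<in> carrier H" using Rc by auto
    have "?q (z \<otimes> inv x \<otimes> y) = ?q z \<otimes>\<^bsub>H Mod U\<^esub> inv\<^bsub>H Mod U\<^esub> ?q x \<otimes>\<^bsub>H Mod U\<^esub> ?q y"
      using c q.hom_mult q.hom_inv by (simp only: m_closed inv_closed)
    also have "\<dots> = ?q z"
    proof -
      have "?q x = ?q y" using sep xyz by blast
      moreover have "?q y \<in> carrier (H Mod U)" "?q z \<in> carrier (H Mod U)" using c by (auto intro: q.hom_closed)
      ultimately show ?thesis by (simp only: K.m_assoc K.inv_closed K.l_inv K.r_one)
    qed
    finally have "?q (z \<otimes> inv x \<otimes> y) = ?q z" .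
    then show "z \<otimes> inv x \<otimes> y \<in> R'" using heap[OF r(1,2,3) xyz(4)] xyz(3) by (simp add: R'mem)
  qed
  moreover have "R' \<subseteq> R" by (auto simp: R'_def)
  ultimately show ?thesis using that sep by blast
qed

text \<open>On a minimal transversal f is injective, hence a continuous bijection from a compact
  space onto a Hausdorff space, and its inverse is the section. The condition on fibres replaces a
  group structure on the target: it covers tuples of faces, whose target is only a subspace of a
  product, as well as the projection of \<open>X_0\<close> onto G.\<close>

theorem continuous_section:
  assumes f: "continuous_map T TB f" "Hausdorff_space TB" "f ` carrier H = topspace TB"
    and heap: "\<And>x y z. x \<in> carrier H \<Longrightarrow> y \<in> carrier H \<Longrightarrow> z \<in> carrier H \<Longrightarrow> f x = f y \<Longrightarrow> f (z \<otimes> inv x \<otimes> y) = f z"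
  obtains s where "continuous_map TB T s" "\<And>b. b \<in> topspace TB \<Longrightarrow> f (s b) = b"
proof -
  let ?A = "{Q. Q \<subseteq> carrier H \<and> transversal f (carrier H - Q)}"
  have "\<exists>Q\<in>?A. \<forall>Q'\<in>?A. Q \<subseteq> Q' \<longrightarrow> Q' = Q"
  proof (rule subset_Zorn')
    fix \<C> assume ch: "subset.chain ?A \<C>"
    then have "\<Union>\<C> \<subseteq> carrier H" by (auto simp: subset.chain_def)
    then show "\<Union>\<C> \<in> ?A" using transversal_Inter[OF f(1,2) ch] by blast
  qed
  then obtain Q where "Q \<in> ?A" and mx: "\<forall>Q'\<in>?A. Q \<subseteq> Q' \<longrightarrow> Q' = Q" by (rule bexE)
  then have Q: "Q \<subseteq> carrier H" "transversal f (carrier H - Q)" by simp_all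
  have max: "Q' = Q" if "Q' \<subseteq> carrier H" "transversal f (carrier H - Q')" "Q \<subseteq> Q'" for Q'
    using mx that by simp
  define R where "R = carrier H - Q"
  have R: "transversal f R" "R \<subseteq> carrier H" using Q by (auto simp: R_def)
  have inj: "inj_on f R"
  proof (rule inj_onI, rule ccontr)
    fix x y assume xy: "x \<in> R" "y \<in> R" "f x = f y" "x \<noteq> y"
    then have c: "x \<in> carrier H" "y \<in> carrier H" using R by auto
    have "x \<otimes> inv y \<noteq> \<one>" using c xy(4) by (metis inv_closed inv_equality inv_inv)
    then obtain U where U: "U \<in> ONS" "x \<otimes> inv y \<notin> U" using ONS_separation[of "x \<otimes> inv y"] c by auto
    obtain R' where R': "transversal f R'" "R' \<subseteq> R" "\<And>x y. x \<in> R' \<Longrightarrow> y \<in> R' \<Longrightarrow> f x = f y \<Longrightarrow> U #> x = U #> y"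
      using transversal_refine[OF R(1) U(1) heap] xy(1) by blast
    have dd: "carrier H - (carrier H - R') = R'" using R R' by blast
    have "carrier H - R' = Q"
    proof (rule max)
      show "Q \<subseteq> carrier H - R'" using R'(2) Q(1) unfolding R_def by blast
    qed (simp_all add: dd R'(1))
    then have "R' = R" using dd R_def by blast
    then have "U #> x = U #> y" using R'(3) xy by blast
    then show False using normal.rcos_eq_iff[OF ONS_normal[OF U(1)] c] U(2) by blast
  qed
  have clR: "closedin T R" and im: "f ` R = topspace TB" using R f(3) by (simp_all add: transversal_def)
  have "homeomorphic_map (subtopology T R) TB f"
  proof (rule continuous_imp_homeomorphic_map)
    show "continuous_map (subtopology T R) TB f" using f(1) by (rule continuous_map_from_subtopology)
    show "compact_space (subtopology T R)"
      using closedin_compact_space[OF compact_T clR] by (simp add: compact_space_subtopology)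
    show "f ` topspace (subtopology T R) = topspace TB" "inj_on f (topspace (subtopology T R))"
      using im inj R(2) by (simp_all add: topspace_T Int_absorb1)
  qed (rule f(2))
  then obtain g where g: "homeomorphic_maps (subtopology T R) TB f g"
    by (auto simp: homeomorphic_map_maps)
  then have "continuous_map TB T g" "\<And>b. b \<in> topspace TB \<Longrightarrow> f (g b) = b"
    by (auto simp: homeomorphic_maps_def continuous_map_in_subtopology)
  then show ?thesis by (rule that)
qed

end

section \<open>Group algebras of finite p-groups\<close>

text \<open>Orbit sizes divide a power of p. If x0 were the only fixed point, every other orbit
  would have size divisible by p, and the number of points would be 1 modulo p.\<close>

lemma (in group_action) p_group_fixed_point:
  assumes p: "prime p" and ord: "order G = p ^ k" and fin: "finite E" and dvd: "p dvd card E"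
    and x0: "x0 \<in> E" "\<And>g. g \<in> carrier G \<Longrightarrow> \<phi> g x0 = x0"
  obtains x where "x \<in> E" "x \<noteq> x0" "\<And>g. g \<in> carrier G \<Longrightarrow> \<phi> g x = x"
proof (rule ccontr)
  assume "\<not> thesis"
  then have no: "\<exists>g\<in>carrier G. \<phi> g x \<noteq> x" if "x \<in> E" "x \<noteq> x0" for x
    using that \<open>\<And>x. \<lbrakk>x \<in> E; x \<noteq> x0; \<And>g. g \<in> carrier G \<Longrightarrow> \<phi> g x = x\<rbrakk> \<Longrightarrow> thesis\<close> by blast
  interpret G: group G using group_hom group_hom.axioms(1) by auto
  have orb0: "orbit G \<phi> x0 = {x0}"
    using x0 G.one_closed unfolding orbit_def by (auto, metis)
  have fo: "finite (orbits G E \<phi>)"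
    using fin by (auto simp: orbits_def)
  have big: "p dvd card Q" if Q: "Q \<in> orbits G E \<phi> - {{x0}}" for Q
  proof -
    obtain x where x: "x \<in> E" "Q = orbit G \<phi> x" using Q by (auto simp: orbits_def)
    have "x \<noteq> x0" using Q x orb0 by auto
    then obtain g where g: "g \<in> carrier G" "\<phi> g x \<noteq> x" using no x by blast
    have "{x, \<phi> g x} \<subseteq> Q" using g x orbit_refl[OF x(1)] by (auto simp: orbit_def)
    moreover have "finite Q" using fin orbits_coverture Q by (metis DiffD1 Sup_upper finite_subset)
    ultimately have "card {x, \<phi> g x} \<le> card Q" by (intro card_mono)
    then have "card Q \<noteq> 1" using g by auto
    moreover have "card Q dvd p ^ k"
      using orbit_stabilizer_theorem[OF x(1)] ord x(2) by (metis dvd_triv_left)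
    ultimately show ?thesis using p by (metis divides_primepow_nat dvd_power gr0I power_0)
  qed
  have "card E = (\<Sum>Q\<in>orbits G E \<phi>. card Q)"
    using disjoint_sum[OF fin, of "\<lambda>_. 1::nat"] by simp
  also have "\<dots> = card {x0} + (\<Sum>Q\<in>orbits G E \<phi> - {{x0}}. card Q)"
    using x0(1) orb0 by (intro sum.remove fo) (auto simp: orbits_def)
  finally have "card E = 1 + (\<Sum>Q\<in>orbits G E \<phi> - {{x0}}. card Q)" by simp
  moreover have "p dvd (\<Sum>Q\<in>orbits G E \<phi> - {{x0}}. card Q)"
    using big by (rule dvd_sum)
  ultimately have "p dvd 1" using dvd by (metis dvd_add_left_iff)
  then show False using p by simp
qed

text \<open>The action passes to V/A, whose order is a nontrivial power of p and where the trivial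
  coset is fixed. A second fixed coset provides v. The group V is written multiplicatively so that
  the additive monoid of a group ring can be substituted for it.\<close>

lemma p_group_fixed_point_quotient:
  assumes p: "prime p" and K: "group K" "order K = p ^ k"
    and V: "comm_group V" "card (carrier V) = p ^ a"
    and A: "subgroup A V" "A \<noteq> carrier V"
    and T: "\<And>g. g \<in> carrier K \<Longrightarrow> T g \<in> hom V V"
    and T1: "\<And>v. v \<in> carrier V \<Longrightarrow> T \<one>\<^bsub>K\<^esub> v = v"
    and TT: "\<And>g h v. g \<in> carrier K \<Longrightarrow> h \<in> carrier K \<Longrightarrow> v \<in> carrier V \<Longrightarrow> T (g \<otimes>\<^bsub>K\<^esub> h) v = T g (T h v)"
    and TA: "\<And>g v. g \<in> carrier K \<Longrightarrow> v \<in> A \<Longrightarrow> T g v \<in> A"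
  obtains v where "v \<in> carrier V" "v \<notin> A" "\<And>g. g \<in> carrier K \<Longrightarrow> T g v \<otimes>\<^bsub>V\<^esub> inv\<^bsub>V\<^esub> v \<in> A"
proof -
  interpret K: group K by fact
  interpret V: comm_group V by fact
  interpret A: normal A V by (rule V.subgroup_imp_normal[OF A(1)])
  have Tc: "T g v \<in> carrier V" if "g \<in> carrier K" "v \<in> carrier V" for g v
    using T that by (auto simp: hom_def)
  have Tm: "T g (v \<otimes>\<^bsub>V\<^esub> w) = T g v \<otimes>\<^bsub>V\<^esub> T g w" if "g \<in> carrier K" "v \<in> carrier V" "w \<in> carrier V" for g v w
    using T that by (auto simp: hom_def)
  have Tinv: "T g (T (inv\<^bsub>K\<^esub> g) v) = v" if "g \<in> carrier K" "v \<in> carrier V" for g v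
    using TT[of g "inv\<^bsub>K\<^esub> g" v] T1 that by simp
  define E where "E = carrier (V Mod A)"
  have coset: "T g ` (A #>\<^bsub>V\<^esub> v) = A #>\<^bsub>V\<^esub> T g v" if g: "g \<in> carrier K" and v: "v \<in> carrier V" for g v
  proof (intro equalityI subsetI)
    fix w assume "w \<in> T g ` (A #>\<^bsub>V\<^esub> v)"
    then obtain u where "u \<in> A" "w = T g (u \<otimes>\<^bsub>V\<^esub> v)" by (auto simp: r_coset_def)
    then show "w \<in> A #>\<^bsub>V\<^esub> T g v" using Tm g v TA by (auto simp: r_coset_def)
  next
    fix w assume "w \<in> A #>\<^bsub>V\<^esub> T g v"
    then obtain u where u: "u \<in> A" "w = u \<otimes>\<^bsub>V\<^esub> T g v" by (auto simp: r_coset_def)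
    let ?u = "T (inv\<^bsub>K\<^esub> g) u"
    have "?u \<in> A" using TA u g by simp
    moreover have "w = T g (?u \<otimes>\<^bsub>V\<^esub> v)" using u Tm g v Tinv Tc by simp
    ultimately show "w \<in> T g ` (A #>\<^bsub>V\<^esub> v)" by (auto simp: r_coset_def)
  qed
  have E: "C \<in> E \<longleftrightarrow> (\<exists>v\<in>carrier V. C = A #>\<^bsub>V\<^esub> v)" for C
    by (auto simp: E_def carrier_FactGroup)
  define \<phi> where "\<phi> g = restrict (\<lambda>C. T g ` C) E" for g
  have \<phi>E: "\<phi> g C \<in> E" if g: "g \<in> carrier K" and C: "C \<in> E" for g C
  proof -
    obtain v where v: "v \<in> carrier V" "C = A #>\<^bsub>V\<^esub> v" using C E by blast
    have "\<phi> g C = A #>\<^bsub>V\<^esub> T g v" using C coset[OF g v(1)] v(2) by (simp add: \<phi>_def)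
    then show ?thesis using Tc[OF g v(1)] by (simp only: E) blast
  qed
  have \<phi>\<phi>: "\<phi> (g \<otimes>\<^bsub>K\<^esub> h) C = \<phi> g (\<phi> h C)" if gh: "g \<in> carrier K" "h \<in> carrier K" and C: "C \<in> E" for g h C
  proof -
    obtain v where v: "v \<in> carrier V" "C = A #>\<^bsub>V\<^esub> v" using C E by blast
    then show ?thesis using \<phi>E[OF gh(2) C] C gh coset TT Tc by (simp add: \<phi>_def)
  qed
  have \<phi>1: "\<phi> \<one>\<^bsub>K\<^esub> C = C" if C: "C \<in> E" for C
  proof -
    obtain v where v: "v \<in> carrier V" "C = A #>\<^bsub>V\<^esub> v" using C E by blast
    then show ?thesis using C coset T1 by (simp add: \<phi>_def)
  qed
  have bij: "\<phi> g \<in> Bij E" if g: "g \<in> carrier K" for g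
  proof -
    have "bij_betw (\<phi> g) E E"
    proof (rule bij_betw_byWitness[where f' = "\<phi> (inv\<^bsub>K\<^esub> g)"])
      have ig: "inv\<^bsub>K\<^esub> g \<in> carrier K" using g by simp
      show "\<forall>C\<in>E. \<phi> (inv\<^bsub>K\<^esub> g) (\<phi> g C) = C"
        using \<phi>\<phi>[OF ig g] \<phi>1 g by simp
      show "\<forall>C\<in>E. \<phi> g (\<phi> (inv\<^bsub>K\<^esub> g) C) = C"
        using \<phi>\<phi>[OF g ig] \<phi>1 g by simp
      show "\<phi> g ` E \<subseteq> E" "\<phi> (inv\<^bsub>K\<^esub> g) ` E \<subseteq> E"
        using \<phi>E g ig by blast+
    qed
    then show ?thesis by (simp add: Bij_def \<phi>_def)
  qed
  have "\<phi> \<in> hom K (BijGroup E)"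
  proof (rule homI)
    show "\<phi> g \<in> carrier (BijGroup E)" if "g \<in> carrier K" for g using bij that by (simp add: BijGroup_def)
    show "\<phi> (g \<otimes>\<^bsub>K\<^esub> h) = \<phi> g \<otimes>\<^bsub>BijGroup E\<^esub> \<phi> h" if "g \<in> carrier K" "h \<in> carrier K" for g h
    proof -
      have "\<phi> (g \<otimes>\<^bsub>K\<^esub> h) = compose E (\<phi> g) (\<phi> h)"
      proof (rule extensionalityI[of _ E])
        show "\<phi> (g \<otimes>\<^bsub>K\<^esub> h) C = compose E (\<phi> g) (\<phi> h) C" if "C \<in> E" for C
          using \<phi>\<phi>[OF \<open>g \<in> carrier K\<close> \<open>h \<in> carrier K\<close> that] that by (simp add: compose_eq)
      qed (simp_all add: \<phi>_def compose_def)
      then show ?thesis using bij that by (simp add: BijGroup_def)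
    qed
  qed
  then interpret group_action K E \<phi>
    by (simp add: group_action_def group_hom_def group_hom_axioms_def K.group_axioms group_BijGroup)
  have finV: "finite (carrier V)" using V(2) p by (metis card.infinite not_prime_0 power_not_zero)
  have lag: "card E * card A = p ^ a"
    using V.lagrange[OF A(1)] V(2) by (simp add: E_def FactGroup_def order_def mult.commute)
  have finE: "finite E" using finV by (simp add: E_def carrier_FactGroup)
  have "card A < card (carrier V)"
    using A(2) A.subset finV by (intro psubset_card_mono) auto
  then have "card E \<noteq> 1" using lag V(2) by auto
  moreover have "card E dvd p ^ a" using lag by (metis dvd_triv_left)
  ultimately have dvd: "p dvd card E" using p by (metis divides_primepow_nat dvd_power gr0I power_0)
  have A0: "A #>\<^bsub>V\<^esub> \<one>\<^bsub>V\<^esub> = A" using A.subset by simp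
  have T0: "T g \<one>\<^bsub>V\<^esub> = \<one>\<^bsub>V\<^esub>" if "g \<in> carrier K" for g
    using hom_one[OF T[OF that]] V.group_axioms by blast
  have AE: "A \<in> E" using A0 E by (metis V.one_closed)
  have fixA: "\<phi> g A = A" if "g \<in> carrier K" for g
    using coset[OF that V.one_closed] T0[OF that] A0 AE by (simp add: \<phi>_def)
  obtain C where C: "C \<in> E" "C \<noteq> A" "\<And>g. g \<in> carrier K \<Longrightarrow> \<phi> g C = C"
    using p_group_fixed_point[OF p K(2) finE dvd AE fixA] by blast
  obtain v where v: "v \<in> carrier V" "C = A #>\<^bsub>V\<^esub> v" using C(1) E by blast
  show ?thesis
  proof (rule that[OF v(1)])
    show "v \<notin> A" using C(2) v A.rcos_eq_self_iff by simp
    show "T g v \<otimes>\<^bsub>V\<^esub> inv\<^bsub>V\<^esub> v \<in> A" if g: "g \<in> carrier K" for g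
      using C(3)[OF g] coset[OF g v(1)] C(1) v A.rcos_eq_iff[OF Tc[OF g v(1)] v(1)] by (simp add: \<phi>_def)
  qed
qed

text \<open>This turns sums in the residue ring into integer sums reduced once at the end, so the
  computations in group rings can be done with integers.\<close>

lemma finsum_Fp:
  assumes p: "prime p" and "finite A" "\<And>a. a \<in> A \<Longrightarrow> f a \<in> {0..int p - 1}"
  shows "finsum (Fp p) f A = (\<Sum>a\<in>A. f a) mod int p"
proof -
  interpret residues "int p" "Fp p" using prime_gt_1_nat[OF p] by unfold_locales simp_all
  have "finsum (Fp p) f A = (\<Oplus>\<^bsub>Fp p\<^esub>a\<in>A. f a mod int p)"
    using assms(3) by (intro finsum_cong') (auto simp: res_carrier_eq)
  then show ?thesis using sum_cong[OF assms(2)] by simp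
qed

locale finite_group_ring =
  fixes p :: nat and K :: "'g monoid" (structure)
  assumes p: "prime p" and K: "group K" and finite_K: "finite (carrier K)"
begin

sublocale K: group K by (rule K)

abbreviation "R \<equiv> group_ring (Fp p) K"

text \<open>Elements of the group ring are treated as reductions of integer-valued functions on K.
  Ring identities are proved for integer convolution and transferred by
  \<open>red_cong\<close>.\<close>

definition red :: "('g \<Rightarrow> int) \<Rightarrow> 'g \<Rightarrow> int" where
  "red f = (\<lambda>x\<in>carrier K. f x mod int p)"

definition conv :: "('g \<Rightarrow> int) \<Rightarrow> ('g \<Rightarrow> int) \<Rightarrow> 'g \<Rightarrow> int" where
  "conv f g x = (\<Sum>y\<in>carrier K. f y * g (inv y \<otimes> x))"

lemma p_pos: "0 < int p" "1 < int p"
  using prime_gt_1_nat[OF p] by auto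

lemma carrier_R: "carrier R = carrier K \<rightarrow>\<^sub>E {0..int p - 1}"
  by (simp add: group_ring_def residue_ring_def)

lemma finite_R: "finite (carrier R)"
  unfolding carrier_R by (intro finite_PiE finite_K) simp

lemma card_R: "card (carrier R) = p ^ card (carrier K)"
  unfolding carrier_R using finite_K by (simp add: card_PiE)

lemma red_closed [simp, intro]: "red f \<in> carrier R"
proof -
  have "f x mod int p \<in> {0..int p - 1}" for x using pos_mod_bound[OF p_pos(1), of "f x"] p_pos by simp
  then show ?thesis by (auto simp: carrier_R red_def)
qed

lemma red_id: "f \<in> carrier R \<Longrightarrow> red f = f"
  unfolding carrier_R red_def
  by (rule extensionalityI[of _ "carrier K"]) (auto simp: PiE_iff Pi_iff)

lemma red_cong: "(\<And>x. x \<in> carrier K \<Longrightarrow> f x mod int p = g x mod int p) \<Longrightarrow> red f = red g"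
  by (auto simp: red_def fun_eq_iff)

lemma red_apply: "x \<in> carrier K \<Longrightarrow> red f x = f x mod int p"
  by (simp add: red_def)

lemma add_R: "f \<oplus>\<^bsub>R\<^esub> g = red (\<lambda>x. f x + g x)"
  by (simp add: group_ring_def residue_ring_def red_def)

lemma zero_R: "\<zero>\<^bsub>R\<^esub> = red (\<lambda>_. 0)"
  by (simp add: group_ring_def residue_ring_def red_def)

definition delta :: "'g \<Rightarrow> 'g \<Rightarrow> int" where
  "delta g x = (if x = g then 1 else 0)"

lemma one_R: "\<one>\<^bsub>R\<^esub> = red (delta \<one>)"
  using p_pos by (auto simp: group_ring_def residue_ring_def red_def delta_def fun_eq_iff)

lemma mult_R:
  assumes "f \<in> carrier R" "g \<in> carrier R"
  shows "f \<otimes>\<^bsub>R\<^esub> g = red (conv f g)"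
proof -
  have "f \<otimes>\<^bsub>R\<^esub> g = (\<lambda>x\<in>carrier K. finsum (Fp p) (\<lambda>y. (f y * g (inv y \<otimes> x)) mod int p) (carrier K))"
    by (simp add: group_ring_def residue_ring_def)
  also have "\<dots> = red (conv f g)"
    unfolding red_def conv_def
  proof (rule restrict_ext)
    fix x
    have "(f y * g (inv y \<otimes> x)) mod int p \<in> {0..int p - 1}" for y
      using pos_mod_bound[OF p_pos(1)] p_pos by simp
    then show "finsum (Fp p) (\<lambda>y. (f y * g (inv y \<otimes> x)) mod int p) (carrier K) =
        (\<Sum>y\<in>carrier K. f y * g (inv y \<otimes> x)) mod int p"
      using finsum_Fp[OF p finite_K] by (simp add: mod_sum_eq)
  qed
  finally show ?thesis .
qed

lemma conv_red:
  assumes "x \<in> carrier K"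
  shows "conv (red f) g x mod int p = conv f g x mod int p"
    and "conv f (red g) x mod int p = conv f g x mod int p"
proof -
  show "conv (red f) g x mod int p = conv f g x mod int p"
    unfolding conv_def
    by (subst (1 2) mod_sum_eq[symmetric]) (simp add: red_apply mod_mult_left_eq)
  show "conv f (red g) x mod int p = conv f g x mod int p"
    unfolding conv_def using assms
    by (subst (1 2) mod_sum_eq[symmetric]) (simp add: red_apply mod_mult_right_eq)
qed

lemma red_conv_red: "red (conv (red f) (red g)) = red (conv f g)"
  by (rule red_cong) (simp add: conv_red)

lemma mult_red: "red f \<otimes>\<^bsub>R\<^esub> red g = red (conv f g)"
  by (simp add: mult_R red_conv_red)

lemma add_red: "red f \<oplus>\<^bsub>R\<^esub> red g = red (\<lambda>x. f x + g x)"
  unfolding add_R by (rule red_cong) (simp add: red_apply mod_add_eq)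

lemma conv_assoc:
  assumes x: "x \<in> carrier K"
  shows "conv (conv f g) h x = conv f (conv g h) x"
proof -
  have "conv (conv f g) h x = (\<Sum>y\<in>carrier K. \<Sum>z\<in>carrier K. f z * (g (inv z \<otimes> y) * h (inv y \<otimes> x)))"
    by (simp add: conv_def sum_distrib_right mult.assoc)
  also have "\<dots> = (\<Sum>z\<in>carrier K. \<Sum>y\<in>carrier K. f z * (g (inv z \<otimes> y) * h (inv y \<otimes> x)))"
    by (rule sum.swap)
  also have "\<dots> = (\<Sum>z\<in>carrier K. \<Sum>w\<in>carrier K. f z * (g w * h (inv w \<otimes> (inv z \<otimes> x))))"
  proof (rule sum.cong[OF refl])
    fix z assume z: "z \<in> carrier K"
    show "(\<Sum>y\<in>carrier K. f z * (g (inv z \<otimes> y) * h (inv y \<otimes> x))) =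
        (\<Sum>w\<in>carrier K. f z * (g w * h (inv w \<otimes> (inv z \<otimes> x))))"
    proof (rule sum.reindex_bij_witness[of _ "\<lambda>w. z \<otimes> w" "\<lambda>y. inv z \<otimes> y"])
      fix y assume y: "y \<in> carrier K"
      show "z \<otimes> (inv z \<otimes> y) = y" using z y by (simp flip: K.m_assoc)
      show "inv z \<otimes> y \<in> carrier K" using z y by simp
      have "inv (inv z \<otimes> y) \<otimes> (inv z \<otimes> x) = inv y \<otimes> (z \<otimes> (inv z \<otimes> x))"
        using x y z by (simp add: K.inv_mult_group K.m_assoc)
      also have "\<dots> = inv y \<otimes> x" using x y z by (simp flip: K.m_assoc)
      finally show "f z * (g (inv z \<otimes> y) * h (inv (inv z \<otimes> y) \<otimes> (inv z \<otimes> x))) =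
          f z * (g (inv z \<otimes> y) * h (inv y \<otimes> x))" by simp
    next
      fix w assume w: "w \<in> carrier K"
      show "inv z \<otimes> (z \<otimes> w) = w" using z w by (simp flip: K.m_assoc)
      show "z \<otimes> w \<in> carrier K" using z w by simp
    qed
  qed
  also have "\<dots> = conv f (conv g h) x"
    by (simp add: conv_def sum_distrib_left)
  finally show ?thesis .
qed

lemma conv_reindex:
  assumes x: "x \<in> carrier K"
  shows "conv f g x = (\<Sum>z\<in>carrier K. f (x \<otimes> inv z) * g z)"
  unfolding conv_def
proof (rule sum.reindex_bij_witness[of _ "\<lambda>z. x \<otimes> inv z" "\<lambda>y. inv y \<otimes> x"])
  fix y assume y: "y \<in> carrier K"
  show "x \<otimes> inv (inv y \<otimes> x) = y" using x y by (simp add: K.inv_mult_group K.m_assoc[symmetric])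
  then show "f (x \<otimes> inv (inv y \<otimes> x)) * g (inv y \<otimes> x) = f y * g (inv y \<otimes> x)" by simp
  show "inv y \<otimes> x \<in> carrier K" using x y by simp
next
  fix z assume z: "z \<in> carrier K"
  show "inv (x \<otimes> inv z) \<otimes> x = z" using x z by (simp add: K.inv_mult_group K.m_assoc)
  show "x \<otimes> inv z \<in> carrier K" using x z by simp
qed

lemma conv_delta_left:
  assumes "g \<in> carrier K"
  shows "conv (delta g) f x = f (inv g \<otimes> x)"
proof -
  have "conv (delta g) f x = (\<Sum>y\<in>carrier K. if y = g then f (inv y \<otimes> x) else 0)"
    unfolding conv_def delta_def by (intro sum.cong) auto
  then show ?thesis using assms finite_K by (simp add: sum.delta)
qed

lemma conv_delta_right:
  assumes "g \<in> carrier K" "x \<in> carrier K"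
  shows "conv f (delta g) x = f (x \<otimes> inv g)"
proof -
  have "conv f (delta g) x = (\<Sum>z\<in>carrier K. if z = g then f (x \<otimes> inv z) else 0)"
    unfolding conv_reindex[OF assms(2)] delta_def by (intro sum.cong) auto
  then show ?thesis using assms finite_K by (simp add: sum.delta)
qed

lemma ring_R: "ring R"
proof (rule ringI)
  show "abelian_group R"
  proof (rule abelian_groupI)
    fix f g h assume f: "f \<in> carrier R" and g: "g \<in> carrier R" and h: "h \<in> carrier R"
    show "f \<oplus>\<^bsub>R\<^esub> g \<in> carrier R" by (simp add: add_R)
    show "f \<oplus>\<^bsub>R\<^esub> g = g \<oplus>\<^bsub>R\<^esub> f" by (simp add: add_R add.commute)
    show "f \<oplus>\<^bsub>R\<^esub> g \<oplus>\<^bsub>R\<^esub> h = f \<oplus>\<^bsub>R\<^esub> (g \<oplus>\<^bsub>R\<^esub> h)"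
      using add_red[of "\<lambda>x. f x + g x" h] add_red[of f "\<lambda>x. g x + h x"]
      by (simp add: red_id f g h add_R add.assoc)
    show "\<zero>\<^bsub>R\<^esub> \<oplus>\<^bsub>R\<^esub> f = f"
      unfolding zero_R using add_red[of "\<lambda>_. 0" f] red_id[OF f] by simp
    have "red (\<lambda>x. - f x) \<oplus>\<^bsub>R\<^esub> f = \<zero>\<^bsub>R\<^esub>"
      unfolding zero_R using add_red[of "\<lambda>x. - f x" f] red_id[OF f] by simp
    then show "\<exists>g\<in>carrier R. g \<oplus>\<^bsub>R\<^esub> f = \<zero>\<^bsub>R\<^esub>" by blast
  qed (simp add: zero_R)
  show "monoid R"
  proof (rule monoidI)
    fix f g h assume f: "f \<in> carrier R" and g: "g \<in> carrier R" and h: "h \<in> carrier R"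
    show "f \<otimes>\<^bsub>R\<^esub> g \<in> carrier R" by (simp add: mult_R f g)
    have "red f \<otimes>\<^bsub>R\<^esub> red g \<otimes>\<^bsub>R\<^esub> red h = red f \<otimes>\<^bsub>R\<^esub> (red g \<otimes>\<^bsub>R\<^esub> red h)"
      unfolding mult_red by (rule red_cong) (simp add: conv_assoc)
    then show "f \<otimes>\<^bsub>R\<^esub> g \<otimes>\<^bsub>R\<^esub> h = f \<otimes>\<^bsub>R\<^esub> (g \<otimes>\<^bsub>R\<^esub> h)" by (simp add: red_id f g h)
    have "\<one>\<^bsub>R\<^esub> \<otimes>\<^bsub>R\<^esub> red f = red f"
      unfolding one_R mult_red by (rule red_cong) (simp add: conv_delta_left)
    then show "\<one>\<^bsub>R\<^esub> \<otimes>\<^bsub>R\<^esub> f = f" by (simp add: red_id f)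
    have "red f \<otimes>\<^bsub>R\<^esub> \<one>\<^bsub>R\<^esub> = red f"
      unfolding one_R mult_red by (rule red_cong) (simp add: conv_delta_right)
    then show "f \<otimes>\<^bsub>R\<^esub> \<one>\<^bsub>R\<^esub> = f" by (simp add: red_id f)
  qed (simp add: one_R)
  fix f g h assume f: "f \<in> carrier R" and g: "g \<in> carrier R" and h: "h \<in> carrier R"
  have "(red f \<oplus>\<^bsub>R\<^esub> red g) \<otimes>\<^bsub>R\<^esub> red h = red f \<otimes>\<^bsub>R\<^esub> red h \<oplus>\<^bsub>R\<^esub> red g \<otimes>\<^bsub>R\<^esub> red h"
    unfolding mult_red add_red by (rule red_cong) (simp add: conv_def distrib_right sum.distrib)
  then show "(f \<oplus>\<^bsub>R\<^esub> g) \<otimes>\<^bsub>R\<^esub> h = f \<otimes>\<^bsub>R\<^esub> h \<oplus>\<^bsub>R\<^esub> g \<otimes>\<^bsub>R\<^esub> h" by (simp add: red_id f g h)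
  have "red h \<otimes>\<^bsub>R\<^esub> (red f \<oplus>\<^bsub>R\<^esub> red g) = red h \<otimes>\<^bsub>R\<^esub> red f \<oplus>\<^bsub>R\<^esub> red h \<otimes>\<^bsub>R\<^esub> red g"
    unfolding mult_red add_red by (rule red_cong) (simp add: conv_def distrib_left sum.distrib)
  then show "h \<otimes>\<^bsub>R\<^esub> (f \<oplus>\<^bsub>R\<^esub> g) = h \<otimes>\<^bsub>R\<^esub> f \<oplus>\<^bsub>R\<^esub> h \<otimes>\<^bsub>R\<^esub> g" by (simp add: red_id f g h)
qed

sublocale R: ring R by (rule ring_R)

lemma neg_red: "\<ominus>\<^bsub>R\<^esub> red f = red (\<lambda>x. - f x)"
proof -
  have "red (\<lambda>x. - f x) \<oplus>\<^bsub>R\<^esub> red f = \<zero>\<^bsub>R\<^esub>" unfolding zero_R add_red by simp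
  then show ?thesis by (metis R.minus_equality red_closed)
qed

definition aug :: "('g \<Rightarrow> int) set" where
  "aug = {f \<in> carrier R. (\<Sum>x\<in>carrier K. f x) mod int p = 0}"

lemma sum_red: "(\<Sum>x\<in>carrier K. red f x) mod int p = (\<Sum>x\<in>carrier K. f x) mod int p"
  by (subst (1 2) mod_sum_eq[symmetric]) (simp add: red_apply)

lemma sum_conv: "(\<Sum>x\<in>carrier K. conv f g x) = (\<Sum>x\<in>carrier K. f x) * (\<Sum>x\<in>carrier K. g x)"
proof -
  have "(\<Sum>x\<in>carrier K. conv f g x) = (\<Sum>y\<in>carrier K. f y * (\<Sum>x\<in>carrier K. g (inv y \<otimes> x)))"
    unfolding conv_def by (subst sum.swap) (simp add: sum_distrib_left)
  also have "\<dots> = (\<Sum>y\<in>carrier K. f y * (\<Sum>x\<in>carrier K. g x))"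
  proof (rule sum.cong[OF refl])
    fix y assume y: "y \<in> carrier K"
    have "(\<Sum>x\<in>carrier K. g (inv y \<otimes> x)) = (\<Sum>x\<in>carrier K. g x)"
      using y by (intro sum.reindex_bij_witness[of _ "\<lambda>x. y \<otimes> x" "\<lambda>x. inv y \<otimes> x"])
        (auto simp flip: K.m_assoc)
    then show "f y * (\<Sum>x\<in>carrier K. g (inv y \<otimes> x)) = f y * (\<Sum>x\<in>carrier K. g x)" by simp
  qed
  finally show ?thesis by (simp add: sum_distrib_right)
qed

lemma ideal_aug: "ideal aug R"
proof (rule idealI)
  show "subgroup aug (add_monoid R)"
  proof (rule group.subgroupI[OF R.add.group_axioms])
    show "aug \<subseteq> carrier (add_monoid R)" by (auto simp: aug_def)
    have "\<zero>\<^bsub>R\<^esub> \<in> aug" using sum_red[of "\<lambda>_. 0"] by (simp add: aug_def zero_R)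
    then show "aug \<noteq> {}" by blast
    fix f assume f: "f \<in> aug"
    then have fc: "f \<in> carrier R" by (simp add: aug_def)
    have "(- (\<Sum>x\<in>carrier K. f x)) mod int p = 0"
      using f by (simp add: aug_def mod_minus_eq[symmetric] zmod_zminus1_eq_if)
    then have "\<ominus>\<^bsub>R\<^esub> f \<in> aug"
      using neg_red[of f] red_id[OF fc] sum_red[of "\<lambda>x. - f x"] by (simp add: aug_def sum_negf)
    then show "inv\<^bsub>add_monoid R\<^esub> f \<in> aug" by (simp add: a_inv_def)
    fix g assume g: "g \<in> aug"
    have "((\<Sum>x\<in>carrier K. f x) + (\<Sum>x\<in>carrier K. g x)) mod int p = 0"
      using f g by (simp add: aug_def mod_add_eq[symmetric] flip: mod_add_eq)
    then show "f \<otimes>\<^bsub>add_monoid R\<^esub> g \<in> aug"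
      using sum_red[of "\<lambda>x. f x + g x"] by (simp add: aug_def add_R sum.distrib)
  qed
  fix f g assume f: "f \<in> aug" and g: "g \<in> carrier R"
  then have fc: "f \<in> carrier R" and s: "(\<Sum>x\<in>carrier K. f x) mod int p = 0" by (simp_all add: aug_def)
  have "(\<Sum>x\<in>carrier K. g x) * (\<Sum>x\<in>carrier K. f x) mod int p = 0"
    using s by (metis mod_mult_right_eq mult_zero_right mod_0)
  then show "g \<otimes>\<^bsub>R\<^esub> f \<in> aug" "f \<otimes>\<^bsub>R\<^esub> g \<in> aug"
    using fc g sum_red[of "conv g f"] sum_red[of "conv f g"]
    by (simp_all add: aug_def mult_R sum_conv mult.commute)
qed (rule ring_R)

text \<open>The n-th stage consists of the v killed by right multiplication with any n elements of
  the augmentation ideal, that is, the left annihilator of its n-th power. It is an ascending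
  series, like an upper central series, and nilpotency means that it reaches the whole ring.\<close>

primrec annihilator :: "nat \<Rightarrow> ('g \<Rightarrow> int) set" where
  "annihilator 0 = {\<zero>\<^bsub>R\<^esub>}"
| "annihilator (Suc n) = {v \<in> carrier R. \<forall>a\<in>aug. v \<otimes>\<^bsub>R\<^esub> a \<in> annihilator n}"

lemma aug_carrier: "a \<in> aug \<Longrightarrow> a \<in> carrier R"
  by (simp add: aug_def)

lemma annihilator_carrier: "v \<in> annihilator n \<Longrightarrow> v \<in> carrier R"
  by (cases n) auto

lemma subgroup_annihilator: "subgroup (annihilator n) (add_monoid R)"
proof (induction n)
  case 0
  show ?case using R.add.triv_subgroup by simp
next
  case (Suc n)
  interpret A: subgroup "annihilator n" "add_monoid R" by (rule Suc)
  show ?case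
  proof (rule group.subgroupI[OF R.add.group_axioms])
    show "annihilator (Suc n) \<subseteq> carrier (add_monoid R)" by auto
    have "\<zero>\<^bsub>R\<^esub> \<in> annihilator (Suc n)" using A.one_closed aug_carrier by auto
    then show "annihilator (Suc n) \<noteq> {}" by blast
    fix v assume v: "v \<in> annihilator (Suc n)"
    have "\<ominus>\<^bsub>R\<^esub> v \<otimes>\<^bsub>R\<^esub> a \<in> annihilator n" if a: "a \<in> aug" for a
    proof -
      have "\<ominus>\<^bsub>R\<^esub> (v \<otimes>\<^bsub>R\<^esub> a) \<in> annihilator n"
        using A.m_inv_closed[of "v \<otimes>\<^bsub>R\<^esub> a"] v a unfolding a_inv_def by simp
      then show ?thesis using v aug_carrier[OF a] by (simp add: R.l_minus)
    qed
    then show "inv\<^bsub>add_monoid R\<^esub> v \<in> annihilator (Suc n)"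
      using v unfolding a_inv_def[of R, symmetric] by simp
    fix w assume w: "w \<in> annihilator (Suc n)"
    have "(v \<oplus>\<^bsub>R\<^esub> w) \<otimes>\<^bsub>R\<^esub> a \<in> annihilator n" if a: "a \<in> aug" for a
      using A.m_closed[of "v \<otimes>\<^bsub>R\<^esub> a" "w \<otimes>\<^bsub>R\<^esub> a"] v w a aug_carrier[OF a] by (simp add: R.l_distr)
    then show "v \<otimes>\<^bsub>add_monoid R\<^esub> w \<in> annihilator (Suc n)" using v w by simp
  qed
qed

lemma annihilator_mono: "annihilator n \<subseteq> annihilator (Suc n)"
proof (induction n)
  case 0
  then show ?case using aug_carrier by auto
next
  case (Suc n)
  then show ?case by auto
qed

lemma annihilator_right_mult:
  assumes "v \<in> annihilator n" "w \<in> carrier R"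
  shows "v \<otimes>\<^bsub>R\<^esub> w \<in> annihilator n"
proof (cases n)
  case 0
  then show ?thesis using assms by simp
next
  case (Suc m)
  have "v \<otimes>\<^bsub>R\<^esub> w \<otimes>\<^bsub>R\<^esub> a \<in> annihilator m" if a: "a \<in> aug" for a
    using assms Suc ideal.I_l_closed[OF ideal_aug a assms(2)] aug_carrier[OF a] by (simp add: R.m_assoc)
  then show ?thesis using assms Suc by simp
qed

lemma red_multiple:
  assumes A: "subgroup A (add_monoid R)" and d: "red d \<in> A"
  shows "red (\<lambda>x. int n * d x) \<in> A"
proof (induction n)
  case 0
  then show ?case using subgroup.one_closed[OF A] by (simp add: zero_R)
next
  case (Suc n)
  have "red (\<lambda>x. int (Suc n) * d x) = red (\<lambda>x. int n * d x) \<oplus>\<^bsub>R\<^esub> red d"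
    unfolding add_red by (rule red_cong) (simp add: algebra_simps)
  then show ?case using subgroup.m_closed[OF A Suc d] by simp
qed

text \<open>Elements of the prime field are represented by nonnegative integers, so an additive
  subgroup is automatically closed under linear combinations with coefficients in it.\<close>

lemma red_combination:
  assumes A: "subgroup A (add_monoid R)" and d: "\<And>g. g \<in> S \<Longrightarrow> red (d g) \<in> A"
    and a: "\<And>g. g \<in> S \<Longrightarrow> a g \<ge> 0" and S: "finite S"
  shows "red (\<lambda>x. \<Sum>g\<in>S. a g * d g x) \<in> A"
  using S d a
proof (induction S)
  case empty
  then show ?case using subgroup.one_closed[OF A] by (simp add: zero_R)
next
  case (insert g S)
  have "red (\<lambda>x. a g * d g x) \<in> A"
    using red_multiple[OF A, of "d g" "nat (a g)"] insert by simp
  moreover have "red (\<lambda>x. \<Sum>g\<in>insert g S. a g * d g x) =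
      red (\<lambda>x. a g * d g x) \<oplus>\<^bsub>R\<^esub> red (\<lambda>x. \<Sum>g\<in>S. a g * d g x)"
    unfolding add_red using insert by simp
  ultimately show ?case using subgroup.m_closed[OF A] insert by simp
qed

text \<open>A fixed point of right translation modulo the annihilator, which exists by counting orbits modulo \<open>p\<close>,
  is carried into the annihilator by the augmentation ideal.\<close>

lemma annihilator_grows:
  assumes ord: "order K = p ^ k" and ne: "annihilator n \<noteq> carrier R"
  shows "annihilator n \<subset> annihilator (Suc n)"
proof -
  \<comment> \<open>The inverse turns right multiplication into a left action: T g sends v to the
    function x -> v (x g).\<close>
  define T where "T g v = v \<otimes>\<^bsub>R\<^esub> red (delta (inv g))" for g v
  have Tred: "T g (red v) = red (\<lambda>x. v (x \<otimes> g))" if "g \<in> carrier K" for g v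
    unfolding T_def mult_red using that by (intro red_cong) (simp add: conv_delta_right)
  have hom: "T g \<in> hom (add_monoid R) (add_monoid R)" if "g \<in> carrier K" for g
    by (auto simp: hom_def T_def R.l_distr)
  have T1: "T \<one> v = v" if v: "v \<in> carrier (add_monoid R)" for v
  proof -
    have "T \<one> (red v) = red v" using Tred[of \<one> v] by (simp, intro red_cong) simp
    then show ?thesis using red_id[of v] v by simp
  qed
  have TT: "T (g \<otimes> h) v = T g (T h v)"
    if "g \<in> carrier K" "h \<in> carrier K" and v: "v \<in> carrier (add_monoid R)" for g h v
  proof -
    have "T (g \<otimes> h) (red v) = T g (T h (red v))"
      using that by (simp add: Tred, intro red_cong) (simp add: K.m_assoc)
    then show ?thesis using red_id[of v] v by simp
  qed
  obtain v where v: "v \<in> carrier R" "v \<notin> annihilator n"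
    and fixed: "\<And>g. g \<in> carrier K \<Longrightarrow> T g v \<oplus>\<^bsub>R\<^esub> \<ominus>\<^bsub>R\<^esub> v \<in> annihilator n"
    using p_group_fixed_point_quotient[OF p K ord R.a_comm_group _ subgroup_annihilator _ hom T1 TT, of "card (carrier K)" n]
      card_R ne annihilator_right_mult by (auto simp: T_def a_inv_def)
  have "v \<otimes>\<^bsub>R\<^esub> a \<in> annihilator n" if a: "a \<in> aug" for a
  proof -
    have ac: "a \<in> carrier R" and a0: "\<And>g. g \<in> carrier K \<Longrightarrow> a g \<ge> 0"
      using a by (auto simp: aug_def carrier_R PiE_iff)
    have "red (\<lambda>x. v (x \<otimes> inv g) - v x) \<in> annihilator n" if g: "g \<in> carrier K" for g
    proof -
      have "T (inv g) (red v) \<oplus>\<^bsub>R\<^esub> \<ominus>\<^bsub>R\<^esub> red v = red (\<lambda>x. v (x \<otimes> inv g) - v x)"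
        using g by (simp add: Tred neg_red add_red)
      then show ?thesis using fixed[of "inv g"] g red_id[OF v(1)] by simp
    qed
    then have "red (\<lambda>x. \<Sum>g\<in>carrier K. a g * (v (x \<otimes> inv g) - v x)) \<in> annihilator n"
      using a0 by (intro red_combination subgroup_annihilator finite_K) auto
    \<comment> \<open>The product is the sum of a(g) times the right translate of v by g.
      Subtracting v in every term changes nothing modulo p, because the coefficients of a sum to
      zero.\<close>
    moreover have "v \<otimes>\<^bsub>R\<^esub> a = red (\<lambda>x. \<Sum>g\<in>carrier K. a g * (v (x \<otimes> inv g) - v x))"
      unfolding mult_R[OF v(1) ac]
    proof (rule red_cong)
      fix x assume x: "x \<in> carrier K"
      have "(\<Sum>g\<in>carrier K. a g * (v (x \<otimes> inv g) - v x)) = conv v a x - (\<Sum>g\<in>carrier K. a g) * v x"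
        unfolding conv_reindex[OF x] by (simp add: algebra_simps sum_subtractf sum_distrib_left)
      moreover have "int p dvd (\<Sum>g\<in>carrier K. a g) * v x" using a by (simp add: aug_def dvd_eq_mod_eq_0[symmetric])
      ultimately show "conv v a x mod int p = (\<Sum>g\<in>carrier K. a g * (v (x \<otimes> inv g) - v x)) mod int p"
        by (simp add: mod_eq_dvd_iff)
    qed
    ultimately show ?thesis by simp
  qed
  then have "v \<in> annihilator (Suc n)" using v by simp
  then show ?thesis using annihilator_mono v(2) by blast
qed

lemma annihilator_eventually:
  assumes ord: "order K = p ^ k"
  obtains N where "annihilator N = carrier R"
proof (rule ccontr)
  assume "\<not> thesis"
  then have ne: "annihilator n \<noteq> carrier R" for n using that by blast
  have "n < card (annihilator n)" for n
  proof (induction n)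
    case 0
    then show ?case by simp
  next
    case (Suc n)
    have "card (annihilator n) < card (annihilator (Suc n))"
      using annihilator_grows[OF ord ne] annihilator_carrier finite_subset[OF _ finite_R]
      by (intro psubset_card_mono) blast+
    then show ?case using Suc by simp
  qed
  moreover have "card (annihilator n) \<le> card (carrier R)" for n
    using annihilator_carrier finite_R by (intro card_mono) blast+
  ultimately show False by (metis not_less_iff_gr_or_eq leD)
qed

primrec aug_power :: "nat \<Rightarrow> ('g \<Rightarrow> int) set" where
  "aug_power 0 = carrier R"
| "aug_power (Suc n) = ideal_prod R (aug_power n) aug"

text \<open>If the annihilator series reaches the whole ring at stage N, then each further factor
  from the augmentation ideal lowers the stage by one. The n-th power thus lies in stage N - n, and
  stage 0 is zero.\<close>

theorem aug_nilpotent: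
  assumes ord: "order K = p ^ k"
  obtains N where "aug_power N \<subseteq> {\<zero>\<^bsub>R\<^esub>}"
proof -
  obtain N where N: "annihilator N = carrier R" using annihilator_eventually[OF ord] .
  have "n \<le> N \<Longrightarrow> aug_power n \<subseteq> annihilator (N - n)" for n
  proof (induction n)
    case 0
    then show ?case using N by simp
  next
    case (Suc n)
    then have "aug_power n \<subseteq> annihilator (Suc (N - Suc n))" by (simp add: Suc_diff_Suc)
    moreover have "x \<in> annihilator (N - Suc n)"
      if "aug_power n \<subseteq> annihilator (Suc (N - Suc n))" "x \<in> ideal_prod R (aug_power n) aug" for x
      using that(2)
    proof (induction rule: ideal_prod.induct)
      case (prod i j)
      then show ?case using that(1) by auto
    next
      case (sum s1 s2)
      then show ?case using subgroup.m_closed[OF subgroup_annihilator] by simp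
    qed
    ultimately show ?case by auto
  qed
  from this[of N] show ?thesis using that by simp
qed

end

section \<open>Push-forward between finite group rings\<close>

lemma Fp_range: "prime p \<Longrightarrow> (a::int) mod int p \<in> {0..int p - 1}"
  using prime_gt_0_nat[of p] pos_mod_bound[of "int p" a] by simp

lemma push_forward_eq:
  assumes p: "prime p" and fin: "finite (carrier K)" and f: "f \<in> carrier (group_ring (Fp p) K)"
  shows "push_forward (Fp p) K L q f =
    (\<lambda>l\<in>carrier L. (\<Sum>k\<in>{k \<in> carrier K. q k = l}. f k) mod int p)"
  unfolding push_forward_def
proof (rule restrict_ext)
  fix l
  have "f k \<in> {0..int p - 1}" if "k \<in> carrier K" for k
    using f that by (auto simp: group_ring_def residue_ring_def)
  then show "finsum (Fp p) f {k \<in> carrier K. q k = l} = (\<Sum>k\<in>{k \<in> carrier K. q k = l}. f k) mod int p"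
    using fin by (intro finsum_Fp[OF p]) auto
qed

lemma push_forward_cong:
  "(\<And>k. k \<in> carrier K \<Longrightarrow> q k = q' k) \<Longrightarrow> push_forward R K L q f = push_forward R K L q' f"
  unfolding push_forward_def by (intro restrict_ext arg_cong2[where f = "finsum R"]) auto

lemma push_forward_closed:
  assumes p: "prime p" and fin: "finite (carrier K)" and f: "f \<in> carrier (group_ring (Fp p) K)"
  shows "push_forward (Fp p) K L q f \<in> carrier (group_ring (Fp p) L)"
  unfolding push_forward_eq[OF assms] using Fp_range[OF p] by (simp add: group_ring_def residue_ring_def)

lemma sum_fibre:
  fixes h :: "'a \<Rightarrow> int"
  assumes "finite A" "finite B" "\<And>a. a \<in> A \<Longrightarrow> q a \<in> B"
  shows "(\<Sum>b\<in>B. \<Sum>a\<in>{a \<in> A. q a = b}. h a) = (\<Sum>a\<in>A. h a)"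
  using assms by (intro sum.group) auto

text \<open>Only sums over fibres enter, so functoriality holds for maps of sets between the bases.
  The extra degeneracy relies on this generality.\<close>

lemma push_forward_comp:
  assumes p: "prime p" and fin: "finite (carrier K)" "finite (carrier L)"
    and f: "f \<in> carrier (group_ring (Fp p) K)" and q: "\<And>k. k \<in> carrier K \<Longrightarrow> q k \<in> carrier L"
  shows "push_forward (Fp p) L M r (push_forward (Fp p) K L q f) = push_forward (Fp p) K M (\<lambda>k. r (q k)) f"
proof -
  define g where "g = push_forward (Fp p) K L q f"
  have gc: "g \<in> carrier (group_ring (Fp p) L)" unfolding g_def by (rule push_forward_closed[OF p fin(1) f])
  have gl: "g l = (\<Sum>k\<in>{k \<in> carrier K. q k = l}. f k) mod int p" if "l \<in> carrier L" for l
    unfolding g_def push_forward_eq[OF p fin(1) f] using that by simp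
  have "push_forward (Fp p) L M r g = push_forward (Fp p) K M (\<lambda>k. r (q k)) f"
    unfolding push_forward_eq[OF p fin(2) gc] push_forward_eq[OF p fin(1) f]
  proof (rule restrict_ext)
    fix m
    let ?S = "{l \<in> carrier L. r l = m}"
    have "(\<Sum>l\<in>?S. g l) mod int p = (\<Sum>l\<in>?S. (\<Sum>k\<in>{k \<in> carrier K. q k = l}. f k) mod int p) mod int p"
      using gl by simp
    also have "\<dots> = (\<Sum>l\<in>?S. \<Sum>k\<in>{k \<in> carrier K. q k = l}. f k) mod int p"
      by (simp add: mod_sum_eq)
    also have "(\<Sum>l\<in>?S. \<Sum>k\<in>{k \<in> carrier K. q k = l}. f k) =
        (\<Sum>l\<in>?S. \<Sum>k\<in>{k \<in> {k \<in> carrier K. r (q k) = m}. q k = l}. f k)"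
      by (intro sum.cong refl) auto
    also have "\<dots> = (\<Sum>k\<in>{k \<in> carrier K. r (q k) = m}. f k)"
      using fin q by (intro sum_fibre) auto
    finally show "(\<Sum>l\<in>?S. g l) mod int p = (\<Sum>k\<in>{k \<in> carrier K. r (q k) = m}. f k) mod int p" .
  qed
  then show ?thesis unfolding g_def .
qed

locale finite_group_ring_pair = K: finite_group_ring p K + L: finite_group_ring p L
  for p :: nat and K :: "'g monoid" and L :: "'h monoid"
begin

definition psum :: "('g \<Rightarrow> 'h) \<Rightarrow> ('g \<Rightarrow> int) \<Rightarrow> 'h \<Rightarrow> int" where
  "psum q f l = (\<Sum>k\<in>{k \<in> carrier K. q k = l}. f k)"

abbreviation "push \<equiv> push_forward (Fp p) K L"

lemma push_eq: "f \<in> carrier K.R \<Longrightarrow> push q f = L.red (psum q f)"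
  using push_forward_eq[OF K.p K.finite_K] by (simp add: psum_def L.red_def)

lemma psum_red: "psum q (K.red f) l mod int p = psum q f l mod int p"
  unfolding psum_def by (subst (1 2) mod_sum_eq[symmetric]) (simp add: K.red_apply)

lemma push_red: "push q (K.red f) = L.red (psum q f)"
  by (simp add: push_eq) (rule L.red_cong, rule psum_red)

lemma push_closed: "f \<in> carrier K.R \<Longrightarrow> push q f \<in> carrier L.R"
  by (simp add: push_eq)

lemma push_zero: "push q \<zero>\<^bsub>K.R\<^esub> = \<zero>\<^bsub>L.R\<^esub>"
  unfolding K.zero_R L.zero_R push_red by (rule L.red_cong) (simp add: psum_def)

lemma push_add:
  assumes "f \<in> carrier K.R" "g \<in> carrier K.R"
  shows "push q (f \<oplus>\<^bsub>K.R\<^esub> g) = push q f \<oplus>\<^bsub>L.R\<^esub> push q g"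
  unfolding K.add_R push_red push_eq[OF assms(1)] push_eq[OF assms(2)] L.add_red
  by (rule L.red_cong) (simp add: psum_def sum.distrib)

lemma push_delta:
  assumes "g \<in> carrier K"
  shows "push q (K.red (K.delta g)) = L.red (L.delta (q g))"
  unfolding push_red
proof (rule L.red_cong)
  fix l
  have "psum q (K.delta g) l = (\<Sum>k\<in>{k \<in> carrier K. q k = l}. if k = g then 1 else 0)"
    unfolding psum_def K.delta_def by simp
  also have "\<dots> = (if q g = l then 1 else 0)"
    using assms K.finite_K by (subst sum.delta) auto
  finally show "psum q (K.delta g) l mod int p = L.delta (q g) l mod int p" by (auto simp: L.delta_def)
qed

lemma push_sum:
  assumes "f \<in> carrier K.R" "\<And>k. k \<in> carrier K \<Longrightarrow> q k \<in> carrier L"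
  shows "(\<Sum>l\<in>carrier L. push q f l) mod int p = (\<Sum>k\<in>carrier K. f k) mod int p"
  unfolding push_eq[OF assms(1)] L.sum_red psum_def
  using sum_fibre[OF K.finite_K L.finite_K assms(2), of "\<lambda>x. x" f] assms(2) by simp

text \<open>At l both sides sum f(y) g(z) over the pairs (y, z) with q(y) q(z) = l. The substitution
  k = y z is the place where q has to be multiplicative.\<close>

lemma push_mult:
  assumes f: "f \<in> carrier K.R" and g: "g \<in> carrier K.R" and q: "q \<in> hom K L"
  shows "push q (f \<otimes>\<^bsub>K.R\<^esub> g) = push q f \<otimes>\<^bsub>L.R\<^esub> push q g"
proof -
  interpret q: group_hom K L q using q by unfold_locales
  have "psum q (K.conv f g) l = L.conv (psum q f) (psum q g) l" if l: "l \<in> carrier L" for l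
  proof -
    let ?h = "\<lambda>y. f y * psum q g (inv\<^bsub>L\<^esub> q y \<otimes>\<^bsub>L\<^esub> l)"
    have "L.conv (psum q f) (psum q g) l =
        (\<Sum>a\<in>carrier L. \<Sum>y\<in>{y \<in> carrier K. q y = a}. ?h y)"
      unfolding L.conv_def by (intro sum.cong refl) (simp add: psum_def[of q f] sum_distrib_right)
    also have "\<dots> = (\<Sum>y\<in>carrier K. ?h y)"
      by (rule sum_fibre[OF K.finite_K L.finite_K]) simp
    also have "\<dots> = (\<Sum>y\<in>carrier K. \<Sum>k\<in>{k \<in> carrier K. q k = l}. f y * g (inv\<^bsub>K\<^esub> y \<otimes>\<^bsub>K\<^esub> k))"
    proof (rule sum.cong[OF refl])
      fix y assume y: "y \<in> carrier K"
      have "psum q g (inv\<^bsub>L\<^esub> q y \<otimes>\<^bsub>L\<^esub> l) = (\<Sum>k\<in>{k \<in> carrier K. q k = l}. g (inv\<^bsub>K\<^esub> y \<otimes>\<^bsub>K\<^esub> k))"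
        unfolding psum_def
      proof (rule sum.reindex_bij_witness[of _ "\<lambda>k. inv\<^bsub>K\<^esub> y \<otimes>\<^bsub>K\<^esub> k" "\<lambda>z. y \<otimes>\<^bsub>K\<^esub> z"])
        fix z assume "z \<in> {z \<in> carrier K. q z = inv\<^bsub>L\<^esub> q y \<otimes>\<^bsub>L\<^esub> l}"
        then have z: "z \<in> carrier K" "q z = inv\<^bsub>L\<^esub> q y \<otimes>\<^bsub>L\<^esub> l" by auto
        show e: "inv\<^bsub>K\<^esub> y \<otimes>\<^bsub>K\<^esub> (y \<otimes>\<^bsub>K\<^esub> z) = z" using y z by (simp flip: K.K.m_assoc)
        show "y \<otimes>\<^bsub>K\<^esub> z \<in> {k \<in> carrier K. q k = l}" using y z l by (simp flip: L.K.m_assoc)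
        show "g (inv\<^bsub>K\<^esub> y \<otimes>\<^bsub>K\<^esub> (y \<otimes>\<^bsub>K\<^esub> z)) = g z" using e by simp
      next
        fix k assume "k \<in> {k \<in> carrier K. q k = l}"
        then have k: "k \<in> carrier K" "q k = l" by auto
        show "y \<otimes>\<^bsub>K\<^esub> (inv\<^bsub>K\<^esub> y \<otimes>\<^bsub>K\<^esub> k) = k" using y k by (simp flip: K.K.m_assoc)
        show "inv\<^bsub>K\<^esub> y \<otimes>\<^bsub>K\<^esub> k \<in> {z \<in> carrier K. q z = inv\<^bsub>L\<^esub> q y \<otimes>\<^bsub>L\<^esub> l}" using y k by simp
      qed
      then show "?h y = (\<Sum>k\<in>{k \<in> carrier K. q k = l}. f y * g (inv\<^bsub>K\<^esub> y \<otimes>\<^bsub>K\<^esub> k))"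
        by (simp add: sum_distrib_left)
    qed
    also have "\<dots> = psum q (K.conv f g) l"
      unfolding psum_def K.conv_def by (rule sum.swap)
    finally show ?thesis ..
  qed
  then show ?thesis
    unfolding K.mult_R[OF f g] push_red push_eq[OF f] push_eq[OF g] L.mult_red
    by (intro L.red_cong) simp
qed

end

section \<open>Completed group algebras\<close>

context pro_p
begin

abbreviation "A \<equiv> completed_group_algebra p H T"
abbreviation "GR U \<equiv> group_ring (Fp p) (H Mod U)"

lemma finite_group_ring_Mod: "U \<in> ONS \<Longrightarrow> finite_group_ring p (H Mod U)"
  using prime_p finite_quotient normal.factorgroup_is_group[OF ONS_normal] by (simp add: finite_group_ring_def)

lemma ring_GR: "U \<in> ONS \<Longrightarrow> ring (GR U)"
  using finite_group_ring.ring_R[OF finite_group_ring_Mod] .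

abbreviation "refine U V \<equiv> push_forward (Fp p) (H Mod U) (H Mod V) (\<lambda>C. V <#> C)"

lemma carrier_A: "c \<in> carrier A \<longleftrightarrow> c \<in> (\<Pi>\<^sub>E U\<in>ONS. carrier (GR U)) \<and>
    (\<forall>U\<in>ONS. \<forall>V\<in>ONS. U \<subseteq> V \<longrightarrow> refine U V (c U) = c V)"
  by (simp add: completed_group_algebra_def Let_def)

lemma comp_closed: "c \<in> carrier A \<Longrightarrow> U \<in> ONS \<Longrightarrow> c U \<in> carrier (GR U)"
  unfolding carrier_A by (blast dest: PiE_mem)

lemma comp_refine: "c \<in> carrier A \<Longrightarrow> U \<in> ONS \<Longrightarrow> V \<in> ONS \<Longrightarrow> U \<subseteq> V \<Longrightarrow> refine U V (c U) = c V"
  unfolding carrier_A by blast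

lemma A_eqI:
  assumes "c \<in> carrier A" "d \<in> carrier A" "\<And>U. U \<in> ONS \<Longrightarrow> c U = d U"
  shows "c = d"
  using assms unfolding carrier_A by (auto intro: PiE_ext)

lemma A_ops:
  "c \<otimes>\<^bsub>A\<^esub> d = (\<lambda>U\<in>ONS. c U \<otimes>\<^bsub>GR U\<^esub> d U)" "\<one>\<^bsub>A\<^esub> = (\<lambda>U\<in>ONS. \<one>\<^bsub>GR U\<^esub>)"
  "c \<oplus>\<^bsub>A\<^esub> d = (\<lambda>U\<in>ONS. c U \<oplus>\<^bsub>GR U\<^esub> d U)" "\<zero>\<^bsub>A\<^esub> = (\<lambda>U\<in>ONS. \<zero>\<^bsub>GR U\<^esub>)"
  by (simp_all add: completed_group_algebra_def Let_def)

lemma coset_proj: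
  assumes "U \<in> ONS" "V \<in> ONS" "U \<subseteq> V" "x \<in> carrier H"
  shows "V <#> (U #> x) = V #> x"
proof -
  interpret h: group_hom H H "\<lambda>x. x"
    using is_group by (simp add: group_hom_def group_hom_axioms_def hom_def Pi_def)
  show ?thesis using h.coset_image[OF ONS_normal ONS_normal _ assms(4), of U V] assms by simp
qed

lemma proj_hom:
  assumes "U \<in> ONS" "V \<in> ONS" "U \<subseteq> V"
  shows "(\<lambda>C. V <#> C) \<in> hom (H Mod U) (H Mod V)"
proof (rule homI)
  fix C assume "C \<in> carrier (H Mod U)"
  then show "V <#> C \<in> carrier (H Mod V)" using coset_proj[OF assms] by (auto simp: carrier_FactGroup)
next
  fix C D assume "C \<in> carrier (H Mod U)" "D \<in> carrier (H Mod U)"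
  then obtain x y where xy: "x \<in> carrier H" "C = U #> x" "y \<in> carrier H" "D = U #> y"
    by (auto simp: carrier_FactGroup)
  then show "V <#> (C \<otimes>\<^bsub>H Mod U\<^esub> D) = (V <#> C) \<otimes>\<^bsub>H Mod V\<^esub> (V <#> D)"
    using coset_proj[OF assms] normal.rcos_sum[OF ONS_normal[OF assms(1)]] normal.rcos_sum[OF ONS_normal[OF assms(2)]]
    by simp
qed

lemma finite_group_ring_pair_Mod: "U \<in> ONS \<Longrightarrow> V \<in> ONS \<Longrightarrow> finite_group_ring_pair p (H Mod U) (H Mod V)"
  by (simp add: finite_group_ring_pair_def finite_group_ring_Mod)

lemma A_memI:
  assumes "\<And>U. U \<in> ONS \<Longrightarrow> f U \<in> carrier (GR U)"
    and "\<And>U V. U \<in> ONS \<Longrightarrow> V \<in> ONS \<Longrightarrow> U \<subseteq> V \<Longrightarrow> refine U V (f U) = f V"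
  shows "(\<lambda>U\<in>ONS. f U) \<in> carrier A"
  unfolding carrier_A using assms by auto

lemma A_mult_closed:
  assumes c: "c \<in> carrier A" and d: "d \<in> carrier A"
  shows "c \<otimes>\<^bsub>A\<^esub> d \<in> carrier A"
  unfolding A_ops
proof (rule A_memI)
  fix U assume U: "U \<in> ONS"
  interpret ring "GR U" using U by (rule ring_GR)
  show "c U \<otimes>\<^bsub>GR U\<^esub> d U \<in> carrier (GR U)" using comp_closed c d U by simp
  fix V assume V: "V \<in> ONS" "U \<subseteq> V"
  interpret finite_group_ring_pair p "H Mod U" "H Mod V" using U V(1) by (rule finite_group_ring_pair_Mod)
  show "refine U V (c U \<otimes>\<^bsub>GR U\<^esub> d U) = c V \<otimes>\<^bsub>GR V\<^esub> d V"
    using push_mult[OF comp_closed[OF c U] comp_closed[OF d U] proj_hom[OF U V]] comp_refine c d U V by simp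
qed

lemma A_add_closed:
  assumes c: "c \<in> carrier A" and d: "d \<in> carrier A"
  shows "c \<oplus>\<^bsub>A\<^esub> d \<in> carrier A"
  unfolding A_ops
proof (rule A_memI)
  fix U assume U: "U \<in> ONS"
  interpret ring "GR U" using U by (rule ring_GR)
  show "c U \<oplus>\<^bsub>GR U\<^esub> d U \<in> carrier (GR U)" using comp_closed c d U by simp
  fix V assume V: "V \<in> ONS" "U \<subseteq> V"
  interpret finite_group_ring_pair p "H Mod U" "H Mod V" using U V(1) by (rule finite_group_ring_pair_Mod)
  show "refine U V (c U \<oplus>\<^bsub>GR U\<^esub> d U) = c V \<oplus>\<^bsub>GR V\<^esub> d V"
    using push_add[OF comp_closed[OF c U] comp_closed[OF d U]] comp_refine c d U V by simp
qed

lemma A_zero_closed: "\<zero>\<^bsub>A\<^esub> \<in> carrier A"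
  unfolding A_ops
proof (rule A_memI)
  fix U assume U: "U \<in> ONS"
  interpret ring "GR U" using U by (rule ring_GR)
  show "\<zero>\<^bsub>GR U\<^esub> \<in> carrier (GR U)" by simp
  fix V assume V: "V \<in> ONS" "U \<subseteq> V"
  interpret finite_group_ring_pair p "H Mod U" "H Mod V" using U V(1) by (rule finite_group_ring_pair_Mod)
  show "refine U V \<zero>\<^bsub>GR U\<^esub> = \<zero>\<^bsub>GR V\<^esub>" by (rule push_zero)
qed

lemma cga_of_comp:
  assumes U: "U \<in> ONS"
  shows "cga_of p H T h U = finite_group_ring.red p (H Mod U) (finite_group_ring.delta (U #> h))"
proof -
  interpret finite_group_ring p "H Mod U" using U by (rule finite_group_ring_Mod)
  show ?thesis
    using U p_pos by (auto simp: cga_of_def red_def delta_def residue_ring_def fun_eq_iff)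
qed

lemma cga_of_closed:
  assumes h: "h \<in> carrier H"
  shows "cga_of p H T h \<in> carrier A"
proof -
  have "(\<lambda>U\<in>ONS. cga_of p H T h U) \<in> carrier A"
  proof (rule A_memI)
    fix U assume U: "U \<in> ONS"
    interpret U: finite_group_ring p "H Mod U" using U by (rule finite_group_ring_Mod)
    show "cga_of p H T h U \<in> carrier (GR U)" using U by (simp add: cga_of_comp)
    fix V assume V: "V \<in> ONS" "U \<subseteq> V"
    interpret finite_group_ring_pair p "H Mod U" "H Mod V" using U V(1) by (rule finite_group_ring_pair_Mod)
    have "U #> h \<in> carrier (H Mod U)" using h by (simp add: carrier_FactGroup)
    then show "refine U V (cga_of p H T h U) = cga_of p H T h V"
      using U V h push_delta by (simp add: cga_of_comp coset_proj)
  qed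
  moreover have "(\<lambda>U\<in>ONS. cga_of p H T h U) = cga_of p H T h"
    by (auto simp: cga_of_def restrict_def fun_eq_iff)
  ultimately show ?thesis by simp
qed

lemma A_one: "\<one>\<^bsub>A\<^esub> = cga_of p H T \<one>"
proof -
  have "\<one>\<^bsub>GR U\<^esub> = cga_of p H T \<one> U" if U: "U \<in> ONS" for U
  proof -
    interpret U: finite_group_ring p "H Mod U" using U by (rule finite_group_ring_Mod)
    have "U #> \<one> = U" using coset_mult_one subgroup.subset[OF normal_imp_subgroup[OF ONS_normal[OF U]]] by blast
    then show ?thesis by (simp add: cga_of_comp[OF U] U.one_R)
  qed
  then show ?thesis by (auto simp: A_ops cga_of_def fun_eq_iff restrict_def)
qed

lemma A_neg:
  assumes c: "c \<in> carrier A"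
  shows "(\<lambda>U\<in>ONS. \<ominus>\<^bsub>GR U\<^esub> c U) \<in> carrier A"
proof (rule A_memI)
  fix U assume U: "U \<in> ONS"
  interpret U: ring "GR U" using U by (rule ring_GR)
  show "\<ominus>\<^bsub>GR U\<^esub> c U \<in> carrier (GR U)" using comp_closed c U by simp
  fix V assume V: "V \<in> ONS" "U \<subseteq> V"
  interpret V: ring "GR V" using V(1) by (rule ring_GR)
  interpret finite_group_ring_pair p "H Mod U" "H Mod V" using U V(1) by (rule finite_group_ring_pair_Mod)
  have "refine U V (\<ominus>\<^bsub>GR U\<^esub> c U) \<oplus>\<^bsub>GR V\<^esub> c V = refine U V (\<ominus>\<^bsub>GR U\<^esub> c U \<oplus>\<^bsub>GR U\<^esub> c U)"
    using push_add[of "\<ominus>\<^bsub>GR U\<^esub> c U" "c U" "\<lambda>C. V <#> C"] comp_closed[OF c U] comp_refine[OF c U V] by simp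
  also have "\<dots> = \<zero>\<^bsub>GR V\<^esub>" using push_zero comp_closed[OF c U] by (simp add: U.l_neg)
  finally show "refine U V (\<ominus>\<^bsub>GR U\<^esub> c U) = \<ominus>\<^bsub>GR V\<^esub> c V"
    using V.minus_equality[of "refine U V (\<ominus>\<^bsub>GR U\<^esub> c U)" "c V"] comp_closed[OF c V(1)]
      push_closed[of "\<ominus>\<^bsub>GR U\<^esub> c U"] comp_closed[OF c U] by simp
qed

lemma ring_A: "ring A"
proof (rule ringI)
  show "abelian_group A"
  proof (rule abelian_groupI)
    fix c d e assume cd: "c \<in> carrier A" "d \<in> carrier A" "e \<in> carrier A"
    show "c \<oplus>\<^bsub>A\<^esub> d \<in> carrier A" using cd by (simp add: A_add_closed)
    have comm: "c U \<oplus>\<^bsub>GR U\<^esub> d U = d U \<oplus>\<^bsub>GR U\<^esub> c U"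
      and ass: "c U \<oplus>\<^bsub>GR U\<^esub> d U \<oplus>\<^bsub>GR U\<^esub> e U = c U \<oplus>\<^bsub>GR U\<^esub> (d U \<oplus>\<^bsub>GR U\<^esub> e U)"
      and zero: "\<zero>\<^bsub>GR U\<^esub> \<oplus>\<^bsub>GR U\<^esub> c U = c U"
      and neg: "\<ominus>\<^bsub>GR U\<^esub> c U \<oplus>\<^bsub>GR U\<^esub> c U = \<zero>\<^bsub>GR U\<^esub>" if U: "U \<in> ONS" for U
    proof -
      interpret ring "GR U" using U by (rule ring_GR)
      show "c U \<oplus>\<^bsub>GR U\<^esub> d U = d U \<oplus>\<^bsub>GR U\<^esub> c U"
        "c U \<oplus>\<^bsub>GR U\<^esub> d U \<oplus>\<^bsub>GR U\<^esub> e U = c U \<oplus>\<^bsub>GR U\<^esub> (d U \<oplus>\<^bsub>GR U\<^esub> e U)"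
        "\<zero>\<^bsub>GR U\<^esub> \<oplus>\<^bsub>GR U\<^esub> c U = c U" "\<ominus>\<^bsub>GR U\<^esub> c U \<oplus>\<^bsub>GR U\<^esub> c U = \<zero>\<^bsub>GR U\<^esub>"
        using comp_closed cd U by (simp_all add: a_ac l_neg r_neg)
    qed
    show "c \<oplus>\<^bsub>A\<^esub> d = d \<oplus>\<^bsub>A\<^esub> c" unfolding A_ops by (rule restrict_ext) (rule comm)
    show "c \<oplus>\<^bsub>A\<^esub> d \<oplus>\<^bsub>A\<^esub> e = c \<oplus>\<^bsub>A\<^esub> (d \<oplus>\<^bsub>A\<^esub> e)"
      unfolding A_ops by (rule restrict_ext) (simp add: ass)
    show "\<zero>\<^bsub>A\<^esub> \<oplus>\<^bsub>A\<^esub> c = c"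
    proof (rule A_eqI)
      show "\<zero>\<^bsub>A\<^esub> \<oplus>\<^bsub>A\<^esub> c \<in> carrier A" using cd by (simp add: A_add_closed A_zero_closed)
      show "(\<zero>\<^bsub>A\<^esub> \<oplus>\<^bsub>A\<^esub> c) U = c U" if "U \<in> ONS" for U using zero[OF that] that by (simp add: A_ops)
    qed (rule cd)
    have "(\<lambda>U\<in>ONS. \<ominus>\<^bsub>GR U\<^esub> c U) \<oplus>\<^bsub>A\<^esub> c = \<zero>\<^bsub>A\<^esub>"
      unfolding A_ops by (rule restrict_ext) (simp add: neg)
    then show "\<exists>d\<in>carrier A. d \<oplus>\<^bsub>A\<^esub> c = \<zero>\<^bsub>A\<^esub>" using A_neg[OF cd(1)] by blast
  qed (rule A_zero_closed)
  show "monoid A"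
  proof (rule monoidI)
    show one: "\<one>\<^bsub>A\<^esub> \<in> carrier A" using cga_of_closed by (simp add: A_one)
    fix c d e assume cd: "c \<in> carrier A" "d \<in> carrier A" "e \<in> carrier A"
    show "c \<otimes>\<^bsub>A\<^esub> d \<in> carrier A" using cd by (simp add: A_mult_closed)
    have ass: "c U \<otimes>\<^bsub>GR U\<^esub> d U \<otimes>\<^bsub>GR U\<^esub> e U = c U \<otimes>\<^bsub>GR U\<^esub> (d U \<otimes>\<^bsub>GR U\<^esub> e U)"
      and ones: "\<one>\<^bsub>GR U\<^esub> \<otimes>\<^bsub>GR U\<^esub> c U = c U" "c U \<otimes>\<^bsub>GR U\<^esub> \<one>\<^bsub>GR U\<^esub> = c U" if U: "U \<in> ONS" for U
    proof -
      interpret ring "GR U" using U by (rule ring_GR)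
      show "c U \<otimes>\<^bsub>GR U\<^esub> d U \<otimes>\<^bsub>GR U\<^esub> e U = c U \<otimes>\<^bsub>GR U\<^esub> (d U \<otimes>\<^bsub>GR U\<^esub> e U)"
        "\<one>\<^bsub>GR U\<^esub> \<otimes>\<^bsub>GR U\<^esub> c U = c U" "c U \<otimes>\<^bsub>GR U\<^esub> \<one>\<^bsub>GR U\<^esub> = c U"
        using comp_closed cd U by (simp_all add: m_assoc)
    qed
    show "c \<otimes>\<^bsub>A\<^esub> d \<otimes>\<^bsub>A\<^esub> e = c \<otimes>\<^bsub>A\<^esub> (d \<otimes>\<^bsub>A\<^esub> e)"
      unfolding A_ops by (rule restrict_ext) (simp add: ass)
    show "\<one>\<^bsub>A\<^esub> \<otimes>\<^bsub>A\<^esub> c = c"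
    proof (rule A_eqI)
      show "\<one>\<^bsub>A\<^esub> \<otimes>\<^bsub>A\<^esub> c \<in> carrier A" using cd one by (simp add: A_mult_closed)
      show "(\<one>\<^bsub>A\<^esub> \<otimes>\<^bsub>A\<^esub> c) U = c U" if "U \<in> ONS" for U using ones[OF that] that by (simp add: A_ops)
    qed (rule cd)
    show "c \<otimes>\<^bsub>A\<^esub> \<one>\<^bsub>A\<^esub> = c"
    proof (rule A_eqI)
      show "c \<otimes>\<^bsub>A\<^esub> \<one>\<^bsub>A\<^esub> \<in> carrier A" using cd one by (simp add: A_mult_closed)
      show "(c \<otimes>\<^bsub>A\<^esub> \<one>\<^bsub>A\<^esub>) U = c U" if "U \<in> ONS" for U using ones[OF that] that by (simp add: A_ops)
    qed (rule cd)
  qed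
  fix c d e assume cd: "c \<in> carrier A" "d \<in> carrier A" "e \<in> carrier A"
  have dist: "(c U \<oplus>\<^bsub>GR U\<^esub> d U) \<otimes>\<^bsub>GR U\<^esub> e U = c U \<otimes>\<^bsub>GR U\<^esub> e U \<oplus>\<^bsub>GR U\<^esub> d U \<otimes>\<^bsub>GR U\<^esub> e U"
    "e U \<otimes>\<^bsub>GR U\<^esub> (c U \<oplus>\<^bsub>GR U\<^esub> d U) = e U \<otimes>\<^bsub>GR U\<^esub> c U \<oplus>\<^bsub>GR U\<^esub> e U \<otimes>\<^bsub>GR U\<^esub> d U" if U: "U \<in> ONS" for U
  proof -
    interpret ring "GR U" using U by (rule ring_GR)
    show "(c U \<oplus>\<^bsub>GR U\<^esub> d U) \<otimes>\<^bsub>GR U\<^esub> e U = c U \<otimes>\<^bsub>GR U\<^esub> e U \<oplus>\<^bsub>GR U\<^esub> d U \<otimes>\<^bsub>GR U\<^esub> e U"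
      "e U \<otimes>\<^bsub>GR U\<^esub> (c U \<oplus>\<^bsub>GR U\<^esub> d U) = e U \<otimes>\<^bsub>GR U\<^esub> c U \<oplus>\<^bsub>GR U\<^esub> e U \<otimes>\<^bsub>GR U\<^esub> d U"
      using comp_closed cd U by (simp_all add: l_distr r_distr)
  qed
  show "(c \<oplus>\<^bsub>A\<^esub> d) \<otimes>\<^bsub>A\<^esub> e = c \<otimes>\<^bsub>A\<^esub> e \<oplus>\<^bsub>A\<^esub> d \<otimes>\<^bsub>A\<^esub> e"
    "e \<otimes>\<^bsub>A\<^esub> (c \<oplus>\<^bsub>A\<^esub> d) = e \<otimes>\<^bsub>A\<^esub> c \<oplus>\<^bsub>A\<^esub> e \<otimes>\<^bsub>A\<^esub> d"
    unfolding A_ops by (rule restrict_ext; simp add: dist)+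
qed

sublocale A: ring A by (rule ring_A)

lemma neg_A:
  assumes "c \<in> carrier A"
  shows "\<ominus>\<^bsub>A\<^esub> c = (\<lambda>U\<in>ONS. \<ominus>\<^bsub>GR U\<^esub> c U)"
proof (rule A.minus_equality)
  have "\<ominus>\<^bsub>GR U\<^esub> c U \<oplus>\<^bsub>GR U\<^esub> c U = \<zero>\<^bsub>GR U\<^esub>" if U: "U \<in> ONS" for U
  proof -
    interpret ring "GR U" using U by (rule ring_GR)
    show ?thesis using comp_closed[OF assms U] by (simp add: l_neg)
  qed
  then show "(\<lambda>U\<in>ONS. \<ominus>\<^bsub>GR U\<^esub> c U) \<oplus>\<^bsub>A\<^esub> c = \<zero>\<^bsub>A\<^esub>"
    unfolding A_ops by (intro restrict_ext) simp
qed (use assms A_neg in auto)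

lemma cga_of_mult:
  assumes "g \<in> carrier H" "h \<in> carrier H"
  shows "cga_of p H T (g \<otimes> h) = cga_of p H T g \<otimes>\<^bsub>A\<^esub> cga_of p H T h"
proof (rule A_eqI)
  fix U assume U: "U \<in> ONS"
  interpret U: finite_group_ring p "H Mod U" using U by (rule finite_group_ring_Mod)
  interpret N: normal U H using U by (rule ONS_normal)
  have c: "U #> g \<in> carrier (H Mod U)" "U #> h \<in> carrier (H Mod U)" using assms by (auto simp: carrier_FactGroup)
  have "U.red (U.delta (U #> g)) \<otimes>\<^bsub>GR U\<^esub> U.red (U.delta (U #> h)) = U.red (U.delta (U #> (g \<otimes> h)))"
    unfolding U.mult_red
  proof (rule U.red_cong)
    fix x assume x: "x \<in> carrier (H Mod U)"
    have "inv\<^bsub>H Mod U\<^esub> (U #> g) \<otimes>\<^bsub>H Mod U\<^esub> x = U #> h \<longleftrightarrow> x = (U #> g) \<otimes>\<^bsub>H Mod U\<^esub> (U #> h)"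
      using c x by (metis U.K.inv_closed U.K.inv_solve_left)
    also have "(U #> g) \<otimes>\<^bsub>H Mod U\<^esub> (U #> h) = U #> (g \<otimes> h)"
      using assms N.rcos_sum by simp
    finally have "inv\<^bsub>H Mod U\<^esub> (U #> g) \<otimes>\<^bsub>H Mod U\<^esub> x = U #> h \<longleftrightarrow> x = U #> (g \<otimes> h)" .
    then show "U.conv (U.delta (U #> g)) (U.delta (U #> h)) x mod int p = U.delta (U #> (g \<otimes> h)) x mod int p"
      unfolding U.conv_delta_left[OF c(1)] by (simp add: U.delta_def)
  qed
  then show "cga_of p H T (g \<otimes> h) U = (cga_of p H T g \<otimes>\<^bsub>A\<^esub> cga_of p H T h) U"
    using U by (simp add: A_ops cga_of_comp)
qed (use assms cga_of_closed in auto)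

end

section \<open>Topology of the completed group algebra and closed powers of its augmentation
  ideal\<close>

context pro_p
begin

abbreviation "CT \<equiv> cga_topology p H T"

lemma topspace_CT: "topspace CT = carrier A"
  unfolding cga_topology_def by (auto simp: carrier_A)

lemma continuous_into_CT:
  assumes "\<And>y. y \<in> topspace Y \<Longrightarrow> f y \<in> carrier A"
    and "\<And>U. U \<in> ONS \<Longrightarrow> continuous_map Y (discrete_topology (carrier (GR U))) (\<lambda>y. f y U)"
  shows "continuous_map Y CT f"
  unfolding cga_topology_def
proof (rule continuous_map_into_subtopology)
  show "f \<in> topspace Y \<rightarrow> carrier A" using assms(1) by blast
  have "f ` topspace Y \<subseteq> extensional ONS" using assms(1) by (auto simp: carrier_A PiE_def)
  then show "continuous_map Y (product_topology (\<lambda>U. discrete_topology (carrier (GR U))) ONS) f"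
    using assms(2) by (auto simp: continuous_map_componentwise)
qed

lemma continuous_comp:
  assumes "U \<in> ONS"
  shows "continuous_map CT (discrete_topology (carrier (GR U))) (\<lambda>c. c U)"
  unfolding cga_topology_def
  by (intro continuous_map_from_subtopology continuous_map_product_projection assms)

lemma clopen_comp:
  assumes "U \<in> ONS"
  shows "openin CT {c \<in> carrier A. c U \<in> S}" "closedin CT {c \<in> carrier A. c U \<in> S}"
proof -
  have "{c \<in> carrier A. c U \<in> S} = {c \<in> topspace CT. c U \<in> S \<inter> carrier (GR U)}"
    using comp_closed[OF _ assms] by (auto simp: topspace_CT)
  then show "openin CT {c \<in> carrier A. c U \<in> S}" "closedin CT {c \<in> carrier A. c U \<in> S}"
    using openin_continuous_map_preimage[OF continuous_comp[OF assms], of "S \<inter> carrier (GR U)"]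
      closedin_continuous_map_preimage[OF continuous_comp[OF assms], of "S \<inter> carrier (GR U)"] by simp_all
qed

text \<open>The algebra is the closed subset of compatible families in a product of finite discrete
  spaces. Each compatibility condition involves two coordinates, and is a finite union, over the
  values of the finer one, of conditions on single coordinates.\<close>

lemma compact_CT: "compact_space CT"
proof -
  let ?P = "product_topology (\<lambda>U. discrete_topology (carrier (GR U))) ONS"
  have comp: "compact_space ?P"
    by (simp add: compact_space_product_topology compact_space_discrete_topology
        finite_group_ring.finite_R[OF finite_group_ring_Mod])
  have cl: "closedin ?P {c \<in> topspace ?P. c U \<in> S}" if U: "U \<in> ONS" for U S
  proof -
    have "closedin ?P {c \<in> topspace ?P. c U \<in> S \<inter> carrier (GR U)}"
      by (rule closedin_continuous_map_preimage[OF continuous_map_product_projection[OF U]]) simp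
    moreover have "{c \<in> topspace ?P. c U \<in> S \<inter> carrier (GR U)} = {c \<in> topspace ?P. c U \<in> S}"
      using U by (auto dest: PiE_mem)
    ultimately show ?thesis by simp
  qed
  let ?E = "\<lambda>U V. {c \<in> topspace ?P. U \<subseteq> V \<longrightarrow> refine U V (c U) = c V}"
  have E: "closedin ?P (?E U V)" if U: "U \<in> ONS" and V: "V \<in> ONS" for U V
  proof (cases "U \<subseteq> V")
    case True
    have "?E U V = (\<Union>x\<in>carrier (GR U). {c \<in> topspace ?P. c U \<in> {x}} \<inter> {c \<in> topspace ?P. c V \<in> {refine U V x}})"
      using True U by (auto dest: PiE_mem)
    moreover have "closedin ?P \<dots>"
    proof (rule closedin_Union)
      fix S assume "S \<in> (\<lambda>x. {c \<in> topspace ?P. c U \<in> {x}} \<inter> {c \<in> topspace ?P. c V \<in> {refine U V x}}) ` carrier (GR U)"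
      then obtain x where S: "S = {c \<in> topspace ?P. c U \<in> {x}} \<inter> {c \<in> topspace ?P. c V \<in> {refine U V x}}"
        by (rule imageE)
      show "closedin ?P S" unfolding S by (rule closedin_Int[OF cl[OF U] cl[OF V]])
    qed (use finite_group_ring.finite_R[OF finite_group_ring_Mod[OF U]] in simp)
    ultimately show ?thesis by simp
  next
    case False
    then show ?thesis using closedin_topspace[of ?P] by (simp del: topspace_product_topology)
  qed
  have eq: "carrier A = topspace ?P \<inter> (\<Inter>U\<in>ONS. \<Inter>V\<in>ONS. ?E U V)"
    by (auto simp: carrier_A)
  have ne: "ONS \<noteq> {}" using ONS_carrier by blast
  have "closedin ?P (carrier A)"
    unfolding eq using ne by (intro closedin_Int closedin_topspace closedin_INT E)
  then show ?thesis
    unfolding cga_topology_def using closedin_compact_space[OF comp] by (simp add: compact_space_subtopology)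
qed

lemma Hausdorff_CT: "Hausdorff_space CT"
  unfolding cga_topology_def by (intro Hausdorff_space_subtopology) (simp add: Hausdorff_space_product_topology)

lemma continuous_discrete_comp:
  assumes "continuous_map Y (discrete_topology S) f" "\<And>x. x \<in> S \<Longrightarrow> g x \<in> S'"
  shows "continuous_map Y (discrete_topology S') (\<lambda>y. g (f y))"
proof -
  have "continuous_map (discrete_topology S) (discrete_topology S') g"
    using assms(2) by auto
  from continuous_map_compose[OF assms(1) this] show ?thesis by (simp add: comp_def)
qed

lemma topological_group_A: "topological_group_on (add_monoid A) CT"
  unfolding topological_group_on_def
proof (intro conjI)
  show "group (add_monoid A)" by (rule A.add.group_axioms)
  show "topspace CT = carrier (add_monoid A)" by (simp add: topspace_CT)
  have "continuous_map (prod_topology CT CT) CT (\<lambda>z. fst z \<oplus>\<^bsub>A\<^esub> snd z)"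
  proof (rule continuous_into_CT)
    show "fst z \<oplus>\<^bsub>A\<^esub> snd z \<in> carrier A" if "z \<in> topspace (prod_topology CT CT)" for z
      using that by (auto simp: topspace_CT)
    fix U assume U: "U \<in> ONS"
    interpret R: ring "GR U" using U by (rule ring_GR)
    have "continuous_map (prod_topology CT CT) (discrete_topology (carrier (GR U))) (\<lambda>z. fst z U)"
      using continuous_map_compose[OF continuous_map_fst continuous_comp[OF U], of CT] by (simp add: comp_def)
    moreover have "continuous_map (prod_topology CT CT) (discrete_topology (carrier (GR U))) (\<lambda>z. snd z U)"
      using continuous_map_compose[OF continuous_map_snd continuous_comp[OF U], of CT] by (simp add: comp_def)
    ultimately have "continuous_map (prod_topology CT CT) (discrete_topology (carrier (GR U) \<times> carrier (GR U)))
        (\<lambda>z. (fst z U, snd z U))"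
      by (simp add: prod_topology_discrete_topology continuous_map_pairwise comp_def)
    then have "continuous_map (prod_topology CT CT) (discrete_topology (carrier (GR U)))
        (\<lambda>z. (\<lambda>(a, b). a \<oplus>\<^bsub>GR U\<^esub> b) (fst z U, snd z U))"
      by (rule continuous_discrete_comp) auto
    then show "continuous_map (prod_topology CT CT) (discrete_topology (carrier (GR U))) (\<lambda>z. (fst z \<oplus>\<^bsub>A\<^esub> snd z) U)"
      using U by (simp add: A_ops)
  qed
  then show "continuous_map (prod_topology CT CT) CT (\<lambda>(x, y). x \<otimes>\<^bsub>add_monoid A\<^esub> y)"
    by (simp add: case_prod_unfold)
  show "continuous_map CT CT (\<lambda>x. inv\<^bsub>add_monoid A\<^esub> x)"
    unfolding a_inv_def[of A, symmetric]
  proof (rule continuous_into_CT)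
    show "\<ominus>\<^bsub>A\<^esub> y \<in> carrier A" if "y \<in> topspace CT" for y using that by (simp add: topspace_CT)
    fix U assume U: "U \<in> ONS"
    interpret R: ring "GR U" using U by (rule ring_GR)
    have "continuous_map CT (discrete_topology (carrier (GR U))) (\<lambda>c. \<ominus>\<^bsub>GR U\<^esub> c U)"
      by (rule continuous_discrete_comp[OF continuous_comp[OF U]]) simp
    then show "continuous_map CT (discrete_topology (carrier (GR U))) (\<lambda>c. (\<ominus>\<^bsub>A\<^esub> c) U)"
      by (rule continuous_map_eq) (use U in \<open>simp add: topspace_CT neg_A\<close>)
  qed
qed

lemma ONS_Inter:
  assumes "finite \<F>" "\<F> \<subseteq> ONS"
  obtains U where "U \<in> ONS" "\<And>V. V \<in> \<F> \<Longrightarrow> U \<subseteq> V"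
  using assms
proof (induction \<F> arbitrary: thesis)
  case empty
  then show ?case using ONS_carrier by blast
next
  case (insert V \<F>)
  obtain U where U: "U \<in> ONS" "\<And>V. V \<in> \<F> \<Longrightarrow> U \<subseteq> V" using insert.IH insert.prems(2) by blast
  show ?case by (rule insert.prems(1)[of "U \<inter> V"]) (use U insert.prems(2) ONS_Int in auto)
qed

text \<open>A basic neighbourhood constrains finitely many coordinates, and an open normal subgroup
  contained in all of their indices determines them by compatibility. So approximating one
  coordinate at a time is enough.\<close>

lemma closure_of_CT:
  assumes S: "S \<subseteq> carrier A"
  shows "(closure_of) CT S = {c \<in> carrier A. \<forall>U\<in>ONS. \<exists>a\<in>S. a U = c U}"
proof (intro equalityI subsetI)
  fix c assume c: "c \<in> (closure_of) CT S"
  then have cA: "c \<in> carrier A" by (simp add: in_closure_of topspace_CT)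
  have "\<exists>a\<in>S. a U = c U" if U: "U \<in> ONS" for U
  proof -
    have "c \<in> {d \<in> carrier A. d U \<in> {c U}}" using cA by simp
    then have "\<exists>a. a \<in> S \<and> a \<in> {d \<in> carrier A. d U \<in> {c U}}"
      using c[unfolded in_closure_of, THEN conjunct2, rule_format, OF conjI[OF _ clopen_comp(1)[OF U, of "{c U}"]]]
      by simp
    then show ?thesis by auto
  qed
  then show "c \<in> {c \<in> carrier A. \<forall>U\<in>ONS. \<exists>a\<in>S. a U = c U}" using cA by blast
next
  fix c assume "c \<in> {c \<in> carrier A. \<forall>U\<in>ONS. \<exists>a\<in>S. a U = c U}"
  then have c: "c \<in> carrier A" "\<And>U. U \<in> ONS \<Longrightarrow> \<exists>a\<in>S. a U = c U" by auto
  have "\<exists>a\<in>S. a \<in> W" if W: "c \<in> W" "openin CT W" for W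
  proof -
    obtain W' where W': "openin (product_topology (\<lambda>U. discrete_topology (carrier (GR U))) ONS) W'"
      "W = W' \<inter> carrier A" using W(2) unfolding cga_topology_def openin_subtopology by blast
    have "c \<in> W'" using W(1) W'(2) by blast
    then obtain B where B: "finite {U \<in> ONS. B U \<noteq> topspace (discrete_topology (carrier (GR U)))}"
      "c \<in> Pi\<^sub>E ONS B" "Pi\<^sub>E ONS B \<subseteq> W'"
      using W'(1)[unfolded openin_product_topology_alt, rule_format, OF \<open>c \<in> W'\<close>] by blast
    have fin: "finite {V \<in> ONS. B V \<noteq> carrier (GR V)}" using B(1) by simp
    obtain U where U: "U \<in> ONS" "\<And>V. V \<in> {V \<in> ONS. B V \<noteq> carrier (GR V)} \<Longrightarrow> U \<subseteq> V"
      using ONS_Inter[OF fin Collect_restrict] by blast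
    obtain a where a: "a \<in> S" "a U = c U" using c(2)[OF U(1)] by blast
    have aA: "a \<in> carrier A" using a S by blast
    have "a V \<in> B V" if V: "V \<in> ONS" for V
    proof (cases "B V = carrier (GR V)")
      case True
      then show ?thesis using comp_closed[OF aA V] by simp
    next
      case False
      then have UV: "U \<subseteq> V" using U(2) V by blast
      have "a V = c V" using comp_refine[OF aA U(1) V UV] comp_refine[OF c(1) U(1) V UV] a(2) by simp
      then show ?thesis using B(2) V by auto
    qed
    then have "a \<in> Pi\<^sub>E ONS B" using aA by (auto simp: carrier_A PiE_def)
    then show ?thesis using a(1) aA B(3) W'(2) by blast
  qed
  then show "c \<in> (closure_of) CT S" using c(1) unfolding in_closure_of topspace_CT by blast
qed

abbreviation "AI \<equiv> augmentation_ideal p H T"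
abbreviation "AP \<equiv> augmentation_power p H T"

lemma AI_iff: "c \<in> AI \<longleftrightarrow> c \<in> carrier A \<and> (\<forall>U\<in>ONS. c U \<in> finite_group_ring.aug p (H Mod U))"
proof -
  have "(finsum (Fp p) (c U) (carrier (H Mod U)) = \<zero>\<^bsub>Fp p\<^esub>) = (c U \<in> finite_group_ring.aug p (H Mod U))"
    if c: "c \<in> carrier A" and U: "U \<in> ONS" for U
  proof -
    interpret U: finite_group_ring p "H Mod U" using U by (rule finite_group_ring_Mod)
    have "finsum (Fp p) (c U) (carrier (H Mod U)) = (\<Sum>C\<in>carrier (H Mod U). c U C) mod int p"
      using comp_closed[OF c U] by (intro finsum_Fp[OF prime_p U.finite_K]) (auto simp: U.carrier_R PiE_iff)
    then show ?thesis using comp_closed[OF c U] by (simp add: U.aug_def residue_ring_def)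
  qed
  then show ?thesis unfolding augmentation_ideal_def by blast
qed

lemma subgroup_componentwise:
  assumes "\<And>U. U \<in> ONS \<Longrightarrow> subgroup (J U) (add_monoid (GR U))"
  shows "subgroup {c \<in> carrier A. \<forall>U\<in>ONS. c U \<in> J U} (add_monoid A)"
proof (rule group.subgroupI[OF A.add.group_axioms])
  let ?J = "{c \<in> carrier A. \<forall>U\<in>ONS. c U \<in> J U}"
  show "?J \<subseteq> carrier (add_monoid A)" by auto
  have "\<zero>\<^bsub>A\<^esub> \<in> ?J" using subgroup.one_closed[OF assms] by (simp add: A_ops(4) A_zero_closed[unfolded A_ops(4)])
  then show "?J \<noteq> {}" by blast
  fix c assume c: "c \<in> ?J"
  have "\<ominus>\<^bsub>GR U\<^esub> c U \<in> J U" if U: "U \<in> ONS" for U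
    using subgroup.m_inv_closed[OF assms[OF U], of "c U"] c U unfolding a_inv_def by simp
  then have "\<ominus>\<^bsub>A\<^esub> c \<in> ?J" using c A.a_inv_closed[of c] by (simp add: neg_A)
  then show "inv\<^bsub>add_monoid A\<^esub> c \<in> ?J" unfolding a_inv_def .
  fix d assume d: "d \<in> ?J"
  have "c U \<oplus>\<^bsub>GR U\<^esub> d U \<in> J U" if U: "U \<in> ONS" for U
    using subgroup.m_closed[OF assms[OF U], of "c U" "d U"] c d U by simp
  then show "c \<otimes>\<^bsub>add_monoid A\<^esub> d \<in> ?J" using c d A_add_closed[of c d] by (simp add: A_ops(3))
qed

lemma ideal_AI: "ideal AI A"
proof (rule idealI)
  note ia = finite_group_ring.ideal_aug[OF finite_group_ring_Mod]
  have eq: "AI = {c \<in> carrier A. \<forall>U\<in>ONS. c U \<in> finite_group_ring.aug p (H Mod U)}"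
    using AI_iff by blast
  show "subgroup AI (add_monoid A)"
    unfolding eq by (rule subgroup_componentwise) (rule additive_subgroup.a_subgroup[OF ideal.axioms(1)[OF ia]])
  fix c d assume c: "c \<in> AI" and d: "d \<in> carrier A"
  have cA: "c \<in> carrier A" using c AI_iff by blast
  have m: "d U \<otimes>\<^bsub>GR U\<^esub> c U \<in> finite_group_ring.aug p (H Mod U)" "c U \<otimes>\<^bsub>GR U\<^esub> d U \<in> finite_group_ring.aug p (H Mod U)"
    if U: "U \<in> ONS" for U
  proof -
    have cU: "c U \<in> finite_group_ring.aug p (H Mod U)" using c U unfolding AI_iff by blast
    show "d U \<otimes>\<^bsub>GR U\<^esub> c U \<in> finite_group_ring.aug p (H Mod U)" "c U \<otimes>\<^bsub>GR U\<^esub> d U \<in> finite_group_ring.aug p (H Mod U)"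
      using ideal.I_l_closed[OF ia[OF U] cU] ideal.I_r_closed[OF ia[OF U] cU] comp_closed[OF d U] by blast+
  qed
  show "d \<otimes>\<^bsub>A\<^esub> c \<in> AI" "c \<otimes>\<^bsub>A\<^esub> d \<in> AI"
    using m A_mult_closed[OF cA d] A_mult_closed[OF d cA] unfolding AI_iff by (simp_all add: A_ops(1))
qed (rule ring_A)

lemma ideal_AP: "ideal (AP n) A"
proof (induction n)
  case 0
  show ?case by (simp add: A.oneideal)
next
  case (Suc n)
  then show ?case by (simp add: A.ideal_prod_is_ideal ideal_AI)
qed

lemma AP_carrier: "AP n \<subseteq> carrier A"
  using ideal.Icarr[OF ideal_AP] by blast

lemma AP_Suc: "AP (Suc n) \<subseteq> AP n"
  using A.ideal_prod_inter[OF ideal_AP[of n] ideal_AI] by auto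

lemma AP_comp:
  assumes U: "U \<in> ONS"
  shows "a \<in> AP n \<Longrightarrow> a U \<in> finite_group_ring.aug_power p (H Mod U) n"
proof -
  interpret U: finite_group_ring p "H Mod U" using U by (rule finite_group_ring_Mod)
  show "a \<in> AP n \<Longrightarrow> a U \<in> U.aug_power n"
  proof (induction n arbitrary: a)
    case 0
    then show ?case using comp_closed[OF _ U] by simp
  next
    case (Suc n)
    have "a \<in> ideal_prod A (AP n) AI" using Suc.prems by simp
    then show ?case
    proof (induction rule: ideal_prod.induct)
      case (prod i j)
      then have "i U \<otimes>\<^bsub>GR U\<^esub> j U \<in> ideal_prod (GR U) (U.aug_power n) U.aug"
        using Suc.IH AI_iff U by (intro ideal_prod.prod) blast+
      then show ?case using U by (simp add: A_ops)
    next
      case (sum s t)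
      then have "s U \<oplus>\<^bsub>GR U\<^esub> t U \<in> ideal_prod (GR U) (U.aug_power n) U.aug"
        by (intro ideal_prod.sum) simp_all
      then show ?case using U by (simp add: A_ops)
    qed
  qed
qed

abbreviation "Del \<equiv> Delta p H T"

lemma Delta_iff: "c \<in> Del n \<longleftrightarrow> c \<in> carrier A \<and> (\<forall>U\<in>ONS. \<exists>a\<in>AP n. a U = c U)"
  unfolding Delta_def closure_of_CT[OF AP_carrier] by simp

lemma Delta_carrier: "c \<in> Del n \<Longrightarrow> c \<in> carrier A"
  by (simp add: Delta_iff)

lemma closedin_Delta: "closedin CT (Del n)"
  by (simp add: Delta_def)

lemma Delta_0: "Del 0 = carrier A"
  using Delta_iff[of _ 0] by auto

lemma Delta_Suc: "Del (Suc n) \<subseteq> Del n"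
  unfolding Delta_def using AP_Suc by (intro closure_of_mono)

text \<open>All operations are componentwise. Hence, at each U, combining elements of the algebraic
  power that agree with the operands there gives an element that agrees with the result.\<close>

lemma ideal_Delta: "ideal (Del n) A"
proof (rule idealI)
  interpret I: ideal "AP n" A by (rule ideal_AP)
  show "subgroup (Del n) (add_monoid A)"
  proof (rule group.subgroupI[OF A.add.group_axioms])
    show "Del n \<subseteq> carrier (add_monoid A)" using Delta_carrier by auto
    have "\<zero>\<^bsub>A\<^esub> \<in> Del n" unfolding Delta_iff using I.zero_closed A.zero_closed by blast
    then show "Del n \<noteq> {}" by blast
    fix c assume c: "c \<in> Del n"
    have "\<ominus>\<^bsub>A\<^esub> c \<in> Del n"
      unfolding Delta_iff
    proof (intro conjI ballI)
      show "\<ominus>\<^bsub>A\<^esub> c \<in> carrier A" using Delta_carrier[OF c] by simp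
      fix U assume U: "U \<in> ONS"
      obtain a where a: "a \<in> AP n" "a U = c U" using c U unfolding Delta_iff by blast
      have "(\<ominus>\<^bsub>A\<^esub> a) U = (\<ominus>\<^bsub>A\<^esub> c) U" using a U AP_carrier Delta_carrier[OF c] by (simp add: neg_A subset_iff)
      then show "\<exists>a\<in>AP n. a U = (\<ominus>\<^bsub>A\<^esub> c) U" using I.a_inv_closed[OF a(1)] by blast
    qed
    then show "inv\<^bsub>add_monoid A\<^esub> c \<in> Del n" unfolding a_inv_def .
    fix d assume d: "d \<in> Del n"
    have "c \<oplus>\<^bsub>A\<^esub> d \<in> Del n"
      unfolding Delta_iff
    proof (intro conjI ballI)
      show "c \<oplus>\<^bsub>A\<^esub> d \<in> carrier A" using Delta_carrier[OF c] Delta_carrier[OF d] by simp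
      fix U assume U: "U \<in> ONS"
      obtain a b where a: "a \<in> AP n" "a U = c U" and b: "b \<in> AP n" "b U = d U"
        using c d U unfolding Delta_iff by blast
      have "(a \<oplus>\<^bsub>A\<^esub> b) U = (c \<oplus>\<^bsub>A\<^esub> d) U" using a b U by (simp add: A_ops)
      then show "\<exists>a\<in>AP n. a U = (c \<oplus>\<^bsub>A\<^esub> d) U" using I.a_closed[OF a(1) b(1)] by blast
    qed
    then show "c \<otimes>\<^bsub>add_monoid A\<^esub> d \<in> Del n" by simp
  qed
  fix c d assume c: "c \<in> Del n" and d: "d \<in> carrier A"
  show "d \<otimes>\<^bsub>A\<^esub> c \<in> Del n"
    unfolding Delta_iff
  proof (intro conjI ballI)
    show "d \<otimes>\<^bsub>A\<^esub> c \<in> carrier A" using Delta_carrier[OF c] d by simp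
    fix U assume U: "U \<in> ONS"
    obtain a where a: "a \<in> AP n" "a U = c U" using c U unfolding Delta_iff by blast
    have "(d \<otimes>\<^bsub>A\<^esub> a) U = (d \<otimes>\<^bsub>A\<^esub> c) U" using a U by (simp add: A_ops)
    then show "\<exists>a\<in>AP n. a U = (d \<otimes>\<^bsub>A\<^esub> c) U" using I.I_l_closed[OF a(1) d] by blast
  qed
  show "c \<otimes>\<^bsub>A\<^esub> d \<in> Del n"
    unfolding Delta_iff
  proof (intro conjI ballI)
    show "c \<otimes>\<^bsub>A\<^esub> d \<in> carrier A" using Delta_carrier[OF c] d by simp
    fix U assume U: "U \<in> ONS"
    obtain a where a: "a \<in> AP n" "a U = c U" using c U unfolding Delta_iff by blast
    have "(a \<otimes>\<^bsub>A\<^esub> d) U = (c \<otimes>\<^bsub>A\<^esub> d) U" using a U by (simp add: A_ops)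
    then show "\<exists>a\<in>AP n. a U = (c \<otimes>\<^bsub>A\<^esub> d) U" using I.I_r_closed[OF a(1) d] by blast
  qed
qed (rule ring_A)

text \<open>The exponent depends on the component: at U an element of the N-th closed power agrees
  with one of the algebraic power, and it vanishes once N reaches the nilpotency index of the finite
  group ring over \<open>H Mod U\<close>.\<close>

lemma Delta_Inter:
  assumes c: "\<And>n. c \<in> Del n"
  shows "c = \<zero>\<^bsub>A\<^esub>"
proof (rule A_eqI)
  show "c \<in> carrier A" using c Delta_carrier by blast
  fix U assume U: "U \<in> ONS"
  interpret U: finite_group_ring p "H Mod U" using U by (rule finite_group_ring_Mod)
  obtain k where "order (H Mod U) = p ^ k" using ONS_index[OF U] by (auto simp: order_def)
  then obtain N where N: "U.aug_power N \<subseteq> {\<zero>\<^bsub>GR U\<^esub>}" by (rule U.aug_nilpotent)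
  obtain a where "a \<in> AP N" "a U = c U" using c[of N] U unfolding Delta_iff by blast
  then have "c U = \<zero>\<^bsub>GR U\<^esub>" using AP_comp[OF U, of a N] N by auto
  then show "c U = \<zero>\<^bsub>A\<^esub> U" using U by (simp add: A_ops)
qed (rule A.zero_closed)

end

context pro_p
begin

subsection \<open>The dimension subgroups\<close>

abbreviation "gel \<equiv> cga_of p H T"

lemma MM_iff: "h \<in> MM p H T n \<longleftrightarrow> h \<in> carrier H \<and> gel h \<ominus>\<^bsub>A\<^esub> \<one>\<^bsub>A\<^esub> \<in> Del n"
  by (simp add: MM_def)

lemma gel_closed [simp]: "h \<in> carrier H \<Longrightarrow> gel h \<in> carrier A"
  by (rule cga_of_closed)

text \<open>The closure properties come from the identities
  \<open>g^-1 (g - 1) = -(g^-1 - 1)\<close>, \<open>g h - 1 = g (h - 1) + (g - 1)\<close> and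
  \<open>x h x^-1 - 1 = x (h - 1) x^-1\<close>, together with the ideal property of the closed
  powers.\<close>

lemma normal_MM: "MM p H T n \<lhd> H"
proof -
  interpret I: ideal "Del n" A by (rule ideal_Delta)
  have "subgroup (MM p H T n) H"
  proof (rule subgroupI)
    show "MM p H T n \<subseteq> carrier H" by (auto simp: MM_iff)
    have "gel \<one> \<ominus>\<^bsub>A\<^esub> \<one>\<^bsub>A\<^esub> = \<zero>\<^bsub>A\<^esub>" by (simp add: A_one[symmetric] A.r_neg a_minus_def)
    then have "gel \<one> \<ominus>\<^bsub>A\<^esub> \<one>\<^bsub>A\<^esub> \<in> Del n" by (simp only: I.zero_closed)
    then have "\<one> \<in> MM p H T n" by (simp only: MM_iff one_closed)
    then show "MM p H T n \<noteq> {}" by blast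
    fix g assume g: "g \<in> MM p H T n"
    then have gc: "g \<in> carrier H" by (simp add: MM_iff)
    have "gel (inv g) \<otimes>\<^bsub>A\<^esub> (gel g \<ominus>\<^bsub>A\<^esub> \<one>\<^bsub>A\<^esub>) = \<ominus>\<^bsub>A\<^esub> (gel (inv g) \<ominus>\<^bsub>A\<^esub> \<one>\<^bsub>A\<^esub>)"
    proof -
      have "gel (inv g) \<otimes>\<^bsub>A\<^esub> gel g = \<one>\<^bsub>A\<^esub>" using gc cga_of_mult[of "inv g" g] by (simp add: A_one)
      then show ?thesis using gc by (simp add: a_minus_def A.r_distr A.r_minus A.minus_add A.a_comm)
    qed
    moreover have "gel (inv g) \<otimes>\<^bsub>A\<^esub> (gel g \<ominus>\<^bsub>A\<^esub> \<one>\<^bsub>A\<^esub>) \<in> Del n"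
      using g gc by (intro I.I_l_closed) (simp_all add: MM_iff)
    ultimately have "\<ominus>\<^bsub>A\<^esub> (\<ominus>\<^bsub>A\<^esub> (gel (inv g) \<ominus>\<^bsub>A\<^esub> \<one>\<^bsub>A\<^esub>)) \<in> Del n" by (metis I.a_inv_closed)
    then show "inv g \<in> MM p H T n" using gc by (simp add: MM_iff)
    fix h assume h: "h \<in> MM p H T n"
    then have hc: "h \<in> carrier H" by (simp add: MM_iff)
    have "gel (g \<otimes> h) \<ominus>\<^bsub>A\<^esub> \<one>\<^bsub>A\<^esub> = gel g \<otimes>\<^bsub>A\<^esub> (gel h \<ominus>\<^bsub>A\<^esub> \<one>\<^bsub>A\<^esub>) \<oplus>\<^bsub>A\<^esub> (gel g \<ominus>\<^bsub>A\<^esub> \<one>\<^bsub>A\<^esub>)"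
      using gc hc by (simp add: cga_of_mult a_minus_def A.r_distr A.r_minus A.a_assoc A.r_neg1)
    moreover have "gel g \<otimes>\<^bsub>A\<^esub> (gel h \<ominus>\<^bsub>A\<^esub> \<one>\<^bsub>A\<^esub>) \<in> Del n"
      using h gc by (intro I.I_l_closed) (simp_all add: MM_iff)
    ultimately have "gel (g \<otimes> h) \<ominus>\<^bsub>A\<^esub> \<one>\<^bsub>A\<^esub> \<in> Del n" using g by (simp add: MM_iff)
    then show "g \<otimes> h \<in> MM p H T n" using gc hc by (simp add: MM_iff)
  qed
  moreover have "x \<otimes> h \<otimes> inv x \<in> MM p H T n" if x: "x \<in> carrier H" and h: "h \<in> MM p H T n" for x h
  proof -
    have hc: "h \<in> carrier H" using h by (simp add: MM_iff)
    have "gel (x \<otimes> h \<otimes> inv x) \<ominus>\<^bsub>A\<^esub> \<one>\<^bsub>A\<^esub> = gel x \<otimes>\<^bsub>A\<^esub> (gel h \<ominus>\<^bsub>A\<^esub> \<one>\<^bsub>A\<^esub>) \<otimes>\<^bsub>A\<^esub> gel (inv x)"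
    proof -
      have "gel x \<otimes>\<^bsub>A\<^esub> gel (inv x) = \<one>\<^bsub>A\<^esub>" using x cga_of_mult[of x "inv x"] by (simp add: A_one)
      then show ?thesis using x hc by (simp add: cga_of_mult a_minus_def A.r_distr A.l_distr A.r_minus A.l_minus)
    qed
    moreover have "gel x \<otimes>\<^bsub>A\<^esub> (gel h \<ominus>\<^bsub>A\<^esub> \<one>\<^bsub>A\<^esub>) \<otimes>\<^bsub>A\<^esub> gel (inv x) \<in> Del n"
      using h x by (intro I.I_l_closed I.I_r_closed) (simp_all add: MM_iff)
    ultimately show ?thesis using x hc by (simp add: MM_iff)
  qed
  ultimately show ?thesis using normal_inv_iff by blast
qed

lemma MM_0: "MM p H T 0 = carrier H"
  by (auto simp: MM_iff Delta_0)

lemma MM_Suc: "MM p H T (Suc n) \<subseteq> MM p H T n"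
  using subsetD[OF Delta_Suc] by (auto simp: MM_iff)

text \<open>An element of all dimension subgroups has the same image in the algebra as the identity.
  The component at an open normal subgroup not containing it would tell the two apart.\<close>

lemma MM_Inter:
  assumes "\<And>n. h \<in> MM p H T n"
  shows "h = \<one>"
proof (rule ccontr)
  assume h: "h \<noteq> \<one>"
  have hc: "h \<in> carrier H" using assms[of 0] by (simp add: MM_iff)
  have "gel h \<ominus>\<^bsub>A\<^esub> \<one>\<^bsub>A\<^esub> = \<zero>\<^bsub>A\<^esub>" using assms by (intro Delta_Inter) (simp add: MM_iff)
  then have "gel h = gel \<one>" using hc A.r_right_minus_eq[of "gel h" "\<one>\<^bsub>A\<^esub>"] by (simp add: A_one)
  obtain U where U: "U \<in> ONS" "h \<notin> U" using ONS_separation[OF hc h] .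
  interpret U: finite_group_ring p "H Mod U" using U(1) by (rule finite_group_ring_Mod)
  have c: "U #> h \<in> carrier (H Mod U)" using hc by (simp add: carrier_FactGroup)
  have "U.red (U.delta (U #> h)) (U #> h) = U.red (U.delta (U #> \<one>)) (U #> h)"
    using \<open>gel h = gel \<one>\<close> by (simp flip: cga_of_comp[OF U(1)])
  then have "U #> h = U #> \<one>" using c U.p_pos by (simp add: U.red_apply U.delta_def split: if_splits)
  then have "h \<otimes> inv \<one> \<in> U" using normal.rcos_eq_iff[OF ONS_normal[OF U(1)] hc one_closed] by simp
  then show False using U(2) hc by simp
qed

text \<open>The group embeds continuously into its algebra, since each component is constant on
  cosets of an open subgroup. The dimension subgroup is then the preimage of a closed ideal under h
  -> h - 1.\<close>

lemma closedin_MM: "closedin T (MM p H T n)"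
proof -
  have cont: "continuous_map T CT (\<lambda>h. gel h \<ominus>\<^bsub>A\<^esub> \<one>\<^bsub>A\<^esub>)"
  proof -
    have "continuous_map T CT gel"
    proof (rule continuous_into_CT)
      show "gel y \<in> carrier A" if "y \<in> topspace T" for y using that by (simp add: topspace_T)
      fix U assume U: "U \<in> ONS"
      have "openin T {h \<in> topspace T. gel h U \<in> S}" for S
      proof -
        have "{h \<in> topspace T. gel h U \<in> S} = (\<Union>h\<in>{h \<in> carrier H. gel h U \<in> S}. U #> h)"
        proof (intro equalityI subsetI)
          fix x assume "x \<in> {h \<in> topspace T. gel h U \<in> S}"
          then show "x \<in> (\<Union>h\<in>{h \<in> carrier H. gel h U \<in> S}. U #> h)"
            using rcos_self[OF _ normal_imp_subgroup[OF ONS_normal[OF U]]] by (auto simp: topspace_T)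
        next
          fix x assume "x \<in> (\<Union>h\<in>{h \<in> carrier H. gel h U \<in> S}. U #> h)"
          then obtain h where h: "h \<in> carrier H" "gel h U \<in> S" "x \<in> U #> h" by blast
          have "U #> h = U #> x" using repr_independence[OF h(3,1) normal_imp_subgroup[OF ONS_normal[OF U]]] .
          moreover have "x \<in> carrier H"
            using h r_coset_subset_G[OF subgroup.subset[OF normal_imp_subgroup[OF ONS_normal[OF U]]]] by blast
          ultimately show "x \<in> {h \<in> topspace T. gel h U \<in> S}" using h U by (simp add: topspace_T cga_of_comp)
        qed
        moreover have "openin T (\<Union>h\<in>{h \<in> carrier H. gel h U \<in> S}. U #> h)"
          using openin_coset[OF ONS_open[OF U] ONS_normal[OF U]] by (intro openin_Union) auto
        ultimately show ?thesis by simp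
      qed
      then show "continuous_map T (discrete_topology (carrier (GR U))) (\<lambda>y. gel y U)"
        using comp_closed[OF cga_of_closed U] by (auto simp: continuous_map_def topspace_T)
    qed
    moreover have "continuous_map T CT (\<lambda>h. \<ominus>\<^bsub>A\<^esub> \<one>\<^bsub>A\<^esub>)" by (simp add: topspace_CT)
    ultimately show ?thesis
      using topological_group_on_mult[OF topological_group_A, of T gel "\<lambda>h. \<ominus>\<^bsub>A\<^esub> \<one>\<^bsub>A\<^esub>"] by (simp add: a_minus_def)
  qed
  from closedin_continuous_map_preimage[OF cont closedin_Delta[of n]] show ?thesis
    by (simp add: MM_def topspace_T)
qed

end

section \<open>Functoriality of the completed group algebra\<close>

text \<open>Elements of the completed group algebra can be pushed forward along arbitrary continuous maps,
  because modulo an open subgroup such a map factors through a finite quotient.\<close>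

locale pro_p_pair = H: pro_p p H T + K: pro_p p K TK
  for p :: nat and H :: "'a monoid" and T :: "'a topology" and K :: "'b monoid" and TK :: "'b topology"
begin

text \<open>This says that U is fine enough for f to induce a map from the cosets of U to the cosets
  of V. No multiplicativity is implied.\<close>

definition good :: "('a \<Rightarrow> 'b) \<Rightarrow> 'a set \<Rightarrow> 'b set \<Rightarrow> bool" where
  "good f U V \<longleftrightarrow> U \<in> H.ONS \<and> V \<in> K.ONS \<and>
     (\<forall>x\<in>carrier H. \<forall>u\<in>U. V #>\<^bsub>K\<^esub> f (u \<otimes>\<^bsub>H\<^esub> x) = V #>\<^bsub>K\<^esub> f x)"

abbreviation pmap :: "('a \<Rightarrow> 'b) \<Rightarrow> 'a set \<Rightarrow> 'b set \<Rightarrow> ('a set \<Rightarrow> int) \<Rightarrow> 'b set \<Rightarrow> int" where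
  "pmap f U V \<equiv> push_forward (Fp p) (H Mod U) (K Mod V) (\<lambda>C. V <#>\<^bsub>K\<^esub> f ` C)"

text \<open>For a homomorphism the preimage of V is a canonical level U. A general continuous map
  offers none, hence the choice; \<open>pmap_indep\<close> shows that every good level gives the
  same component.\<close>

definition cga_push :: "('a \<Rightarrow> 'b) \<Rightarrow> 'a cga \<Rightarrow> 'b cga" where
  "cga_push f c = (\<lambda>V\<in>K.ONS. let U = (SOME U. good f U V) in pmap f U V (c U))"

lemma map_closed: "continuous_map T TK f \<Longrightarrow> x \<in> carrier H \<Longrightarrow> f x \<in> carrier K"
  using continuous_map_image_subset_topspace[of T TK f] by (auto simp: H.topspace_T K.topspace_T)

text \<open>There are finitely many cosets of V and their preimages are clopen. Each preimage is
  invariant under left translation by some open normal subgroup, and a common open normal subgroup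
  of these serves all cosets at once.\<close>

lemma good_exists:
  assumes f: "continuous_map T TK f" and V: "V \<in> K.ONS"
  obtains U where "good f U V"
proof -
  note sV = normal_imp_subgroup[OF K.ONS_normal[OF V]]
  have "\<exists>U. U \<in> H.ONS \<and> (\<forall>u\<in>U. \<forall>x\<in>carrier H. f (u \<otimes>\<^bsub>H\<^esub> x) \<in> D \<longleftrightarrow> f x \<in> D)"
    if D: "D \<in> carrier (K Mod V)" for D
  proof -
    let ?W = "{x \<in> topspace T. f x \<in> D}"
    have "openin TK D" "closedin TK D"
      using D K.openin_coset[OF K.ONS_open[OF V] K.ONS_normal[OF V]]
        K.closedin_coset[OF K.ONS_open[OF V] K.ONS_normal[OF V]] by (auto simp: carrier_FactGroup)
    then have "openin T ?W" "closedin T ?W"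
      using openin_continuous_map_preimage[OF f] closedin_continuous_map_preimage[OF f] by blast+
    then obtain U where U: "U \<in> H.ONS" "\<And>u x. u \<in> U \<Longrightarrow> x \<in> carrier H \<Longrightarrow> u \<otimes>\<^bsub>H\<^esub> x \<in> ?W \<longleftrightarrow> x \<in> ?W"
      by (rule H.clopen_saturated) (rule that)
    have "f (u \<otimes>\<^bsub>H\<^esub> x) \<in> D \<longleftrightarrow> f x \<in> D" if u: "u \<in> U" and x: "x \<in> carrier H" for u x
    proof -
      have "u \<in> carrier H" using u subgroup.mem_carrier[OF normal_imp_subgroup[OF H.ONS_normal[OF U(1)]]] by blast
      then show ?thesis using U(2)[OF u x] x by (simp add: H.topspace_T)
    qed
    then show ?thesis using U(1) by blast
  qed
  then obtain U where U: "\<And>D. D \<in> carrier (K Mod V) \<Longrightarrow> U D \<in> H.ONS"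
    "\<And>D u x. D \<in> carrier (K Mod V) \<Longrightarrow> u \<in> U D \<Longrightarrow> x \<in> carrier H \<Longrightarrow> f (u \<otimes>\<^bsub>H\<^esub> x) \<in> D \<longleftrightarrow> f x \<in> D"
    by metis
  obtain U0 where U0: "U0 \<in> H.ONS" "\<And>W. W \<in> U ` carrier (K Mod V) \<Longrightarrow> U0 \<subseteq> W"
    using H.ONS_Inter[of "U ` carrier (K Mod V)"] K.finite_quotient[OF V] U(1) by blast
  have "V #>\<^bsub>K\<^esub> f (u \<otimes>\<^bsub>H\<^esub> x) = V #>\<^bsub>K\<^esub> f x" if x: "x \<in> carrier H" and u: "u \<in> U0" for x u
  proof -
    have fx: "f x \<in> carrier K" using map_closed[OF f x] .
    let ?D = "V #>\<^bsub>K\<^esub> f x"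
    have D: "?D \<in> carrier (K Mod V)" using fx by (simp add: carrier_FactGroup)
    have "u \<in> U ?D" using U0(2) D u by blast
    then have "f (u \<otimes>\<^bsub>H\<^esub> x) \<in> ?D" using U(2)[OF D _ x] K.rcos_self[OF fx sV] by blast
    then show ?thesis using K.repr_independence[OF _ fx sV] by simp
  qed
  then have "good f U0 V" using U0(1) V by (simp add: good_def)
  then show ?thesis by (rule that)
qed

lemma good_sub: "good f U V \<Longrightarrow> U' \<in> H.ONS \<Longrightarrow> U' \<subseteq> U \<Longrightarrow> good f U' V"
  by (auto simp: good_def)

lemma good_sup:
  assumes f: "continuous_map T TK f" and g: "good f U V" and V': "V' \<in> K.ONS" "V \<subseteq> V'"
  shows "good f U V'"
proof -
  have UV: "U \<in> H.ONS" "V \<in> K.ONS" using g by (simp_all add: good_def)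
  have "V' #>\<^bsub>K\<^esub> f (u \<otimes>\<^bsub>H\<^esub> x) = V' #>\<^bsub>K\<^esub> f x" if x: "x \<in> carrier H" and u: "u \<in> U" for x u
  proof -
    have "u \<in> carrier H" using u subgroup.mem_carrier[OF normal_imp_subgroup[OF H.ONS_normal[OF UV(1)]]] by blast
    then have "f (u \<otimes>\<^bsub>H\<^esub> x) \<in> carrier K" "f x \<in> carrier K" using x map_closed[OF f] by auto
    then have "V' #>\<^bsub>K\<^esub> f (u \<otimes>\<^bsub>H\<^esub> x) = V' <#>\<^bsub>K\<^esub> (V #>\<^bsub>K\<^esub> f (u \<otimes>\<^bsub>H\<^esub> x))" "V' #>\<^bsub>K\<^esub> f x = V' <#>\<^bsub>K\<^esub> (V #>\<^bsub>K\<^esub> f x)"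
      using K.coset_proj[OF UV(2) V'] by simp_all
    then show ?thesis using g x u by (simp add: good_def)
  qed
  then show ?thesis using UV V' by (simp add: good_def)
qed

lemma good_image:
  assumes g: "good f U V" and x: "x \<in> carrier H"
  shows "V <#>\<^bsub>K\<^esub> f ` (U #>\<^bsub>H\<^esub> x) = V #>\<^bsub>K\<^esub> f x"
proof -
  have UV: "U \<in> H.ONS" "V \<in> K.ONS" using g by (simp_all add: good_def)
  have "V <#>\<^bsub>K\<^esub> f ` (U #>\<^bsub>H\<^esub> x) = (\<Union>u\<in>U. V #>\<^bsub>K\<^esub> f (u \<otimes>\<^bsub>H\<^esub> x))"
    by (auto simp: set_mult_def r_coset_def)
  also have "\<dots> = (\<Union>u\<in>U. V #>\<^bsub>K\<^esub> f x)"
    using g x by (intro SUP_cong) (auto simp: good_def)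
  also have "\<dots> = V #>\<^bsub>K\<^esub> f x"
    using subgroup.one_closed[OF normal_imp_subgroup[OF H.ONS_normal[OF UV(1)]]] by blast
  finally show ?thesis .
qed

lemma pmap_refine:
  assumes c: "c \<in> carrier H.A" and g: "good f U' V" and U: "U \<in> H.ONS" "U \<subseteq> U'"
  shows "pmap f U V (c U) = pmap f U' V (c U')"
proof -
  have U': "U' \<in> H.ONS" using g by (simp add: good_def)
  have gU: "good f U V" using good_sub[OF g U] .
  have "pmap f U' V (c U') = pmap f U' V (H.refine U U' (c U))"
    using H.comp_refine[OF c U(1) U' U(2)] by simp
  also have "\<dots> = push_forward (Fp p) (H Mod U) (K Mod V) (\<lambda>C. V <#>\<^bsub>K\<^esub> f ` (U' <#>\<^bsub>H\<^esub> C)) (c U)"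
    using H.proj_hom[OF U(1) U' U(2)]
    by (intro push_forward_comp H.prime_p H.finite_quotient U(1) U' H.comp_closed[OF c]) (auto simp: hom_def)
  also have "\<dots> = pmap f U V (c U)"
  proof (rule push_forward_cong)
    fix C assume "C \<in> carrier (H Mod U)"
    then obtain x where x: "x \<in> carrier H" "C = U #>\<^bsub>H\<^esub> x" by (auto simp: carrier_FactGroup)
    then show "V <#>\<^bsub>K\<^esub> f ` (U' <#>\<^bsub>H\<^esub> C) = V <#>\<^bsub>K\<^esub> f ` C"
      using H.coset_proj[OF U(1) U' U(2)] good_image[OF g] good_image[OF gU] by simp
  qed
  finally show ?thesis ..
qed

text \<open>Both levels are compared with their intersection, to which the compatibility of the
  family c applies.\<close>

lemma pmap_indep:
  assumes c: "c \<in> carrier H.A" and g: "good f U V" "good f U' V"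
  shows "pmap f U V (c U) = pmap f U' V (c U')"
proof -
  have I: "U \<inter> U' \<in> H.ONS" using g by (intro H.ONS_Int) (simp_all add: good_def)
  show ?thesis using pmap_refine[OF c g(1) I] pmap_refine[OF c g(2) I] by simp
qed

lemma cga_push_eq:
  assumes c: "c \<in> carrier H.A" and g: "good f U V"
  shows "cga_push f c V = pmap f U V (c U)"
proof -
  have "good f (SOME U. good f U V) V" using g by (rule someI)
  from pmap_indep[OF c this g] show ?thesis
    using g by (simp add: cga_push_def Let_def good_def)
qed

lemma cga_push_closed:
  assumes f: "continuous_map T TK f" and c: "c \<in> carrier H.A"
  shows "cga_push f c \<in> carrier K.A"
proof -
  have "(\<lambda>V\<in>K.ONS. cga_push f c V) \<in> carrier K.A"
  proof (rule K.A_memI)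
    fix V assume V: "V \<in> K.ONS"
    obtain U where g: "good f U V" using good_exists[OF f V] .
    have U: "U \<in> H.ONS" using g by (simp add: good_def)
    show cl: "cga_push f c V \<in> carrier (K.GR V)"
      unfolding cga_push_eq[OF c g]
      by (intro push_forward_closed H.prime_p H.finite_quotient[OF U] H.comp_closed[OF c U])
    fix V' assume V': "V' \<in> K.ONS" "V \<subseteq> V'"
    have g': "good f U V'" by (rule good_sup[OF f g V'])
    have closed: "V <#>\<^bsub>K\<^esub> f ` C \<in> carrier (K Mod V)" if C: "C \<in> carrier (H Mod U)" for C
    proof -
      obtain x where x: "x \<in> carrier H" "C = U #>\<^bsub>H\<^esub> x" using C by (auto simp: carrier_FactGroup)
      then show ?thesis using good_image[OF g x(1)] map_closed[OF f x(1)] by (simp add: carrier_FactGroup)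
    qed
    have "K.refine V V' (cga_push f c V) =
        push_forward (Fp p) (H Mod U) (K Mod V') (\<lambda>C. V' <#>\<^bsub>K\<^esub> (V <#>\<^bsub>K\<^esub> f ` C)) (c U)"
      unfolding cga_push_eq[OF c g]
      by (intro push_forward_comp H.prime_p H.finite_quotient[OF U] K.finite_quotient[OF V] H.comp_closed[OF c U] closed)
    also have "\<dots> = pmap f U V' (c U)"
    proof (rule push_forward_cong)
      fix C assume "C \<in> carrier (H Mod U)"
      then obtain x where x: "x \<in> carrier H" "C = U #>\<^bsub>H\<^esub> x" by (auto simp: carrier_FactGroup)
      then show "V' <#>\<^bsub>K\<^esub> (V <#>\<^bsub>K\<^esub> f ` C) = V' <#>\<^bsub>K\<^esub> f ` C"
        using good_image[OF g] good_image[OF g'] K.coset_proj[OF V V'] map_closed[OF f] by simp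
    qed
    also have "\<dots> = cga_push f c V'" using cga_push_eq[OF c g'] by simp
    finally show "K.refine V V' (cga_push f c V) = cga_push f c V'" .
  qed
  moreover have "(\<lambda>V\<in>K.ONS. cga_push f c V) = cga_push f c"
    by (auto simp: cga_push_def fun_eq_iff)
  ultimately show ?thesis by simp
qed

lemma pair_Mod: "U \<in> H.ONS \<Longrightarrow> V \<in> K.ONS \<Longrightarrow> finite_group_ring_pair p (H Mod U) (K Mod V)"
  by (simp add: finite_group_ring_pair_def H.finite_group_ring_Mod K.finite_group_ring_Mod)

lemma cga_push_zero:
  assumes f: "continuous_map T TK f"
  shows "cga_push f \<zero>\<^bsub>H.A\<^esub> = \<zero>\<^bsub>K.A\<^esub>"
proof (rule K.A_eqI)
  fix V assume V: "V \<in> K.ONS"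
  obtain U where g: "good f U V" using good_exists[OF f V] .
  have U: "U \<in> H.ONS" using g by (simp add: good_def)
  show "cga_push f \<zero>\<^bsub>H.A\<^esub> V = \<zero>\<^bsub>K.A\<^esub> V"
    unfolding cga_push_eq[OF H.A.zero_closed g]
    using finite_group_ring_pair.push_zero[OF pair_Mod[OF U V]] U V by (simp add: H.A_ops K.A_ops)
qed (use cga_push_closed[OF f] in auto)

lemma cga_push_add:
  assumes f: "continuous_map T TK f" and c: "c \<in> carrier H.A" and d: "d \<in> carrier H.A"
  shows "cga_push f (c \<oplus>\<^bsub>H.A\<^esub> d) = cga_push f c \<oplus>\<^bsub>K.A\<^esub> cga_push f d"
proof (rule K.A_eqI)
  fix V assume V: "V \<in> K.ONS"
  obtain U where g: "good f U V" using good_exists[OF f V] .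
  have U: "U \<in> H.ONS" using g by (simp add: good_def)
  show "cga_push f (c \<oplus>\<^bsub>H.A\<^esub> d) V = (cga_push f c \<oplus>\<^bsub>K.A\<^esub> cga_push f d) V"
    using finite_group_ring_pair.push_add[OF pair_Mod[OF U V] H.comp_closed[OF c U] H.comp_closed[OF d U]] U V
    by (simp add: H.A_ops(3) K.A_ops(3) cga_push_eq[OF c g] cga_push_eq[OF d g]
        cga_push_eq[OF H.A_add_closed[OF c d, unfolded H.A_ops(3)] g])
qed (use cga_push_closed[OF f] c d in \<open>auto intro!: K.A_add_closed\<close>)

lemma cga_push_gel:
  assumes f: "continuous_map T TK f" and h: "h \<in> carrier H"
  shows "cga_push f (cga_of p H T h) = cga_of p K TK (f h)"
proof (rule K.A_eqI)
  fix V assume V: "V \<in> K.ONS"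
  obtain U where g: "good f U V" using good_exists[OF f V] .
  have U: "U \<in> H.ONS" using g by (simp add: good_def)
  have "U #>\<^bsub>H\<^esub> h \<in> carrier (H Mod U)" using h by (simp add: carrier_FactGroup)
  then show "cga_push f (cga_of p H T h) V = cga_of p K TK (f h) V"
    unfolding cga_push_eq[OF H.cga_of_closed[OF h] g] H.cga_of_comp[OF U] K.cga_of_comp[OF V]
    using finite_group_ring_pair.push_delta[OF pair_Mod[OF U V]] good_image[OF g h] by simp
qed (use cga_push_closed[OF f] H.cga_of_closed[OF h] K.cga_of_closed[OF map_closed[OF f h]] in auto)

lemma cga_push_cong:
  assumes f: "continuous_map T TK f" and f': "continuous_map T TK f'"
    and eq: "\<And>x. x \<in> carrier H \<Longrightarrow> f x = f' x" and c: "c \<in> carrier H.A"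
  shows "cga_push f c = cga_push f' c"
proof (rule K.A_eqI)
  fix V assume V: "V \<in> K.ONS"
  obtain U where g: "good f U V" using good_exists[OF f V] .
  have U: "U \<in> H.ONS" using g by (simp add: good_def)
  have g': "good f' U V"
    unfolding good_def
  proof (intro conjI ballI U V)
    fix x u assume x: "x \<in> carrier H" and u: "u \<in> U"
    have uc: "u \<in> carrier H" using u subgroup.mem_carrier[OF normal_imp_subgroup[OF H.ONS_normal[OF U]]] by blast
    have "V #>\<^bsub>K\<^esub> f (u \<otimes>\<^bsub>H\<^esub> x) = V #>\<^bsub>K\<^esub> f x" using g x u by (simp add: good_def)
    then show "V #>\<^bsub>K\<^esub> f' (u \<otimes>\<^bsub>H\<^esub> x) = V #>\<^bsub>K\<^esub> f' x" by (simp only: eq[OF x] eq[OF H.m_closed[OF uc x]])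
  qed
  have "pmap f U V (c U) = pmap f' U V (c U)"
  proof (rule push_forward_cong)
    fix C assume "C \<in> carrier (H Mod U)"
    then obtain x where x: "x \<in> carrier H" "C = U #>\<^bsub>H\<^esub> x" by (auto simp: carrier_FactGroup)
    then show "V <#>\<^bsub>K\<^esub> f ` C = V <#>\<^bsub>K\<^esub> f' ` C" using good_image[OF g] good_image[OF g'] eq by simp
  qed
  then show "cga_push f c V = cga_push f' c V" by (simp add: cga_push_eq[OF c g] cga_push_eq[OF c g'])
qed (use cga_push_closed[OF f c] cga_push_closed[OF f' c] in auto)

lemma good_preimage:
  assumes f: "continuous_map T TK f" and h: "f \<in> hom H K" and V: "V \<in> K.ONS"
  shows "good f {x \<in> carrier H. f x \<in> V} V"
proof -
  interpret f: group_hom H K f using h by unfold_locales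
  interpret V: normal V K using V by (rule K.ONS_normal)
  let ?U = "{x \<in> carrier H. f x \<in> V}"
  have "subgroup ?U H"
    by (rule H.subgroupI) (auto intro: V.one_closed exI[of _ "\<one>\<^bsub>H\<^esub>"])
  then have "?U \<lhd> H"
    using V.inv_op_closed2 by (auto simp: H.normal_inv_iff)
  moreover have "openin T ?U"
    using openin_continuous_map_preimage[OF f K.ONS_open[OF V]] by (simp add: H.topspace_T)
  ultimately have U: "?U \<in> H.ONS" by (simp add: open_normal_subgroups_def)
  have "V #>\<^bsub>K\<^esub> f (u \<otimes>\<^bsub>H\<^esub> x) = V #>\<^bsub>K\<^esub> f x" if "x \<in> carrier H" "u \<in> ?U" for x u
    using that by (subst V.rcos_eq_iff) (auto simp: K.m_assoc)
  then show ?thesis using U V by (simp add: good_def)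
qed

text \<open>This gives the maps used to define the simplicial algebra access to the functoriality
  that holds for all continuous maps, so that faces can be composed with maps that are not
  homomorphisms.\<close>

lemma cga_map_eq_push:
  assumes f: "continuous_map T TK f" and h: "f \<in> hom H K" and c: "c \<in> carrier H.A"
  shows "cga_map p H K TK f c = cga_push f c"
proof
  fix V
  show "cga_map p H K TK f c V = cga_push f c V"
  proof (cases "V \<in> K.ONS")
    case True
    then show ?thesis using cga_push_eq[OF c good_preimage[OF f h True]] by (simp add: cga_map_def Let_def)
  next
    case False
    then show ?thesis by (simp add: cga_map_def cga_push_def)
  qed
qed

lemma cga_push_mult:
  assumes f: "continuous_map T TK f" and h: "f \<in> hom H K" and c: "c \<in> carrier H.A" and d: "d \<in> carrier H.A"
  shows "cga_push f (c \<otimes>\<^bsub>H.A\<^esub> d) = cga_push f c \<otimes>\<^bsub>K.A\<^esub> cga_push f d"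
proof (rule K.A_eqI)
  fix V assume V: "V \<in> K.ONS"
  define U where "U = {x \<in> carrier H. f x \<in> V}"
  have g: "good f U V" unfolding U_def by (rule good_preimage[OF f h V])
  then have U: "U \<in> H.ONS" by (simp add: good_def)
  interpret f: group_hom H K f using h by unfold_locales
  have "(\<lambda>C. V <#>\<^bsub>K\<^esub> f ` C) \<in> hom (H Mod U) (K Mod V)"
  proof (rule homI)
    fix C assume "C \<in> carrier (H Mod U)"
    then show "V <#>\<^bsub>K\<^esub> f ` C \<in> carrier (K Mod V)" using good_image[OF g] by (auto simp: carrier_FactGroup)
  next
    fix C D assume "C \<in> carrier (H Mod U)" "D \<in> carrier (H Mod U)"
    then obtain x y where xy: "x \<in> carrier H" "C = U #>\<^bsub>H\<^esub> x" "y \<in> carrier H" "D = U #>\<^bsub>H\<^esub> y"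
      by (auto simp: carrier_FactGroup)
    then show "V <#>\<^bsub>K\<^esub> f ` (C \<otimes>\<^bsub>H Mod U\<^esub> D) = (V <#>\<^bsub>K\<^esub> f ` C) \<otimes>\<^bsub>K Mod V\<^esub> (V <#>\<^bsub>K\<^esub> f ` D)"
      using good_image[OF g] normal.rcos_sum[OF H.ONS_normal[OF U]] normal.rcos_sum[OF K.ONS_normal[OF V]]
      by simp
  qed
  then show "cga_push f (c \<otimes>\<^bsub>H.A\<^esub> d) V = (cga_push f c \<otimes>\<^bsub>K.A\<^esub> cga_push f d) V"
    using finite_group_ring_pair.push_mult[OF pair_Mod[OF U V] H.comp_closed[OF c U] H.comp_closed[OF d U]] U V
    by (simp add: H.A_ops(1) K.A_ops(1) cga_push_eq[OF c g] cga_push_eq[OF d g]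
        cga_push_eq[OF H.A_mult_closed[OF c d, unfolded H.A_ops(1)] g])
qed (use cga_push_closed[OF f] c d in \<open>auto intro!: K.A_mult_closed H.A_mult_closed\<close>)

lemma cga_push_AI:
  assumes f: "continuous_map T TK f" and c: "c \<in> H.AI"
  shows "cga_push f c \<in> K.AI"
  unfolding K.AI_iff
proof (intro conjI ballI)
  have cA: "c \<in> carrier H.A" using c H.AI_iff by blast
  show "cga_push f c \<in> carrier K.A" by (rule cga_push_closed[OF f cA])
  fix V assume V: "V \<in> K.ONS"
  obtain U where g: "good f U V" using good_exists[OF f V] .
  have U: "U \<in> H.ONS" using g by (simp add: good_def)
  interpret P: finite_group_ring_pair p "H Mod U" "K Mod V" by (rule pair_Mod[OF U V])
  have closed: "V <#>\<^bsub>K\<^esub> f ` C \<in> carrier (K Mod V)" if C: "C \<in> carrier (H Mod U)" for C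
  proof -
    obtain x where x: "x \<in> carrier H" "C = U #>\<^bsub>H\<^esub> x" using C by (auto simp: carrier_FactGroup)
    then show ?thesis using good_image[OF g x(1)] map_closed[OF f x(1)] by (simp add: carrier_FactGroup)
  qed
  have "c U \<in> P.K.aug" using c U H.AI_iff by blast
  then show "cga_push f c V \<in> finite_group_ring.aug p (K Mod V)"
    unfolding cga_push_eq[OF cA g]
    using P.push_sum[OF H.comp_closed[OF cA U] closed] P.push_closed[OF H.comp_closed[OF cA U]]
    by (simp add: P.K.aug_def P.L.aug_def)
qed

lemma cga_push_AP:
  assumes f: "continuous_map T TK f" and h: "f \<in> hom H K"
  shows "c \<in> H.AP n \<Longrightarrow> cga_push f c \<in> K.AP n"
proof (induction n arbitrary: c)
  case 0
  then show ?case using cga_push_closed[OF f] by simp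
next
  case (Suc n)
  have "c \<in> ideal_prod H.A (H.AP n) H.AI" using Suc.prems by simp
  then have "cga_push f c \<in> ideal_prod K.A (K.AP n) K.AI"
  proof (induction rule: ideal_prod.induct)
    case (prod i j)
    then have "i \<in> carrier H.A" "j \<in> carrier H.A" using H.AP_carrier H.AI_iff by blast+
    then have "cga_push f (i \<otimes>\<^bsub>H.A\<^esub> j) = cga_push f i \<otimes>\<^bsub>K.A\<^esub> cga_push f j"
      by (rule cga_push_mult[OF f h])
    then show ?case using ideal_prod.prod[OF Suc.IH[OF prod(1)] cga_push_AI[OF f prod(2)], of K.A] by simp
  next
    case (sum s t)
    have "H.AP (Suc n) \<subseteq> carrier H.A" by (rule H.AP_carrier)
    then have "s \<in> carrier H.A" "t \<in> carrier H.A" using sum(1,2) by auto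
    then have "cga_push f (s \<oplus>\<^bsub>H.A\<^esub> t) = cga_push f s \<oplus>\<^bsub>K.A\<^esub> cga_push f t"
      by (rule cga_push_add[OF f])
    then show ?case using ideal_prod.sum[OF sum.IH] by simp
  qed
  then show ?case by simp
qed

lemma cga_push_Delta:
  assumes f: "continuous_map T TK f" and h: "f \<in> hom H K" and c: "c \<in> H.Del n"
  shows "cga_push f c \<in> K.Del n"
  unfolding K.Delta_iff
proof (intro conjI ballI)
  have cA: "c \<in> carrier H.A" by (rule H.Delta_carrier[OF c])
  show "cga_push f c \<in> carrier K.A" by (rule cga_push_closed[OF f cA])
  fix V assume V: "V \<in> K.ONS"
  obtain U where g: "good f U V" using good_exists[OF f V] .
  have U: "U \<in> H.ONS" using g by (simp add: good_def)
  obtain a where a: "a \<in> H.AP n" "a U = c U" using c U unfolding H.Delta_iff by blast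
  have "a \<in> carrier H.A" using a(1) H.AP_carrier by blast
  then have "cga_push f a V = cga_push f c V" using a(2) cga_push_eq[OF _ g] cA by simp
  then show "\<exists>a\<in>K.AP n. a V = cga_push f c V" using cga_push_AP[OF f h a(1)] by blast
qed

text \<open>The induced map is additive, preserves the unit and carries the image of x to the image
  of f x. So it sends x - 1 to f x - 1, and it respects the closed powers.\<close>

lemma MM_image:
  assumes f: "continuous_map T TK f" and h: "f \<in> hom H K" and x: "x \<in> MM p H T n"
  shows "f x \<in> MM p K TK n"
proof -
  interpret f: group_hom H K f using h by unfold_locales
  have xc: "x \<in> carrier H" and xd: "cga_of p H T x \<ominus>\<^bsub>H.A\<^esub> \<one>\<^bsub>H.A\<^esub> \<in> H.Del n" using x by (simp_all add: MM_def)
  have gx: "cga_of p H T x \<in> carrier H.A" "cga_of p K TK (f x) \<in> carrier K.A"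
    using H.cga_of_closed[OF xc] K.cga_of_closed[OF f.hom_closed[OF xc]] by auto
  define d where "d = cga_of p H T x \<ominus>\<^bsub>H.A\<^esub> \<one>\<^bsub>H.A\<^esub>"
  have dc: "d \<in> carrier H.A" using gx by (simp add: d_def)
  have "cga_of p H T x = d \<oplus>\<^bsub>H.A\<^esub> \<one>\<^bsub>H.A\<^esub>"
    using gx by (simp add: d_def a_minus_def H.A.a_assoc H.A.l_neg)
  then have "cga_push f (cga_of p H T x) = cga_push f d \<oplus>\<^bsub>K.A\<^esub> cga_push f \<one>\<^bsub>H.A\<^esub>"
    using cga_push_add[OF f dc H.A.one_closed] by simp
  moreover have "cga_push f \<one>\<^bsub>H.A\<^esub> = \<one>\<^bsub>K.A\<^esub>"
    using cga_push_gel[OF f H.one_closed] by (simp add: H.A_one K.A_one)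
  ultimately have "cga_of p K TK (f x) = cga_push f d \<oplus>\<^bsub>K.A\<^esub> \<one>\<^bsub>K.A\<^esub>"
    using cga_push_gel[OF f xc] by simp
  then have "cga_of p K TK (f x) \<ominus>\<^bsub>K.A\<^esub> \<one>\<^bsub>K.A\<^esub> = cga_push f d"
    using cga_push_closed[OF f dc] by (simp add: a_minus_def K.A.a_assoc K.A.r_neg)
  then show ?thesis using cga_push_Delta[OF f h xd] xc by (simp add: MM_def d_def)
qed

lemma continuous_cga_push:
  assumes f: "continuous_map T TK f"
  shows "continuous_map H.CT K.CT (cga_push f)"
proof (rule K.continuous_into_CT)
  show "cga_push f c \<in> carrier K.A" if "c \<in> topspace H.CT" for c
    using cga_push_closed[OF f, of c] that by (simp add: H.topspace_CT)
  fix V assume V: "V \<in> K.ONS"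
  obtain U where g: "good f U V" using good_exists[OF f V] .
  have U: "U \<in> H.ONS" using g by (simp add: good_def)
  have "continuous_map H.CT (discrete_topology (carrier (K.GR V))) (\<lambda>c. pmap f U V (c U))"
    by (rule H.continuous_discrete_comp[OF H.continuous_comp[OF U]])
      (rule push_forward_closed[OF H.prime_p H.finite_quotient[OF U]])
  then show "continuous_map H.CT (discrete_topology (carrier (K.GR V))) (\<lambda>c. cga_push f c V)"
    by (rule continuous_map_eq) (simp add: H.topspace_CT cga_push_eq[OF _ g])
qed

end

text \<open>Good levels compose: translating the argument by an element of U moves the value of f by
  an element of V, which \<open>f'\<close> cannot see modulo W. At such levels the claim reduces to
  composition of push-forwards between finite group rings.\<close>

lemma cga_push_comp:
  assumes "pro_p_pair p H T K TK" "pro_p_pair p K TK L TL"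
    and f: "continuous_map T TK f" and f': "continuous_map TK TL f'"
    and c: "c \<in> carrier (completed_group_algebra p H T)"
  shows "pro_p_pair.cga_push p K TK L TL f' (pro_p_pair.cga_push p H T K TK f c) =
    pro_p_pair.cga_push p H T L TL (\<lambda>x. f' (f x)) c"
proof -
  interpret HK: pro_p_pair p H T K TK by fact
  interpret KL: pro_p_pair p K TK L TL by fact
  interpret HL: pro_p_pair p H T L TL by unfold_locales
  have ff: "continuous_map T TL (\<lambda>x. f' (f x))"
    using continuous_map_compose[OF f f'] by (simp add: comp_def)
  show ?thesis
  proof (rule KL.K.A_eqI)
    fix W assume W: "W \<in> KL.K.ONS"
    obtain V where gV: "KL.good f' V W" using KL.good_exists[OF f' W] .
    have V: "V \<in> HK.K.ONS" using gV by (simp add: KL.good_def)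
    obtain U where gU: "HK.good f U V" using HK.good_exists[OF f V] .
    have U: "U \<in> HK.H.ONS" using gU by (simp add: HK.good_def)
    have step: "W #>\<^bsub>L\<^esub> f' (f (u \<otimes>\<^bsub>H\<^esub> x)) = W #>\<^bsub>L\<^esub> f' (f x)" if x: "x \<in> carrier H" and u: "u \<in> U" for x u
    proof -
      have uc: "u \<in> carrier H" using u subgroup.mem_carrier[OF normal_imp_subgroup[OF HK.H.ONS_normal[OF U]]] by blast
      have fc: "f x \<in> carrier K" "f (u \<otimes>\<^bsub>H\<^esub> x) \<in> carrier K" using x uc HK.map_closed[OF f] by auto
      have "f (u \<otimes>\<^bsub>H\<^esub> x) \<in> V #>\<^bsub>K\<^esub> f (u \<otimes>\<^bsub>H\<^esub> x)"
        by (rule HK.K.rcos_self[OF fc(2) normal_imp_subgroup[OF HK.K.ONS_normal[OF V]]])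
      then have "f (u \<otimes>\<^bsub>H\<^esub> x) \<in> V #>\<^bsub>K\<^esub> f x" using gU x u by (simp add: HK.good_def)
      then obtain v where v: "v \<in> V" "f (u \<otimes>\<^bsub>H\<^esub> x) = v \<otimes>\<^bsub>K\<^esub> f x" by (auto simp: r_coset_def)
      then show ?thesis using gV fc(1) by (simp add: KL.good_def)
    qed
    have gUW: "HL.good (\<lambda>x. f' (f x)) U W" using step U W by (simp add: HL.good_def)
    have fc: "HK.cga_push f c \<in> carrier HK.K.A" by (rule HK.cga_push_closed[OF f c])
    have closed: "V <#>\<^bsub>K\<^esub> f ` C \<in> carrier (K Mod V)" if C: "C \<in> carrier (H Mod U)" for C
    proof -
      obtain x where x: "x \<in> carrier H" "C = U #>\<^bsub>H\<^esub> x" using C by (auto simp: carrier_FactGroup)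
      then show ?thesis using HK.good_image[OF gU x(1)] HK.map_closed[OF f x(1)] by (simp add: carrier_FactGroup)
    qed
    have "KL.cga_push f' (HK.cga_push f c) W = KL.pmap f' V W (HK.pmap f U V (c U))"
      unfolding KL.cga_push_eq[OF fc gV] HK.cga_push_eq[OF c gU] ..
    also have "\<dots> = push_forward (Fp p) (H Mod U) (L Mod W) (\<lambda>C. W <#>\<^bsub>L\<^esub> f' ` (V <#>\<^bsub>K\<^esub> f ` C)) (c U)"
      by (intro push_forward_comp HK.H.prime_p HK.H.finite_quotient[OF U] HK.K.finite_quotient[OF V]
          HK.H.comp_closed[OF c U] closed)
    also have "\<dots> = HL.pmap (\<lambda>x. f' (f x)) U W (c U)"
    proof (rule push_forward_cong)
      fix C assume "C \<in> carrier (H Mod U)"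
      then obtain x where x: "x \<in> carrier H" "C = U #>\<^bsub>H\<^esub> x" by (auto simp: carrier_FactGroup)
      then show "W <#>\<^bsub>L\<^esub> f' ` (V <#>\<^bsub>K\<^esub> f ` C) = W <#>\<^bsub>L\<^esub> (\<lambda>x. f' (f x)) ` C"
        using HK.good_image[OF gU] HL.good_image[OF gUW] KL.good_image[OF gV] HK.map_closed[OF f] by simp
    qed
    also have "\<dots> = HL.cga_push (\<lambda>x. f' (f x)) c W" using HL.cga_push_eq[OF c gUW] by simp
    finally show "KL.cga_push f' (HK.cga_push f c) W = HL.cga_push (\<lambda>x. f' (f x)) c W" .
  qed (use KL.cga_push_closed[OF f' HK.cga_push_closed[OF f c]] HL.cga_push_closed[OF ff c] in auto)
qed

lemma (in pro_p) cga_push_id: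
  assumes c: "c \<in> carrier A"
  shows "pro_p_pair.cga_push p H T H T (\<lambda>x. x) c = c"
proof -
  interpret HH: pro_p_pair p H T H T by unfold_locales
  show ?thesis
  proof (rule A_eqI)
    fix V assume V: "V \<in> ONS"
    interpret N: normal V H using V by (rule ONS_normal)
    have g: "HH.good (\<lambda>x. x) V V"
      unfolding HH.good_def
    proof (intro conjI ballI V)
      fix x u assume "x \<in> carrier H" "u \<in> V"
      then show "V #> (u \<otimes> x) = V #> x" by (subst N.rcos_eq_iff) (auto simp: m_assoc)
    qed
    have "HH.cga_push (\<lambda>x. x) c V = refine V V (c V)" using HH.cga_push_eq[OF c g] by simp
    then show "HH.cga_push (\<lambda>x. x) c V = c V" using comp_refine[OF c V V] by simp
  qed (use HH.cga_push_closed[OF continuous_map_id[unfolded id_def] c] c in auto)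
qed

section \<open>The extra degeneracy\<close>

locale simplicial_pro_p = simplicial_grp X for X :: "'a simplicial" +
  fixes p :: nat and T :: "nat \<Rightarrow> 'a topology"
  assumes prime_p: "prime p" and simplicial_pro_p: "simplicial_pro_p_group p X T"
begin

lemma pro_p_obj: "pro_p p (obj X m) (T m)"
  using prime_p simplicial_pro_p by (simp add: simplicial_pro_p_group_def pro_p_def)

lemma face_continuous: "i \<le> Suc m \<Longrightarrow> continuous_map (T (Suc m)) (T m) (face X (Suc m) i)"
  using simplicial_pro_p unfolding simplicial_pro_p_group_def by blast

lemma degen_continuous: "i \<le> m \<Longrightarrow> continuous_map (T m) (T (Suc m)) (degen X m i)"
  using simplicial_pro_p unfolding simplicial_pro_p_group_def by blast

lemma topspace_obj: "topspace (T m) = carrier (obj X m)"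
  by (rule pro_p.topspace_T[OF pro_p_obj])

text \<open>The map from a simplex to the tuple of its faces is considered over its own image, so no
  description of that image is required. Two simplices with equal faces differ by an element on
  which every face is trivial, so the fibres have the coset form that
  \<open>continuous_section\<close> asks for.\<close>

lemma continuous_filler:
  assumes g: "\<And>i. i \<le> Suc m \<Longrightarrow> continuous_map Y (T m) (g i)"
    and fill: "\<And>y. y \<in> topspace Y \<Longrightarrow> \<exists>z\<in>carrier (obj X (Suc m)). \<forall>i\<le>Suc m. face X (Suc m) i z = g i y"
  obtains s where "continuous_map Y (T (Suc m)) s"
    "\<And>y i. y \<in> topspace Y \<Longrightarrow> i \<le> Suc m \<Longrightarrow> face X (Suc m) i (s y) = g i y"
proof -
  interpret P: pro_p p "obj X (Suc m)" "T (Suc m)" by (rule pro_p_obj)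
  let ?P = "product_topology (\<lambda>_. T m) {..Suc m}"
  define F where "F z = (\<lambda>i\<in>{..Suc m}. face X (Suc m) i z)" for z
  define TB where "TB = subtopology ?P (F ` carrier (obj X (Suc m)))"
  have contF: "continuous_map (T (Suc m)) ?P F"
    using face_continuous by (auto simp: continuous_map_componentwise F_def)
  have sub: "F ` carrier (obj X (Suc m)) \<subseteq> topspace ?P"
    using continuous_map_image_subset_topspace[OF contF] by (simp add: topspace_obj)
  have tB: "topspace TB = F ` carrier (obj X (Suc m))" using sub by (auto simp: TB_def)
  have FTB: "continuous_map (T (Suc m)) TB F"
    unfolding TB_def using contF by (intro continuous_map_into_subtopology) (auto simp: topspace_obj)
  have "Hausdorff_space ?P"
    using pro_p.Hausdorff_T[OF pro_p_obj] by (simp add: Hausdorff_space_product_topology)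
  then have HTB: "Hausdorff_space TB" unfolding TB_def by (rule Hausdorff_space_subtopology)
  have heap: "F (z \<otimes>\<^bsub>obj X (Suc m)\<^esub> inv\<^bsub>obj X (Suc m)\<^esub> x \<otimes>\<^bsub>obj X (Suc m)\<^esub> y) = F z"
    if xyz: "x \<in> carrier (obj X (Suc m))" "y \<in> carrier (obj X (Suc m))" "z \<in> carrier (obj X (Suc m))" and eq: "F x = F y" for x y z
    unfolding F_def
  proof (rule restrict_ext)
    fix i assume "i \<in> {..Suc m}"
    then have i: "i \<le> Suc m" by simp
    have "face X (Suc m) i x = face X (Suc m) i y" using fun_cong[OF eq, of i] i by (simp add: F_def)
    then show "face X (Suc m) i (z \<otimes>\<^bsub>obj X (Suc m)\<^esub> inv\<^bsub>obj X (Suc m)\<^esub> x \<otimes>\<^bsub>obj X (Suc m)\<^esub> y) = face X (Suc m) i z"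
      using xyz i by (simp add: assoc)
  qed
  obtain sec where sec: "continuous_map TB (T (Suc m)) sec" "\<And>b. b \<in> topspace TB \<Longrightarrow> F (sec b) = b"
    using P.continuous_section[OF FTB HTB tB[symmetric] heap] by blast
  define G where "G y = (\<lambda>i\<in>{..Suc m}. g i y)" for y
  have GF: "G y \<in> F ` carrier (obj X (Suc m))" if y: "y \<in> topspace Y" for y
  proof -
    obtain z where z: "z \<in> carrier (obj X (Suc m))" "\<And>i. i \<le> Suc m \<Longrightarrow> face X (Suc m) i z = g i y"
      using fill[OF y] by blast
    have "G y = F z" unfolding G_def F_def by (rule restrict_ext) (simp add: z(2))
    then show ?thesis using z(1) by blast
  qed
  have "continuous_map Y ?P G"
    using g by (auto simp: continuous_map_componentwise G_def)
  then have GTB: "continuous_map Y TB G"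
    unfolding TB_def using GF by (intro continuous_map_into_subtopology) auto
  show ?thesis
  proof (rule that)
    show "continuous_map Y (T (Suc m)) (sec \<circ> G)" by (rule continuous_map_compose[OF GTB sec(1)])
    fix y i assume y: "y \<in> topspace Y" and i: "i \<le> Suc m"
    have "F (sec (G y)) = G y" using sec(2) GF[OF y] tB by simp
    from fun_cong[OF this, of i] show "face X (Suc m) i ((sec \<circ> G) y) = g i y"
      using i by (simp add: F_def G_def)
  qed
qed

text \<open>The third condition is the matching condition for the next step of the construction.\<close>

definition extra_degeneracy :: "nat \<Rightarrow> ('a \<Rightarrow> 'a) \<Rightarrow> bool" where
  "extra_degeneracy m s \<longleftrightarrow> continuous_map (T m) (T (Suc m)) s \<and>
     (\<forall>x\<in>carrier (obj X m). face X (Suc m) (Suc m) (s x) = x) \<and>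
     (\<forall>x\<in>carrier (obj X (Suc m)). \<forall>i j. i < j \<longrightarrow> j \<le> Suc m \<longrightarrow>
        face X (Suc m) i (s (face X (Suc m) j x)) = face X (Suc m) (j - 1) (s (face X (Suc m) i x)))"

text \<open>The simplex s x has faces \<open>\<sigma>(x) = sec (f x)\<close> and x. It exists
  because x and \<open>\<sigma>(x)\<close> lie in the same class of \<open>\<pi>_0(X)\<close>. The
  matching condition holds since the two faces of a 1-simplex have the same image under f, hence the
  same \<open>\<sigma>\<close>.\<close>

lemma extra_degeneracy_0:
  assumes TG: "Hausdorff_space TG" and f: "continuous_map (T 0) TG f" "f ` carrier (obj X 0) = topspace TG"
    and eq: "\<And>x y. x \<in> carrier (obj X 0) \<Longrightarrow> y \<in> carrier (obj X 0) \<Longrightarrow>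
      f x = f y \<longleftrightarrow> x \<otimes>\<^bsub>obj X 0\<^esub> inv\<^bsub>obj X 0\<^esub> y \<in> moore_boundaries X 0"
  obtains s where "extra_degeneracy 0 s"
proof -
  interpret P: pro_p p "obj X 0" "T 0" by (rule pro_p_obj)
  interpret N: normal "moore_boundaries X 0" "obj X 0" by (rule boundaries_normal)
  \<comment> \<open>Equality under f concerns \<open>y x^-1\<close>. Normality of the boundaries
    converts this to \<open>x^-1 y\<close>, and conjugation by z gives the form needed for the
    product.\<close>
  have heap: "f (z \<otimes>\<^bsub>obj X 0\<^esub> inv\<^bsub>obj X 0\<^esub> x \<otimes>\<^bsub>obj X 0\<^esub> y) = f z"
    if xyz: "x \<in> carrier (obj X 0)" "y \<in> carrier (obj X 0)" "z \<in> carrier (obj X 0)" and fxy: "f x = f y" for x y z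
  proof -
    let ?b = "y \<otimes>\<^bsub>obj X 0\<^esub> inv\<^bsub>obj X 0\<^esub> x"
    have b: "?b \<in> moore_boundaries X 0" using eq[of y x] xyz fxy by simp
    have "inv\<^bsub>obj X 0\<^esub> x \<otimes>\<^bsub>obj X 0\<^esub> y = inv\<^bsub>obj X 0\<^esub> x \<otimes>\<^bsub>obj X 0\<^esub> ?b \<otimes>\<^bsub>obj X 0\<^esub> x" using xyz by (simp add: assoc)
    then have "inv\<^bsub>obj X 0\<^esub> x \<otimes>\<^bsub>obj X 0\<^esub> y \<in> moore_boundaries X 0" using N.inv_op_closed1[OF xyz(1) b] by simp
    then have "z \<otimes>\<^bsub>obj X 0\<^esub> (inv\<^bsub>obj X 0\<^esub> x \<otimes>\<^bsub>obj X 0\<^esub> y) \<otimes>\<^bsub>obj X 0\<^esub> inv\<^bsub>obj X 0\<^esub> z \<in> moore_boundaries X 0"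
      by (rule N.inv_op_closed2[OF xyz(3)])
    then show ?thesis using xyz by (subst eq) (simp_all add: assoc)
  qed
  obtain sec where sec: "continuous_map TG (T 0) sec" "\<And>b. b \<in> topspace TG \<Longrightarrow> f (sec b) = b"
    using P.continuous_section[OF f(1) TG f(2) heap] by blast
  let ?\<sigma> = "\<lambda>x. sec (f x)"
  have c\<sigma>: "continuous_map (T 0) (T 0) ?\<sigma>" using continuous_map_compose[OF f(1) sec(1)] by (simp add: comp_def)
  have \<sigma>: "?\<sigma> x \<in> carrier (obj X 0)" "f (?\<sigma> x) = f x" if x: "x \<in> carrier (obj X 0)" for x
    using continuous_map_image_subset_topspace[OF c\<sigma>] sec(2)[of "f x"] f(2) x by (auto simp: topspace_obj)
  let ?g = "\<lambda>i x. if i = 0 then ?\<sigma> x else x"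
  have cg: "continuous_map (T 0) (T 0) (?g i)" for i :: nat
    using c\<sigma> continuous_map_id[of "T 0"] by (cases "i = 0") (simp_all add: id_def)
  have fill: "\<exists>z\<in>carrier (obj X (Suc 0)). \<forall>i\<le>Suc 0. face X (Suc 0) i z = ?g i x" if "x \<in> topspace (T 0)" for x
  proof -
    have x: "x \<in> carrier (obj X 0)" using that by (simp add: topspace_obj)
    note s = \<sigma>[OF x]
    have "x \<otimes>\<^bsub>obj X 0\<^esub> inv\<^bsub>obj X 0\<^esub> ?\<sigma> x \<in> moore_boundaries X 0" using eq[OF x s(1)] s(2) by simp
    then obtain w where w: "w \<in> moore X (Suc 0)" "face X (Suc 0) (Suc 0) w = x \<otimes>\<^bsub>obj X 0\<^esub> inv\<^bsub>obj X 0\<^esub> ?\<sigma> x"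
      unfolding moore_boundaries_def by (metis imageE)
    have wc: "w \<in> carrier (obj X (Suc 0))" "face X (Suc 0) 0 w = \<one>\<^bsub>obj X 0\<^esub>" using w(1) by (simp_all add: moore_Suc)
    \<comment> \<open>The chain w has faces 1 and \<open>x \<sigma>(x)^-1\<close>. Multiplying on
      the right by the degenerate simplex on \<open>\<sigma>(x)\<close>, whose faces are both
      \<open>\<sigma>(x)\<close>, yields the faces \<open>\<sigma>(x)\<close> and x.\<close>
    let ?z = "w \<otimes>\<^bsub>obj X (Suc 0)\<^esub> degen X 0 0 (?\<sigma> x)"
    have d: "face X (Suc 0) 0 (degen X 0 0 (?\<sigma> x)) = ?\<sigma> x" "face X (Suc 0) (Suc 0) (degen X 0 0 (?\<sigma> x)) = ?\<sigma> x"
      using face_degen[OF s(1), of 0 0] face_degen[OF s(1), of "Suc 0" 0] by simp_all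
    have "face X (Suc 0) 0 ?z = ?\<sigma> x" "face X (Suc 0) (Suc 0) ?z = x"
      using wc w(2) d s(1) x by (simp_all add: assoc)
    then have "\<forall>i\<le>Suc 0. face X (Suc 0) i ?z = ?g i x" by (auto simp: le_Suc_eq)
    moreover have "?z \<in> carrier (obj X (Suc 0))" using wc s(1) by simp
    ultimately show ?thesis by blast
  qed
  obtain s where s: "continuous_map (T 0) (T (Suc 0)) s"
    "\<And>x i. x \<in> topspace (T 0) \<Longrightarrow> i \<le> Suc 0 \<Longrightarrow> face X (Suc 0) i (s x) = ?g i x"
    using continuous_filler[of 0 "T 0" ?g, OF cg fill] by blast
  have s0: "face X (Suc 0) 0 (s x) = ?\<sigma> x" and s1: "face X (Suc 0) (Suc 0) (s x) = x" if "x \<in> carrier (obj X 0)" for x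
    using s(2)[of x 0] s(2)[of x "Suc 0"] that by (simp_all add: topspace_obj)
  \<comment> \<open>Dividing x by the degenerate simplex on its zeroth face makes that face trivial.
    The boundary of the resulting Moore chain is the quotient of the two faces of x.\<close>
  have faces: "f (face X (Suc 0) (Suc 0) x) = f (face X (Suc 0) 0 x)" if x: "x \<in> carrier (obj X (Suc 0))" for x
  proof -
    let ?e = "degen X 0 0 (face X (Suc 0) 0 x)"
    let ?y = "x \<otimes>\<^bsub>obj X (Suc 0)\<^esub> inv\<^bsub>obj X (Suc 0)\<^esub> ?e"
    have fc: "face X (Suc 0) 0 x \<in> carrier (obj X 0)" "face X (Suc 0) (Suc 0) x \<in> carrier (obj X 0)" using x by simp_all
    have d: "face X (Suc 0) 0 ?e = face X (Suc 0) 0 x" "face X (Suc 0) (Suc 0) ?e = face X (Suc 0) 0 x"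
      using face_degen[OF fc(1), of 0 0] face_degen[OF fc(1), of "Suc 0" 0] by simp_all
    have ec: "?e \<in> carrier (obj X (Suc 0))" using fc by simp
    have "?y \<in> moore X (Suc 0)" using x ec fc d by (simp add: moore_Suc)
    then have "face X (Suc 0) (Suc 0) ?y \<in> moore_boundaries X 0" by (simp add: moore_boundaries_def)
    then show ?thesis using eq[OF fc(2,1)] x ec d by simp
  qed
  have "extra_degeneracy 0 s"
    unfolding extra_degeneracy_def
  proof (intro conjI ballI allI impI)
    show "continuous_map (T 0) (T (Suc 0)) s" by (rule s(1))
    show "face X (Suc 0) (Suc 0) (s x) = x" if "x \<in> carrier (obj X 0)" for x by (rule s1[OF that])
    fix x and i j :: nat assume x: "x \<in> carrier (obj X (Suc 0))" and ij: "i < j" "j \<le> Suc 0"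
    then have "i = 0" "j = Suc 0" by auto
    then show "face X (Suc 0) i (s (face X (Suc 0) j x)) = face X (Suc 0) (j - 1) (s (face X (Suc 0) i x))"
      using s0 x faces[OF x] by simp
  qed
  then show ?thesis by (rule that)
qed

text \<open>The prescribed faces of the new value at x are the \<open>s (d_i x)\<close>, followed by
  x itself. They agree among one another by the matching condition on s and with x by the section
  property, so they fill. The simplicial identity between the faces of x yields the matching
  condition for the next stage.\<close>

lemma extra_degeneracy_Suc:
  assumes s: "extra_degeneracy m s" and acyclic: "moore_cycles X (Suc m) \<subseteq> moore_boundaries X (Suc m)"
  obtains s' where "extra_degeneracy (Suc m) s'"
    "\<And>x i. x \<in> carrier (obj X (Suc m)) \<Longrightarrow> i \<le> Suc m \<Longrightarrow> face X (Suc (Suc m)) i (s' x) = s (face X (Suc m) i x)"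
proof -
  have cs: "continuous_map (T m) (T (Suc m)) s"
    and sec: "\<And>x. x \<in> carrier (obj X m) \<Longrightarrow> face X (Suc m) (Suc m) (s x) = x"
    and match: "\<And>x i j. x \<in> carrier (obj X (Suc m)) \<Longrightarrow> i < j \<Longrightarrow> j \<le> Suc m \<Longrightarrow>
        face X (Suc m) i (s (face X (Suc m) j x)) = face X (Suc m) (j - 1) (s (face X (Suc m) i x))"
    using s unfolding extra_degeneracy_def by blast+
  have sc: "s x \<in> carrier (obj X (Suc m))" if "x \<in> carrier (obj X m)" for x
    using continuous_map_image_subset_topspace[OF cs] that by (auto simp: topspace_obj)
  let ?g = "\<lambda>i x. if i \<le> Suc m then s (face X (Suc m) i x) else x"
  have cg: "continuous_map (T (Suc m)) (T (Suc m)) (?g i)" for i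
  proof (cases "i \<le> Suc m")
    case True
    then show ?thesis using continuous_map_compose[OF face_continuous[OF True] cs] by (simp add: comp_def)
  next
    case False
    then show ?thesis using continuous_map_id[of "T (Suc m)"] by (simp add: id_def)
  qed
  have fill: "\<exists>z\<in>carrier (obj X (Suc (Suc m))). \<forall>i\<le>Suc (Suc m). face X (Suc (Suc m)) i z = ?g i x"
    if "x \<in> topspace (T (Suc m))" for x
  proof (rule sphere_filler[OF acyclic])
    have x: "x \<in> carrier (obj X (Suc m))" using that by (simp add: topspace_obj)
    show "?g i x \<in> carrier (obj X (Suc m))" if "i \<le> Suc (Suc m)" for i using x sc by simp
    show "face X (Suc m) i (?g j x) = face X (Suc m) (j - 1) (?g i x)" if "i < j" "j \<le> Suc (Suc m)" for i j
    proof (cases "j \<le> Suc m")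
      case True
      then show ?thesis using match[OF x \<open>i < j\<close> True] \<open>i < j\<close> by simp
    next
      case False
      then have "j = Suc (Suc m)" "i \<le> Suc m" using that by auto
      then show ?thesis using sec[of "face X (Suc m) i x"] x by simp
    qed
  qed
  obtain s' where s': "continuous_map (T (Suc m)) (T (Suc (Suc m))) s'"
    "\<And>x i. x \<in> topspace (T (Suc m)) \<Longrightarrow> i \<le> Suc (Suc m) \<Longrightarrow> face X (Suc (Suc m)) i (s' x) = ?g i x"
    using continuous_filler[of "Suc m" "T (Suc m)" ?g, OF cg fill] by blast
  have f': "face X (Suc (Suc m)) i (s' x) = s (face X (Suc m) i x)" if "x \<in> carrier (obj X (Suc m))" "i \<le> Suc m" for x i
    using s'(2)[of x i] that by (simp add: topspace_obj)
  have "extra_degeneracy (Suc m) s'"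
    unfolding extra_degeneracy_def
  proof (intro conjI ballI allI impI)
    show "continuous_map (T (Suc m)) (T (Suc (Suc m))) s'" by (rule s'(1))
    show "face X (Suc (Suc m)) (Suc (Suc m)) (s' x) = x" if "x \<in> carrier (obj X (Suc m))" for x
      using s'(2)[of x "Suc (Suc m)"] that by (simp add: topspace_obj)
    fix x i j assume x: "x \<in> carrier (obj X (Suc (Suc m)))" and ij: "i < j" "j \<le> Suc (Suc m)"
    have "face X (Suc (Suc m)) i (s' (face X (Suc (Suc m)) j x)) = s (face X (Suc m) i (face X (Suc (Suc m)) j x))"
      using f'[of "face X (Suc (Suc m)) j x" i] x ij by simp
    also have "\<dots> = s (face X (Suc m) (j - 1) (face X (Suc (Suc m)) i x))"
      using face_face[OF x ij] by simp
    also have "\<dots> = face X (Suc (Suc m)) (j - 1) (s' (face X (Suc (Suc m)) i x))"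
      using f'[of "face X (Suc (Suc m)) i x" "j - 1"] x ij by simp
    finally show "face X (Suc (Suc m)) i (s' (face X (Suc (Suc m)) j x)) =
        face X (Suc (Suc m)) (j - 1) (s' (face X (Suc (Suc m)) i x))" .
  qed
  then show ?thesis using f' by (rule that)
qed

text \<open>The choice is dependent: each map prescribes the faces of the next one, so the
  commutation with faces has to be carried along the sequence.\<close>

lemma extra_degeneracy_step_exists:
  assumes s0: "extra_degeneracy 0 s0" and acyclic: "\<And>m. moore_cycles X (Suc m) \<subseteq> moore_boundaries X (Suc m)"
  obtains s where "\<And>m. extra_degeneracy m (s m)"
    "\<And>m x i. x \<in> carrier (obj X (Suc m)) \<Longrightarrow> i \<le> Suc m \<Longrightarrow>
       face X (Suc (Suc m)) i (s (Suc m) x) = s m (face X (Suc m) i x)"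
proof -
  let ?Q = "\<lambda>m s s'. \<forall>x\<in>carrier (obj X (Suc m)). \<forall>i\<le>Suc m. face X (Suc (Suc m)) i (s' x) = s (face X (Suc m) i x)"
  have "\<exists>s'. extra_degeneracy (Suc m) s' \<and> ?Q m s s'" if sm: "extra_degeneracy m s" for m s
  proof -
    obtain s' where "extra_degeneracy (Suc m) s'"
      "\<And>x i. x \<in> carrier (obj X (Suc m)) \<Longrightarrow> i \<le> Suc m \<Longrightarrow> face X (Suc (Suc m)) i (s' x) = s (face X (Suc m) i x)"
      using extra_degeneracy_Suc[OF sm acyclic] by blast
    then show ?thesis by blast
  qed
  with s0 obtain s where "\<And>m. extra_degeneracy m (s m)" "\<And>m. ?Q m (s m) (s (Suc m))"
    using dependent_nat_choice[of extra_degeneracy ?Q] by blast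
  then show ?thesis by (intro that[of s]) blast+
qed

end

section \<open>The simplicial completed group algebra\<close>

context simplicial_pro_p
begin

lemma pair_obj: "pro_p_pair p (obj X m) (T m) (obj X k) (T k)"
  by (simp add: pro_p_pair_def pro_p_obj)

abbreviation "Alg m \<equiv> completed_group_algebra p (obj X m) (T m)"
abbreviation "push m k \<equiv> pro_p_pair.cga_push p (obj X m) (T m) (obj X k) (T k)"
abbreviation "Y \<equiv> cga_simplicial p X T"

lemma ring_Alg: "ring (Alg m)"
  by (rule pro_p.ring_A[OF pro_p_obj])

lemmas push_closed = pro_p_pair.cga_push_closed[OF pair_obj]
lemmas push_zero = pro_p_pair.cga_push_zero[OF pair_obj]
lemmas push_add = pro_p_pair.cga_push_add[OF pair_obj]
lemmas push_comp = cga_push_comp[OF pair_obj pair_obj]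
lemmas push_cong = pro_p_pair.cga_push_cong[OF pair_obj]
lemmas push_id = pro_p.cga_push_id[OF pro_p_obj]

lemma obj_Y: "obj Y m = add_monoid (Alg m)"
  by (simp add: cga_simplicial_def)

lemma face_hom_X: "i \<le> Suc m \<Longrightarrow> face X (Suc m) i \<in> hom (obj X (Suc m)) (obj X m)"
  using face_hom[of i m] by (simp add: group_hom_def group_hom_axioms_def)

lemma degen_hom_X: "i \<le> m \<Longrightarrow> degen X m i \<in> hom (obj X m) (obj X (Suc m))"
  using degen_hom[of i m] by (simp add: group_hom_def group_hom_axioms_def)

lemma face_Y: "i \<le> Suc m \<Longrightarrow> c \<in> carrier (Alg (Suc m)) \<Longrightarrow>
    face Y (Suc m) i c = push (Suc m) m (face X (Suc m) i) c"
  using pro_p_pair.cga_map_eq_push[OF pair_obj face_continuous face_hom_X] by (simp add: cga_simplicial_def)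

lemma degen_Y: "i \<le> m \<Longrightarrow> c \<in> carrier (Alg m) \<Longrightarrow> degen Y m i c = push m (Suc m) (degen X m i) c"
  using pro_p_pair.cga_map_eq_push[OF pair_obj degen_continuous degen_hom_X] by (simp add: cga_simplicial_def)

lemma continuous_comp:
  "continuous_map (T m) (T k) f \<Longrightarrow> continuous_map (T k) (T l) g \<Longrightarrow> continuous_map (T m) (T l) (\<lambda>x. g (f x))"
  using continuous_map_compose[of "T m" "T k" f "T l" g] by (simp add: comp_def)

lemma continuous_id: "continuous_map (T m) (T m) (\<lambda>x. x)"
  using continuous_map_id[of "T m"] by (simp add: id_def)

text \<open>It transfers an identity between composites of continuous maps, such as a simplicial
  identity of X, to the completed group algebras.\<close>

lemma push_push_cong:
  assumes "continuous_map (T m) (T k) f" "continuous_map (T k) (T l) g"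
    and "continuous_map (T m) (T k') f'" "continuous_map (T k') (T l) g'"
    and "\<And>x. x \<in> carrier (obj X m) \<Longrightarrow> g (f x) = g' (f' x)" and "c \<in> carrier (Alg m)"
  shows "push k l g (push m k f c) = push k' l g' (push m k' f' c)"
  unfolding push_comp[OF assms(1,2,6)] push_comp[OF assms(3,4,6)]
  by (rule push_cong[OF continuous_comp[OF assms(1,2)] continuous_comp[OF assms(3,4)] assms(5,6)])

lemma push_push_id:
  assumes "continuous_map (T m) (T k) f" "continuous_map (T k) (T m) g"
    and "\<And>x. x \<in> carrier (obj X m) \<Longrightarrow> g (f x) = x" and "c \<in> carrier (Alg m)"
  shows "push k m g (push m k f c) = c"
proof -
  have "push k m g (push m k f c) = push m m (\<lambda>x. x) c"
    unfolding push_comp[OF assms(1,2,4)]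
    by (rule push_cong[OF continuous_comp[OF assms(1,2)] continuous_id assms(3,4)])
  then show ?thesis using push_id[OF assms(4)] by simp
qed

lemma simplicial_Y: "simplicial_group Y"
  unfolding simplicial_group_def
proof (intro conjI allI impI ballI)
  show "group (obj Y m)" for m
    unfolding obj_Y by (rule abelian_group.a_group[OF ring.axioms(1)[OF ring_Alg]])
next
  fix m i :: nat assume i: "i \<le> Suc m"
  show "face Y (Suc m) i \<in> hom (obj Y (Suc m)) (obj Y m)"
  proof (rule homI)
    fix c assume c: "c \<in> carrier (obj Y (Suc m))"
    then show "face Y (Suc m) i c \<in> carrier (obj Y m)"
      using push_closed[OF face_continuous[OF i]] by (simp add: obj_Y face_Y[OF i])
    fix d assume d: "d \<in> carrier (obj Y (Suc m))"
    show "face Y (Suc m) i (c \<otimes>\<^bsub>obj Y (Suc m)\<^esub> d) = face Y (Suc m) i c \<otimes>\<^bsub>obj Y m\<^esub> face Y (Suc m) i d"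
      using c d push_add[OF face_continuous[OF i]] pro_p.A_add_closed[OF pro_p_obj, of c "Suc m" d]
      by (simp add: obj_Y face_Y[OF i])
  qed
next
  fix m i :: nat assume i: "i \<le> m"
  show "degen Y m i \<in> hom (obj Y m) (obj Y (Suc m))"
  proof (rule homI)
    fix c assume c: "c \<in> carrier (obj Y m)"
    then show "degen Y m i c \<in> carrier (obj Y (Suc m))"
      using push_closed[OF degen_continuous[OF i]] by (simp add: obj_Y degen_Y[OF i])
    fix d assume d: "d \<in> carrier (obj Y m)"
    show "degen Y m i (c \<otimes>\<^bsub>obj Y m\<^esub> d) = degen Y m i c \<otimes>\<^bsub>obj Y (Suc m)\<^esub> degen Y m i d"
      using c d push_add[OF degen_continuous[OF i]] pro_p.A_add_closed[OF pro_p_obj, of c m d]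
      by (simp add: obj_Y degen_Y[OF i])
  qed
next
  fix m i j :: nat and c assume c: "c \<in> carrier (obj Y (Suc (Suc m)))" and ij: "i < j \<and> j \<le> Suc (Suc m)"
  then have i: "i \<le> Suc m" "i \<le> Suc (Suc m)" "j \<le> Suc (Suc m)" "j - 1 \<le> Suc m" by auto
  have cA: "c \<in> carrier (Alg (Suc (Suc m)))" using c by (simp add: obj_Y)
  show "face Y (Suc m) i (face Y (Suc (Suc m)) j c) = face Y (Suc m) (j - 1) (face Y (Suc (Suc m)) i c)"
    unfolding face_Y[OF i(3) cA] face_Y[OF i(2) cA]
      face_Y[OF i(1) push_closed[OF face_continuous[OF i(3)] cA]]
      face_Y[OF i(4) push_closed[OF face_continuous[OF i(2)] cA]]
    by (rule push_push_cong[OF face_continuous[OF i(3)] face_continuous[OF i(1)]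
          face_continuous[OF i(2)] face_continuous[OF i(4)] _ cA])
      (use ij in \<open>simp add: face_face\<close>)
next
  fix m i j :: nat and c assume c: "c \<in> carrier (obj Y m)" and ij: "i \<le> Suc m \<and> j \<le> m"
  then have i: "i \<le> Suc m" and j: "j \<le> m" by auto
  have cA: "c \<in> carrier (Alg m)" using c by (simp add: obj_Y)
  have l: "face Y (Suc m) i (degen Y m j c) = push (Suc m) m (face X (Suc m) i) (push m (Suc m) (degen X m j) c)"
    unfolding degen_Y[OF j cA] face_Y[OF i push_closed[OF degen_continuous[OF j] cA]] ..
  consider "i < j" | "i = j \<or> i = Suc j" | "Suc j < i" by linarith
  then show "face Y (Suc m) i (degen Y m j c) =
      (if i < j then degen Y (m - 1) (j - 1) (face Y m i c)
       else if i = j \<or> i = Suc j then c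
       else degen Y (m - 1) j (face Y m (i - 1) c))"
  proof cases
    case 1
    then obtain m' where m: "m = Suc m'" using j by (cases m) auto
    have i': "i \<le> Suc m'" and j': "j - 1 \<le> m'" using 1 j m by auto
    have cA': "c \<in> carrier (Alg (Suc m'))" using cA m by simp
    have "push (Suc m) m (face X (Suc m) i) (push m (Suc m) (degen X m j) c) =
        push m' m (degen X m' (j - 1)) (push m m' (face X m i) c)"
      unfolding m
      by (rule push_push_cong[OF degen_continuous[OF j[unfolded m]] face_continuous[OF i[unfolded m]]
            face_continuous[OF i'] degen_continuous[OF j'] _ cA'])
        (use 1 i j m face_degen[of _ "Suc m'" i j] in simp)
    then show ?thesis
      using 1 l degen_Y[OF j' push_closed[OF face_continuous[OF i'] cA']] face_Y[OF i' cA'] by (simp add: m)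
  next
    case 2
    have "push (Suc m) m (face X (Suc m) i) (push m (Suc m) (degen X m j) c) = c"
      by (rule push_push_id[OF degen_continuous[OF j] face_continuous[OF i] _ cA])
        (use 2 i j face_degen[of _ m i j] in auto)
    then show ?thesis using 2 l by auto
  next
    case 3
    then obtain m' where m: "m = Suc m'" using i by (cases m) auto
    have i': "i - 1 \<le> Suc m'" and j': "j \<le> m'" using 3 i m by auto
    have cA': "c \<in> carrier (Alg (Suc m'))" using cA m by simp
    have "push (Suc m) m (face X (Suc m) i) (push m (Suc m) (degen X m j) c) =
        push m' m (degen X m' j) (push m m' (face X m (i - 1)) c)"
      unfolding m
      by (rule push_push_cong[OF degen_continuous[OF j[unfolded m]] face_continuous[OF i[unfolded m]]
            face_continuous[OF i'] degen_continuous[OF j'] _ cA'])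
        (use 3 i j m face_degen[of _ "Suc m'" i j] in simp)
    then show ?thesis
      using 3 l degen_Y[OF j' push_closed[OF face_continuous[OF i'] cA']] face_Y[OF i' cA'] by (simp add: m)
  qed
next
  fix m i j :: nat and c assume c: "c \<in> carrier (obj Y m)" and ij: "i \<le> j \<and> j \<le> m"
  then have i: "i \<le> m" "j \<le> m" "i \<le> Suc m" "Suc j \<le> Suc m" by auto
  have cA: "c \<in> carrier (Alg m)" using c by (simp add: obj_Y)
  show "degen Y (Suc m) i (degen Y m j c) = degen Y (Suc m) (Suc j) (degen Y m i c)"
    unfolding degen_Y[OF i(2) cA] degen_Y[OF i(1) cA]
      degen_Y[OF i(3) push_closed[OF degen_continuous[OF i(2)] cA]]
      degen_Y[OF i(4) push_closed[OF degen_continuous[OF i(1)] cA]]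
    by (rule push_push_cong[OF degen_continuous[OF i(2)] degen_continuous[OF i(3)]
          degen_continuous[OF i(1)] degen_continuous[OF i(4)] _ cA])
      (use ij in \<open>simp add: degen_degen\<close>)
qed

sublocale Y: simplicial_grp Y
  by unfold_locales (rule simplicial_Y)

text \<open>The map induced by s is additive although s is not a homomorphism, so it sends zero to
  zero. For a cycle c the faces of the image that should vanish are images under the previous map of
  the faces of c, which are zero; the last face returns c.\<close>

lemma acyclic_Y:
  assumes s0: "extra_degeneracy 0 s0" and acyclic: "\<And>m. moore_cycles X (Suc m) \<subseteq> moore_boundaries X (Suc m)"
  shows "moore_cycles Y (Suc m) \<subseteq> moore_boundaries Y (Suc m)"
proof
  obtain s where s: "\<And>m. extra_degeneracy m (s m)"
    and step: "\<And>m x i. x \<in> carrier (obj X (Suc m)) \<Longrightarrow> i \<le> Suc m \<Longrightarrow>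
       face X (Suc (Suc m)) i (s (Suc m) x) = s m (face X (Suc m) i x)"
    using extra_degeneracy_step_exists[OF s0 acyclic] by blast
  have cs: "continuous_map (T m) (T (Suc m)) (s m)" for m
    using s[of m] unfolding extra_degeneracy_def by blast
  have sec: "face X (Suc m) (Suc m) (s m x) = x" if "x \<in> carrier (obj X m)" for m x
    using s[of m] that unfolding extra_degeneracy_def by blast
  fix c assume "c \<in> moore_cycles Y (Suc m)"
  then have c: "c \<in> carrier (Alg (Suc m))"
    and d: "\<And>i. i \<le> Suc m \<Longrightarrow> push (Suc m) m (face X (Suc m) i) c = \<zero>\<^bsub>Alg m\<^esub>"
    using face_Y by (auto simp: Y.moore_cycles_Suc obj_Y)
  define y where "y = push (Suc m) (Suc (Suc m)) (s (Suc m)) c"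
  have y: "y \<in> carrier (Alg (Suc (Suc m)))" unfolding y_def by (rule push_closed[OF cs c])
  have "face Y (Suc (Suc m)) i y = \<zero>\<^bsub>Alg (Suc m)\<^esub>" if i: "i \<le> Suc m" for i
  proof -
    have i': "i \<le> Suc (Suc m)" using i by simp
    have "face Y (Suc (Suc m)) i y = push m (Suc m) (s m) (push (Suc m) m (face X (Suc m) i) c)"
      unfolding face_Y[OF i' y] unfolding y_def
      by (rule push_push_cong[OF cs face_continuous[OF i'] face_continuous[OF i] cs _ c]) (rule step[OF _ i])
    then show ?thesis using d[OF i] push_zero[OF cs] by simp
  qed
  then have ym: "y \<in> moore Y (Suc (Suc m))" using y by (simp add: Y.moore_Suc obj_Y)
  have "face Y (Suc (Suc m)) (Suc (Suc m)) y = c"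
    unfolding face_Y[OF order_refl y] unfolding y_def
    by (rule push_push_id[OF cs face_continuous[OF order_refl] sec c])
  then show "c \<in> moore_boundaries Y (Suc m)" using ym unfolding moore_boundaries_def by blast
qed

lemma compact_filtered_M: "compact_filtered_simplicial X (M_filtration p X T) T"
proof (intro compact_filtered_simplicial.intro filtered_simplicial.intro filtered_simplicial_axioms.intro
    compact_filtered_simplicial_axioms.intro)
  show "simplicial_grp X" by (rule simplicial_grp_axioms)
next
  fix n m i x
  show "M_filtration p X T n m \<lhd> obj X m"
    unfolding M_filtration_def by (rule pro_p.normal_MM[OF pro_p_obj])
  show "face X (Suc m) i x \<in> M_filtration p X T n m" if "x \<in> M_filtration p X T n (Suc m)" "i \<le> Suc m"
    using pro_p_pair.MM_image[OF pair_obj face_continuous face_hom_X] that by (simp add: M_filtration_def)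
  show "degen X m i x \<in> M_filtration p X T n (Suc m)" if "x \<in> M_filtration p X T n m" "i \<le> m"
    using pro_p_pair.MM_image[OF pair_obj degen_continuous degen_hom_X] that by (simp add: M_filtration_def)
  show "M_filtration p X T 0 m = carrier (obj X m)"
    unfolding M_filtration_def by (rule pro_p.MM_0[OF pro_p_obj])
  show "M_filtration p X T (Suc n) m \<subseteq> M_filtration p X T n m"
    unfolding M_filtration_def by (rule pro_p.MM_Suc[OF pro_p_obj])
  show "topological_group_on (obj X m) (T m)" "compact_space (T m)" "Hausdorff_space (T m)"
    by (rule pro_p.top_group[OF pro_p_obj] pro_p.compact_T[OF pro_p_obj] pro_p.Hausdorff_T[OF pro_p_obj])+
  show "continuous_map (T (Suc m)) (T m) (face X (Suc m) i)" if "i \<le> Suc m"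
    using that by (rule face_continuous)
  show "closedin (T m) (M_filtration p X T n m)"
    unfolding M_filtration_def by (rule pro_p.closedin_MM[OF pro_p_obj])
  show "x = \<one>\<^bsub>obj X m\<^esub>" if "\<And>n. x \<in> M_filtration p X T n m"
    using that unfolding M_filtration_def by (rule pro_p.MM_Inter[OF pro_p_obj])
qed

sublocale MF: compact_filtered_simplicial X "M_filtration p X T" T
  by (rule compact_filtered_M)

lemma compact_filtered_Delta: "compact_filtered_simplicial Y (Delta_filtration p X T) (\<lambda>m. cga_topology p (obj X m) (T m))"
proof (intro compact_filtered_simplicial.intro filtered_simplicial.intro filtered_simplicial_axioms.intro
    compact_filtered_simplicial_axioms.intro)
  show "simplicial_grp Y" by (rule Y.simplicial_grp_axioms)
next
  fix n m i x
  show "Delta_filtration p X T n m \<lhd> obj Y m"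
    unfolding Delta_filtration_def obj_Y
    using comm_group.subgroup_imp_normal[OF abelian_group.a_comm_group[OF ring.axioms(1)[OF ring_Alg]]
        additive_subgroup.a_subgroup[OF ideal.axioms(1)[OF pro_p.ideal_Delta[OF pro_p_obj]]]] .
  show "face Y (Suc m) i x \<in> Delta_filtration p X T n m" if "x \<in> Delta_filtration p X T n (Suc m)" "i \<le> Suc m"
    using pro_p_pair.cga_push_Delta[OF pair_obj face_continuous face_hom_X, of i m x n] that
      face_Y[OF that(2) pro_p.Delta_carrier[OF pro_p_obj]] by (simp add: Delta_filtration_def)
  show "degen Y m i x \<in> Delta_filtration p X T n (Suc m)" if "x \<in> Delta_filtration p X T n m" "i \<le> m"
    using pro_p_pair.cga_push_Delta[OF pair_obj degen_continuous degen_hom_X, of i m x n] that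
      degen_Y[OF that(2) pro_p.Delta_carrier[OF pro_p_obj]] by (simp add: Delta_filtration_def)
  show "Delta_filtration p X T 0 m = carrier (obj Y m)"
    using pro_p.Delta_0[OF pro_p_obj] by (simp add: Delta_filtration_def obj_Y)
  show "Delta_filtration p X T (Suc n) m \<subseteq> Delta_filtration p X T n m"
    unfolding Delta_filtration_def by (rule pro_p.Delta_Suc[OF pro_p_obj])
  show "topological_group_on (obj Y m) (cga_topology p (obj X m) (T m))"
    unfolding obj_Y by (rule pro_p.topological_group_A[OF pro_p_obj])
  show "compact_space (cga_topology p (obj X m) (T m))" "Hausdorff_space (cga_topology p (obj X m) (T m))"
    by (rule pro_p.compact_CT[OF pro_p_obj] pro_p.Hausdorff_CT[OF pro_p_obj])+
  show "continuous_map (cga_topology p (obj X (Suc m)) (T (Suc m))) (cga_topology p (obj X m) (T m)) (face Y (Suc m) i)"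
    if "i \<le> Suc m"
    by (rule continuous_map_eq[OF pro_p_pair.continuous_cga_push[OF pair_obj face_continuous[OF that]]])
      (simp add: face_Y[OF that] pro_p.topspace_CT[OF pro_p_obj])
  show "closedin (cga_topology p (obj X m) (T m)) (Delta_filtration p X T n m)"
    unfolding Delta_filtration_def by (rule pro_p.closedin_Delta[OF pro_p_obj])
  show "x = \<one>\<^bsub>obj Y m\<^esub>" if "\<And>n. x \<in> Delta_filtration p X T n m"
    using pro_p.Delta_Inter[OF pro_p_obj, of x m] that by (simp add: Delta_filtration_def obj_Y)
qed

sublocale DF: compact_filtered_simplicial Y "Delta_filtration p X T" "\<lambda>m. cga_topology p (obj X m) (T m)"
  by (rule compact_filtered_Delta)

end

section \<open>Conclusion for free simplicial pro-p resolutions\<close>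

lemma trivial_homotopy_const:
  assumes "group G"
  shows "trivial_group (homotopy_group (const_simplicial G) (Suc m))"
proof -
  have "simplicial_group (const_simplicial G)"
    using assms by (auto simp: simplicial_group_def const_simplicial_def hom_def)
  then interpret C: simplicial_grp "const_simplicial G" by unfold_locales
  have "moore_cycles (const_simplicial G) (Suc m) \<subseteq> {\<one>\<^bsub>obj (const_simplicial G) (Suc m)\<^esub>}"
    by (auto simp: C.moore_cycles_Suc) (auto simp: const_simplicial_def)
  then show ?thesis
    unfolding C.trivial_homotopy_iff using subgroup.one_closed[OF C.subgroup_boundaries[of "Suc m"]] by blast
qed

lemma trivial_groups_iso:
  assumes "trivial_group G" "trivial_group H"
  shows "G \<cong> H"
proof -
  interpret G: group G using assms by (simp add: trivial_group_def)
  interpret H: group H using assms by (simp add: trivial_group_def)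
  have "carrier G = {\<one>\<^bsub>G\<^esub>}" "carrier H = {\<one>\<^bsub>H\<^esub>}" using assms by (simp_all add: trivial_group_def)
  then have "(\<lambda>_. \<one>\<^bsub>H\<^esub>) \<in> iso G H" by (auto simp: iso_def hom_def bij_betw_def)
  then show ?thesis by (auto simp: is_iso_def)
qed

theorem mainTheorem9:
  fixes p :: nat
    and G :: "'b monoid" and TG :: "'b topology"
    and X :: "'a simplicial" and T :: "nat \<Rightarrow> 'a topology"
    and m :: nat
  assumes "prime p"
    and "pro_p_group p G TG"
    and "free_simplicial_pro_p_resolution p X T G TG"
    and "m > 0"
  shows "converges_to (M_couple p X T) m (homotopy_group X m) (limit_map X (M_filtration p X T) m)
       \<and> homotopy_group X m \<cong> homotopy_group (const_simplicial G) m
       \<and> trivial_group (homotopy_group (const_simplicial G) m)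
       \<and> (\<forall>n. trivial_group (E_infinity (M_couple p X T) n m))
       \<and> converges_to (Delta_couple p X T) m (homology_group p X T m)
           (limit_map (cga_simplicial p X T) (Delta_filtration p X T) m)
       \<and> trivial_group (homology_group p X T m)
       \<and> (\<forall>n. trivial_group (E_infinity (Delta_couple p X T) n m))"
proof -
  have X: "simplicial_pro_p_group p X T"
    and triv: "\<And>m. m > 0 \<Longrightarrow> trivial_group (homotopy_group X m)"
    using assms(3) by (simp_all add: free_simplicial_pro_p_resolution_def)
  obtain \<phi> where \<phi>: "\<phi> \<in> iso (homotopy_group X 0) G"
    and quotient: "quotient_map (T 0) TG (\<lambda>x. \<phi> (homotopy_class X 0 x))"
    using assms(3) unfolding free_simplicial_pro_p_resolution_def by blast
  have "simplicial_group X" using X by (simp add: simplicial_pro_p_group_def)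
  then interpret simplicial_pro_p X p T
    using X assms(1) by unfold_locales
  have acyclic: "moore_cycles X (Suc k) \<subseteq> moore_boundaries X (Suc k)" for k
    using triv[of "Suc k"] by (simp add: trivial_homotopy_iff)
  have G: "group G" and TG: "Hausdorff_space TG"
    using assms(2) by (simp_all add: pro_p_group_def topological_group_on_def)
  \<comment> \<open>The target of the section is G with its given topology: the quotient map
    identifies the classes of \<open>\<pi>_0(X)\<close> with points of a Hausdorff space, and
    injectivity of \<phi> makes its fibres exactly the cosets of the boundaries.\<close>
  obtain s0 where s0: "extra_degeneracy 0 s0"
  proof (rule extra_degeneracy_0[OF TG])
    show "continuous_map (T 0) TG (\<lambda>x. \<phi> (homotopy_class X 0 x))"
      using quotient by (rule quotient_imp_continuous_map)
    show "(\<lambda>x. \<phi> (homotopy_class X 0 x)) ` carrier (obj X 0) = topspace TG"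
      using quotient_imp_surjective_map[OF quotient] by (simp add: topspace_obj)
    fix x y assume xy: "x \<in> carrier (obj X 0)" "y \<in> carrier (obj X 0)"
    then have "homotopy_class X 0 x \<in> carrier (homotopy_group X 0)" "homotopy_class X 0 y \<in> carrier (homotopy_group X 0)"
      by (simp_all add: carrier_homotopy moore_cycles_0)
    moreover have "inj_on \<phi> (carrier (homotopy_group X 0))" using \<phi> by (simp add: iso_def bij_betw_def)
    ultimately have "\<phi> (homotopy_class X 0 x) = \<phi> (homotopy_class X 0 y) \<longleftrightarrow> homotopy_class X 0 x = homotopy_class X 0 y"
      by (simp add: inj_on_eq_iff)
    then show "\<phi> (homotopy_class X 0 x) = \<phi> (homotopy_class X 0 y) \<longleftrightarrow>
        x \<otimes>\<^bsub>obj X 0\<^esub> inv\<^bsub>obj X 0\<^esub> y \<in> moore_boundaries X 0"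
      using homotopy_class_eq_iff[OF xy] by simp
  qed
  obtain k where m: "m = Suc k" using assms(4) by (cases m) auto
  have acY: "moore_cycles Y (Suc k) \<subseteq> moore_boundaries Y (Suc k)"
    by (rule acyclic_Y[OF s0 acyclic])
  have const: "trivial_group (homotopy_group (const_simplicial G) m)"
    unfolding m by (rule trivial_homotopy_const[OF G])
  show ?thesis
  proof (intro conjI allI)
    show "converges_to (M_couple p X T) m (homotopy_group X m) (limit_map X (M_filtration p X T) m)"
      unfolding m M_couple_def by (rule MF.converges_to_zero_of_acyclic(2)[OF acyclic])
    show "homotopy_group X m \<cong> homotopy_group (const_simplicial G) m"
      by (rule trivial_groups_iso[OF triv[OF assms(4)] const])
    show "trivial_group (E_infinity (M_couple p X T) n m)" for n
      unfolding m M_couple_def by (rule MF.converges_to_zero_of_acyclic(1)[OF acyclic])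
    show "converges_to (Delta_couple p X T) m (homology_group p X T m)
        (limit_map (cga_simplicial p X T) (Delta_filtration p X T) m)"
      unfolding m Delta_couple_def homology_group_def by (rule DF.converges_to_zero_of_acyclic(2)[OF acY])
    show "trivial_group (homology_group p X T m)"
      unfolding m homology_group_def using acY by (simp add: Y.trivial_homotopy_iff)
    show "trivial_group (E_infinity (Delta_couple p X T) n m)" for n
      unfolding m Delta_couple_def by (rule DF.converges_to_zero_of_acyclic(1)[OF acY])
  qed (rule const)
qed

end
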